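(* Let $L$ be a nilpotent Lie algebra over $\mathbb{Z}$ of class $2$ that is free of finite rank as an abelian group, and let $G$ be the torsion-free finitely generated nilpotent group of class $2$, unique up to isomorphism, such that $L\cong L(G)$ as Lie algebras. Then $$\zeta^i_G(s)=\zeta^i_L(s)\quad\text{and}\quad\zeta^\wedge_G(s)=\zeta^\wedge_L(s).$$
   Context: For a torsion-free finitely generated nilpotent group $G$ of class $2$ with center $Z$, $L(G)=(G/Z)\oplus Z$ is the Lie algebra over $\mathbb{Z}$ with bracket induced by the commutator of $G$: $[(xZ,a),(yZ,b)]=(1,[x,y])$, where $[x,y]=x^{-1}y^{-1}xy$ (the abelian group $L(G)$ is free of finite rank). By the class-two Lie correspondence (known), every $L$ as in the claim is isomorphic to $L(G)$ for such a $G$, unique up to isomorphism. Zeta functions of groups: $\zeta^i_G(s)=\sum_{n>0}\#\mathcal{S}^i_n(G)n^{-s}$ and $\zeta^\wedge_G(s)=\sum_{n>0}\#\mathcal{S}^\wedge_n(G)n^{-s}$, where $\mathcal{S}^i_n(G)$ (resp. $\mathcal{S}^\wedge_n(G)$) is the set of subgroups $H$ of $G$ of index $n$ with $H\cong G$ as groups (resp. $\widehat H\cong\widehat G$ as topological groups, $\widehat{\ }$ denoting profinite completion). Zeta functions of algebras: $\zeta^i_L(s)=\sum_{n>0}a^i_n(L)n^{-s}$ and $\zeta^\wedge_L(s)=\sum_{n>0}a^\wedge_n(L)n^{-s}$, where $a^i_n(L)$ (resp. $a^\wedge_n(L)$) is the number of subalgebras $M$ of $L$ of index $n$ with $M\cong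 L$ as algebras (resp. $M\otimes\widehat{\mathbb{Z}}\cong L\otimes\widehat{\mathbb{Z}}$ as algebras over $\widehat{\mathbb{Z}}$). *)

theory Defs
  imports "HOL-Analysis.Analysis" "HOL-Algebra.Algebra"
begin

section \<open>Nilpotent groups\<close>

definition group_commutator :: "('g, 'm) monoid_scheme \<Rightarrow> 'g \<Rightarrow> 'g \<Rightarrow> 'g"
  where "group_commutator G x y = inv\<^bsub>G\<^esub> x \<otimes>\<^bsub>G\<^esub> inv\<^bsub>G\<^esub> y \<otimes>\<^bsub>G\<^esub> x \<otimes>\<^bsub>G\<^esub> y"

definition group_center :: "('g, 'm) monoid_scheme \<Rightarrow> 'g set"
  where "group_center G = {z \<in> carrier G. \<forall>x \<in> carrier G. z \<otimes>\<^bsub>G\<^esub> x = x \<otimes>\<^bsub>G\<^esub> z}"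

text \<open>Both lower central series below are indexed from 0: the term with index \<open>n\<close> is the one
  usually written with index \<open>n + 1\<close>. The nilpotency class is understood exactly, so the objects of
  class 2 are not abelian.\<close>

primrec group_lcs :: "('g, 'm) monoid_scheme \<Rightarrow> nat \<Rightarrow> 'g set"
  where
    "group_lcs G 0 = carrier G"
  | "group_lcs G (Suc n) =
       generate G {group_commutator G x y | x y. x \<in> group_lcs G n \<and> y \<in> carrier G}"

definition group_nilpotent_of_class :: "nat \<Rightarrow> ('g, 'm) monoid_scheme \<Rightarrow> bool"
  where "group_nilpotent_of_class c G \<longleftrightarrow>
    group_lcs G c = {\<one>\<^bsub>G\<^esub>} \<and> (\<forall>d<c. group_lcs G d \<noteq> {\<one>\<^bsub>G\<^esub>})"

definition finitely_generated_group :: "('g, 'm) monoid_scheme \<Rightarrow> bool"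
  where "finitely_generated_group G \<longleftrightarrow>
    (\<exists>S. finite S \<and> S \<subseteq> carrier G \<and> generate G S = carrier G)"

definition torsion_free_group :: "('g, 'm) monoid_scheme \<Rightarrow> bool"
  where "torsion_free_group G \<longleftrightarrow>
    (\<forall>x \<in> carrier G. \<forall>n::nat. 0 < n \<and> x [^]\<^bsub>G\<^esub> n = \<one>\<^bsub>G\<^esub> \<longrightarrow> x = \<one>\<^bsub>G\<^esub>)"


section \<open>Lie algebras over a commutative ring\<close>

text \<open>A Lie algebra is encoded in the \<open>module\<close> record of HOL-Algebra. Its field \<open>mult\<close> holds the Lie
  bracket; its field \<open>one\<close> is not used.\<close>

locale lie_algebra = module R L
  for R :: "('r, 'm) ring_scheme" (structure) and L :: "('r, 'a, 'n) module_scheme" (structure) +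
  assumes bracket_closed:
      "\<lbrakk>x \<in> carrier L; y \<in> carrier L\<rbrakk> \<Longrightarrow> x \<otimes>\<^bsub>L\<^esub> y \<in> carrier L"
    and bracket_add_left:
      "\<lbrakk>x \<in> carrier L; y \<in> carrier L; z \<in> carrier L\<rbrakk> \<Longrightarrow>
        (x \<oplus>\<^bsub>L\<^esub> y) \<otimes>\<^bsub>L\<^esub> z = x \<otimes>\<^bsub>L\<^esub> z \<oplus>\<^bsub>L\<^esub> y \<otimes>\<^bsub>L\<^esub> z"
    and bracket_add_right:
      "\<lbrakk>x \<in> carrier L; y \<in> carrier L; z \<in> carrier L\<rbrakk> \<Longrightarrow>
        z \<otimes>\<^bsub>L\<^esub> (x \<oplus>\<^bsub>L\<^esub> y) = z \<otimes>\<^bsub>L\<^esub> x \<oplus>\<^bsub>L\<^esub> z \<otimes>\<^bsub>L\<^esub> y"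
    and bracket_smult_left:
      "\<lbrakk>c \<in> carrier R; x \<in> carrier L; y \<in> carrier L\<rbrakk> \<Longrightarrow>
        (c \<odot>\<^bsub>L\<^esub> x) \<otimes>\<^bsub>L\<^esub> y = c \<odot>\<^bsub>L\<^esub> (x \<otimes>\<^bsub>L\<^esub> y)"
    and bracket_smult_right:
      "\<lbrakk>c \<in> carrier R; x \<in> carrier L; y \<in> carrier L\<rbrakk> \<Longrightarrow>
        x \<otimes>\<^bsub>L\<^esub> (c \<odot>\<^bsub>L\<^esub> y) = c \<odot>\<^bsub>L\<^esub> (x \<otimes>\<^bsub>L\<^esub> y)"
    and bracket_alternating:
      "x \<in> carrier L \<Longrightarrow> x \<otimes>\<^bsub>L\<^esub> x = \<zero>\<^bsub>L\<^esub>"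
    and jacobi:
      "\<lbrakk>x \<in> carrier L; y \<in> carrier L; z \<in> carrier L\<rbrakk> \<Longrightarrow>
        x \<otimes>\<^bsub>L\<^esub> (y \<otimes>\<^bsub>L\<^esub> z) \<oplus>\<^bsub>L\<^esub> y \<otimes>\<^bsub>L\<^esub> (z \<otimes>\<^bsub>L\<^esub> x) \<oplus>\<^bsub>L\<^esub> z \<otimes>\<^bsub>L\<^esub> (x \<otimes>\<^bsub>L\<^esub> y) = \<zero>\<^bsub>L\<^esub>"

primrec lie_lcs :: "('r, 'a, 'n) module_scheme \<Rightarrow> nat \<Rightarrow> 'a set"
  where
    "lie_lcs L 0 = carrier L"
  | "lie_lcs L (Suc n) =
       generate (add_monoid L) {x \<otimes>\<^bsub>L\<^esub> y | x y. x \<in> lie_lcs L n \<and> y \<in> carrier L}"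

definition lie_nilpotent_of_class :: "nat \<Rightarrow> ('r, 'a, 'n) module_scheme \<Rightarrow> bool"
  where "lie_nilpotent_of_class c L \<longleftrightarrow>
    lie_lcs L c = {\<zero>\<^bsub>L\<^esub>} \<and> (\<forall>d<c. lie_lcs L d \<noteq> {\<zero>\<^bsub>L\<^esub>})"

definition free_of_finite_rank :: "('r, 'a, 'n) module_scheme \<Rightarrow> bool"
  where "free_of_finite_rank L \<longleftrightarrow>
    (\<exists>r::nat. add_monoid L \<cong> free_Abelian_group {..<r})"

definition lie_subalgebra ::
  "'a set \<Rightarrow> ('r, 'm) ring_scheme \<Rightarrow> ('r, 'a, 'n) module_scheme \<Rightarrow> bool"
  where "lie_subalgebra M R L \<longleftrightarrow>
    submodule M R L \<and> (\<forall>x \<in> M. \<forall>y \<in> M. x \<otimes>\<^bsub>L\<^esub> y \<in> M)"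

definition lie_isomorphic ::
  "('r, 'm) ring_scheme \<Rightarrow> ('r, 'a, 'n) module_scheme \<Rightarrow> ('r, 'b, 'k) module_scheme \<Rightarrow> bool"
  where "lie_isomorphic R L M \<longleftrightarrow>
    (\<exists>h \<in> iso (add_monoid L) (add_monoid M).
      (\<forall>c \<in> carrier R. \<forall>x \<in> carrier L. h (c \<odot>\<^bsub>L\<^esub> x) = c \<odot>\<^bsub>M\<^esub> h x) \<and>
      (\<forall>x \<in> carrier L. \<forall>y \<in> carrier L. h (x \<otimes>\<^bsub>L\<^esub> y) = h x \<otimes>\<^bsub>M\<^esub> h y))"


section \<open>The Lie algebra of a group of class two\<close>

text \<open>The union of singletons under \<open>the_elem\<close> is a singleton because the commutator of \<open>x\<close> and \<open>y\<close>
  depends only on their cosets modulo the center.\<close>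

definition lie_of_group :: "('g, 'm) monoid_scheme \<Rightarrow> (int, 'g set \<times> 'g) module"
  where "lie_of_group G =
    (let Z = group_center G; A = (G Mod Z) \<times>\<times> G\<lparr>carrier := Z\<rparr>
     in \<lparr>carrier = carrier A,
         monoid.mult = (\<lambda>(U, a) (V, b). (\<one>\<^bsub>G Mod Z\<^esub>,
           the_elem (\<Union>x\<in>U. \<Union>y\<in>V. {group_commutator G x y}))),
         monoid.one = undefined,
         ring.zero = \<one>\<^bsub>A\<^esub>,
         ring.add = (\<lambda>u v. u \<otimes>\<^bsub>A\<^esub> v),
         module.smult = (\<lambda>n u. u [^]\<^bsub>A\<^esub> n)\<rparr>)"


section \<open>Profinite completions\<close>

definition finite_index_normals :: "('g, 'm) monoid_scheme \<Rightarrow> 'g set set"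
  where "finite_index_normals G = {N. N \<lhd> G \<and> finite (rcosets\<^bsub>G\<^esub> N)}"

text \<open>For \<open>N \<subseteq> M\<close> the projection from \<open>G Mod N\<close> to \<open>G Mod M\<close> sends a coset of \<open>N\<close> to the coset
  of \<open>M\<close> containing it, so the condition \<open>f N \<subseteq> f M\<close> is the compatibility defining the inverse limit.
  The same encoding is used for the profinite integers.\<close>

definition profinite_completion :: "('g, 'm) monoid_scheme \<Rightarrow> ('g set \<Rightarrow> 'g set) monoid"
  where "profinite_completion G =
    (product_group (finite_index_normals G) (\<lambda>N. G Mod N))
      \<lparr>carrier := {f \<in> (\<Pi>\<^sub>E N \<in> finite_index_normals G. carrier (G Mod N)).
        \<forall>N \<in> finite_index_normals G. \<forall>M \<in> finite_index_normals G. N \<subseteq> M \<longrightarrow> f N \<subseteq> f M}\<rparr>"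

definition profinite_topology :: "('g, 'm) monoid_scheme \<Rightarrow> ('g set \<Rightarrow> 'g set) topology"
  where "profinite_topology G =
    subtopology
      (product_topology (\<lambda>N. discrete_topology (carrier (G Mod N))) (finite_index_normals G))
      (carrier (profinite_completion G))"

definition isomorphic_profinite_completions ::
  "('g, 'm) monoid_scheme \<Rightarrow> ('h, 'n) monoid_scheme \<Rightarrow> bool"
  where "isomorphic_profinite_completions G H \<longleftrightarrow>
    (\<exists>\<phi> \<in> iso (profinite_completion G) (profinite_completion H).
      homeomorphic_map (profinite_topology G) (profinite_topology H) \<phi>)"

definition profinite_int :: "(nat \<Rightarrow> int set) ring"
  where "profinite_int =
    \<lparr>carrier = {f \<in> (\<Pi>\<^sub>E n \<in> {0<..}. carrier (ZFact (int n))).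
        \<forall>m>0. \<forall>n>0. m dvd n \<longrightarrow> f n \<subseteq> f m},
     monoid.mult = (\<lambda>f g. \<lambda>n\<in>{0<..}. f n \<otimes>\<^bsub>ZFact (int n)\<^esub> g n),
     monoid.one = (\<lambda>n\<in>{0<..}. \<one>\<^bsub>ZFact (int n)\<^esub>),
     ring.zero = (\<lambda>n\<in>{0<..}. \<zero>\<^bsub>ZFact (int n)\<^esub>),
     ring.add = (\<lambda>f g. \<lambda>n\<in>{0<..}. f n \<oplus>\<^bsub>ZFact (int n)\<^esub> g n)\<rparr>"


section \<open>Extension of scalars\<close>

text \<open>The tensor product over the integers of a Lie algebra \<open>L\<close> over the integers with a
  commutative ring \<open>S\<close>, as the quotient of the free abelian group on pairs by the biadditivity
  relations; it is a Lie algebra over \<open>S\<close>. The operations on cosets are given on all representatives,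
  so that each of the unions is a single coset.\<close>

definition tensor_relations ::
  "('r, 'a, 'n) module_scheme \<Rightarrow> ('s, 'm) ring_scheme \<Rightarrow> ('a \<times> 's \<Rightarrow>\<^sub>0 int) set"
  where "tensor_relations L S =
    {frag_of (x \<oplus>\<^bsub>L\<^esub> y, a) - frag_of (x, a) - frag_of (y, a) | x y a.
      x \<in> carrier L \<and> y \<in> carrier L \<and> a \<in> carrier S} \<union>
    {frag_of (x, a \<oplus>\<^bsub>S\<^esub> b) - frag_of (x, a) - frag_of (x, b) | x a b.
      x \<in> carrier L \<and> a \<in> carrier S \<and> b \<in> carrier S}"

definition lie_tensor ::
  "('r, 'a, 'n) module_scheme \<Rightarrow> ('s, 'm) ring_scheme \<Rightarrow> ('s, ('a \<times> 's \<Rightarrow>\<^sub>0 int) set) module"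
  where "lie_tensor L S =
    (let F = free_Abelian_group (carrier L \<times> carrier S);
         T = generate F (tensor_relations L S)
     in \<lparr>carrier = carrier (F Mod T),
         monoid.mult = (\<lambda>U V. \<Union>u\<in>U. \<Union>v\<in>V. T #>\<^bsub>F\<^esub>
           frag_extend (\<lambda>(x, a). frag_extend (\<lambda>(y, b). frag_of (x \<otimes>\<^bsub>L\<^esub> y, a \<otimes>\<^bsub>S\<^esub> b)) v) u),
         monoid.one = undefined,
         ring.zero = \<one>\<^bsub>F Mod T\<^esub>,
         ring.add = (\<lambda>U V. U \<otimes>\<^bsub>F Mod T\<^esub> V),
         module.smult = (\<lambda>c U. \<Union>u\<in>U. T #>\<^bsub>F\<^esub> frag_extend (\<lambda>(x, a). frag_of (x, c \<otimes>\<^bsub>S\<^esub> a)) u)\<rparr>)"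


section \<open>Zeta functions of groups and of Lie algebras\<close>

definition dirichlet_series :: "(nat \<Rightarrow> nat) \<Rightarrow> complex \<Rightarrow> complex"
  where "dirichlet_series a s = suminf (\<lambda>n. of_nat (a (Suc n)) * of_nat (Suc n) powr (- s))"

definition iso_subgroups :: "('g, 'm) monoid_scheme \<Rightarrow> nat \<Rightarrow> 'g set set"
  where "iso_subgroups G n =
    {H. subgroup H G \<and> card (rcosets\<^bsub>G\<^esub> H) = n \<and> G\<lparr>carrier := H\<rparr> \<cong> G}"

definition pro_iso_subgroups :: "('g, 'm) monoid_scheme \<Rightarrow> nat \<Rightarrow> 'g set set"
  where "pro_iso_subgroups G n =
    {H. subgroup H G \<and> card (rcosets\<^bsub>G\<^esub> H) = n \<and>
      isomorphic_profinite_completions (G\<lparr>carrier := H\<rparr>) G}"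

definition iso_subalgebras :: "(int, 'a, 'n) module_scheme \<Rightarrow> nat \<Rightarrow> 'a set set"
  where "iso_subalgebras L n =
    {M. lie_subalgebra M \<Z> L \<and> card (a_rcosets\<^bsub>L\<^esub> M) = n \<and>
      lie_isomorphic \<Z> (L\<lparr>carrier := M\<rparr>) L}"

definition pro_iso_subalgebras :: "(int, 'a, 'n) module_scheme \<Rightarrow> nat \<Rightarrow> 'a set set"
  where "pro_iso_subalgebras L n =
    {M. lie_subalgebra M \<Z> L \<and> card (a_rcosets\<^bsub>L\<^esub> M) = n \<and>
      lie_isomorphic profinite_int
        (lie_tensor (L\<lparr>carrier := M\<rparr>) profinite_int) (lie_tensor L profinite_int)}"

definition group_zeta_iso :: "('g, 'm) monoid_scheme \<Rightarrow> complex \<Rightarrow> complex"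
  where "group_zeta_iso G = dirichlet_series (\<lambda>n. card (iso_subgroups G n))"

definition group_zeta_pro_iso :: "('g, 'm) monoid_scheme \<Rightarrow> complex \<Rightarrow> complex"
  where "group_zeta_pro_iso G = dirichlet_series (\<lambda>n. card (pro_iso_subgroups G n))"

definition lie_zeta_iso :: "(int, 'a, 'n) module_scheme \<Rightarrow> complex \<Rightarrow> complex"
  where "lie_zeta_iso L = dirichlet_series (\<lambda>n. card (iso_subalgebras L n))"

definition lie_zeta_pro_iso :: "(int, 'a, 'n) module_scheme \<Rightarrow> complex \<Rightarrow> complex"
  where "lie_zeta_pro_iso L = dirichlet_series (\<lambda>n. card (pro_iso_subalgebras L n))"

end

theory Submission
  imports Defs "HOL-Library.Function_Algebras"
begin

text \<open>
  Both sides are governed by the same integral structure constants. Let \<open>V\<close> be the quotient of \<open>G\<close>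
  by its center \<open>Z\<close>. Since \<open>V \<oplus> Z\<close> is free of finite rank, so are \<open>V\<close> and \<open>Z\<close>. Writing the elements
  of \<open>G\<close> as ordered products of powers of lifts of a basis of \<open>V\<close>, times a central element, gives
  coordinates in which \<open>(a, z) (b, w) = (a + b, z + w + \<beta> a b)\<close> with \<open>\<beta>\<close> bilinear over the integers,
  while \<open>L(G)\<close> becomes the same abelian group with \<open>[(a, z), (b, w)] = (0, \<omega> a b)\<close>, where
  \<open>\<omega> a b = \<beta> a b - \<beta> b a\<close> (\<open>twist_of_group_and_lie_algebra\<close>). That \<open>Z\<close> is the whole center says that
  \<open>\<omega>\<close> is nondegenerate. The coefficients of \<open>\<beta>\<close> are kept in a \<open>twist\<close>, which defines a group and a
  Lie algebra over any commutative ring.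

  Only \<open>\<omega>\<close> matters up to isomorphism. Let \<open>R\<close> be the ring of integers or its profinite completion.
  Two nondegenerate twists have isomorphic groups over \<open>R\<close> exactly if there are additive bijections of
  their bases and of their centers that carry one bracket to the other
  (\<open>twisted_groups_isomorphic_iff\<close>), and their Lie algebras over \<open>R\<close> are isomorphic under the same
  condition (\<open>lie_models_isomorphic_iff\<close>). If the brackets match, the cocycles differ by a symmetric
  bilinear map, and this is a coboundary: with \<open>x (x - 1) / 2\<close> in place of \<open>x\<^sup>2 / 2\<close>, a quadratic
  function with the required polarization exists although 2 is not invertible. Hence it suffices to
  pair the subgroups of \<open>G\<close> with the subalgebras of \<open>L\<close> in such a way that partners of finite index
  have the same index and are described by one and the same nondegenerate twist.

  The pairing comes from the same idea. A subgroup \<open>H\<close> projects onto a subgroup \<open>W\<close> of \<open>V\<close> and meets \<open>Z\<close>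
  in a subgroup \<open>Y\<close> containing \<open>\<omega> W W\<close>. There is a quadratic function \<open>q\<close>, chosen from \<open>W\<close> and \<open>Y\<close>
  alone, such that \<open>q u + q v - q (u + v) + \<beta> u v\<close> is bilinear on \<open>W\<close> with values in \<open>Y\<close>
  (\<open>straightening_exists\<close>). Modulo \<open>Y\<close> the map \<open>(w, z) \<mapsto> (w, z - q w)\<close> therefore turns
  multiplication into addition, and it takes subgroups with the data \<open>(W, Y)\<close> bijectively to subalgebras
  with the data \<open>(W, Y)\<close> (\<open>bij_betw_to_lie\<close>). The index is the product of the indices of \<open>W\<close> and \<open>Y\<close> on
  both sides, and in coordinates for \<open>W\<close> and \<open>Y\<close> the displayed bilinear map is the common twist
  (\<open>common_twist\<close>).

  For the second zeta function, the profinite completion of the group of a twist is the group of the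
  same twist over the profinite integers, and extension of scalars of its Lie algebra is the Lie algebra
  of the twist over the profinite integers (\<open>to_completion_iso\<close>, \<open>lie_tensor_isomorphic_model\<close>).
  An abstract isomorphism between these completions is a homeomorphism, because a homomorphism to a
  group of order \<open>k\<close> kills all coordinate vectors divisible by \<open>2 k\<close>, which form an open subgroup
  (\<open>multiples_in_kernel\<close>, \<open>hom_continuous\<close>).
\<close>

declare [[coercion_enabled = false]]

section \<open>Rings in which the integers are dense\<close>

text \<open>The integers and the profinite integers are treated together. Density of the integers for the
  topology of divisibility, together with separatedness, makes every additive function of vectors linear; the absence
  of torsion allows division by positive integers wherever a quotient exists.\<close>
class integer_dense = comm_ring_1 +
  assumes integer_approx: "n > 0 \<Longrightarrow> \<exists>k y. x = of_int k + of_nat n * y"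
    and divisible_imp_zero: "(\<And>n. n > 0 \<Longrightarrow> \<exists>y. x = of_nat n * y) \<Longrightarrow> x = 0"
    and of_nat_cancel: "n > 0 \<Longrightarrow> of_nat n * x = 0 \<Longrightarrow> x = 0"

instance int :: integer_dense
proof
  fix n :: nat and x :: int
  show "\<exists>k y. x = of_int k + of_nat n * y"
    by (rule exI[of _ x], rule exI[of _ 0]) simp
  show "x = 0" if "n > 0" "of_nat n * x = 0"
    using that by simp
  show "x = 0" if multiple: "\<And>n. n > 0 \<Longrightarrow> \<exists>y. x = of_nat n * y"
  proof (rule ccontr)
    assume "x \<noteq> 0"
    have "nat \<bar>x\<bar> + 1 > 0"
      by simp
    from multiple[OF this] obtain y where "x = of_nat (nat \<bar>x\<bar> + 1) * y" ..
    then have "of_nat (nat \<bar>x\<bar> + 1) dvd x"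
      by (rule dvdI)
    with \<open>x \<noteq> 0\<close> have "\<bar>of_nat (nat \<bar>x\<bar> + 1)\<bar> \<le> \<bar>x\<bar>"
      by (rule dvd_imp_le_int)
    then show False
      by linarith
  qed
qed

text \<open>A profinite integer is a compatible system of least nonnegative residues modulo all positive
  integers. The residue modulo 0 is set to 0 so that equality is equality of functions.\<close>
typedef zhat = "{f :: nat \<Rightarrow> int. f 0 = 0 \<and> (\<forall>n>0. 0 \<le> f n \<and> f n < int n) \<and>
    (\<forall>m n. 0 < n \<longrightarrow> m dvd n \<longrightarrow> f n mod int m = f m)}"
  morphisms residue Abs_zhat
  by (rule exI[of _ "\<lambda>_. 0"]) auto

lemma residue_0 [simp]: "residue x 0 = 0"
  using residue[of x] by simp

lemma residue_less: "n > 0 \<Longrightarrow> residue x n < int n"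
  using residue[of x] by simp

lemma residue_nonneg [simp]: "0 \<le> residue x n"
  using residue[of x] by (cases "n = 0") simp_all

lemma residue_mod_dvd: "n > 0 \<Longrightarrow> m dvd n \<Longrightarrow> residue x n mod int m = residue x m"
  using residue[of x] by simp

lemma residue_mod_self [simp]: "residue x n mod int n = residue x n"
proof (cases "n = 0")
  case False
  then show ?thesis
    using residue_less[of n x] by (simp add: mod_pos_pos_trivial)
qed simp

lemma zhat_eqI: "(\<And>n. n > 0 \<Longrightarrow> residue x n = residue y n) \<Longrightarrow> x = y"
  by (metis residue_inject residue_0 ext gr0I)

definition zhat_of :: "(nat \<Rightarrow> int) \<Rightarrow> zhat"
  where "zhat_of f = Abs_zhat (\<lambda>n. if n = 0 then 0 else f n mod int n)"

lemma residue_zhat_of: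
  assumes compat: "\<And>m n. 0 < n \<Longrightarrow> m dvd n \<Longrightarrow> f n mod int m = f m mod int m" and "n > 0"
  shows "residue (zhat_of f) n = f n mod int n"
proof -
  have 1: "f n mod int n mod int m = f m mod int m" "m > 0" if n: "0 < n" "m dvd n" for m n
  proof -
    have "f n mod int n mod int m = f n mod int m"
      using n by (intro mod_mod_cancel) simp
    also have "\<dots> = f m mod int m"
      using n by (rule compat)
    finally show "f n mod int n mod int m = f m mod int m" .
    show "m > 0"
      using n by (rule dvd_pos_nat)
  qed
  have "residue (zhat_of f) = (\<lambda>n. if n = 0 then 0 else f n mod int n)"
    unfolding zhat_of_def by (rule Abs_zhat_inverse) (use 1 in simp)
  with assms(2) show ?thesis
    by simp
qed

instantiation zhat :: comm_ring_1
begin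

definition "0 = zhat_of (\<lambda>_. 0)"
definition "1 = zhat_of (\<lambda>_. 1)"
definition "x + y = zhat_of (\<lambda>n. residue x n + residue y n)"
definition "x * y = zhat_of (\<lambda>n. residue x n * residue y n)"
definition "- x = zhat_of (\<lambda>n. - residue x n)"
definition "x - y = zhat_of (\<lambda>n. residue x n - residue y n)"

lemma residue_add: "n > 0 \<Longrightarrow> residue (x + y) n = (residue x n + residue y n) mod int n"
  unfolding plus_zhat_def by (rule residue_zhat_of) (metis mod_add_eq residue_mod_dvd residue_mod_self)

lemma residue_mult: "n > 0 \<Longrightarrow> residue (x * y) n = (residue x n * residue y n) mod int n"
  unfolding times_zhat_def by (rule residue_zhat_of) (metis mod_mult_eq residue_mod_dvd residue_mod_self)

lemma residue_uminus: "n > 0 \<Longrightarrow> residue (- x) n = (- residue x n) mod int n"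
  unfolding uminus_zhat_def by (rule residue_zhat_of) (metis mod_minus_eq residue_mod_dvd residue_mod_self)

lemma residue_diff: "n > 0 \<Longrightarrow> residue (x - y) n = (residue x n - residue y n) mod int n"
  unfolding minus_zhat_def by (rule residue_zhat_of) (metis mod_diff_eq residue_mod_dvd residue_mod_self)

lemma residue_zero [simp]: "residue 0 n = 0"
  unfolding zero_zhat_def by (cases "n = 0") (simp_all add: residue_zhat_of)

lemma residue_one: "n > 0 \<Longrightarrow> residue 1 n = 1 mod int n"
  unfolding one_zhat_def by (simp add: residue_zhat_of)

instance
proof
  fix a b c :: zhat
  note r = residue_add residue_mult residue_uminus residue_diff residue_one
  show "a * b * c = a * (b * c)" by (rule zhat_eqI) (simp add: r mod_simps mult.assoc)
  show "a * b = b * a" by (rule zhat_eqI) (simp add: r mod_simps mult.commute)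
  show "1 * a = a" by (rule zhat_eqI) (simp add: r mod_simps)
  show "a + b + c = a + (b + c)" by (rule zhat_eqI) (simp add: r mod_simps add.assoc)
  show "a + b = b + a" by (rule zhat_eqI) (simp add: r add.commute)
  show "0 + a = a" by (rule zhat_eqI) (simp add: r)
  show "- a + a = 0" by (rule zhat_eqI) (simp add: r mod_simps)
  show "a - b = a + - b" by (rule zhat_eqI) (simp add: r mod_simps)
  show "(a + b) * c = a * c + b * c" by (rule zhat_eqI) (simp add: r mod_simps algebra_simps)
  have "residue 0 2 \<noteq> residue 1 2" by (simp add: residue_one)
  then show "(0::zhat) \<noteq> 1" by metis
qed

end

lemma residue_of_nat: "n > 0 \<Longrightarrow> residue (of_nat k) n = int k mod int n"
  by (induction k) (simp_all add: residue_add residue_one mod_simps)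

lemma residue_of_int: "n > 0 \<Longrightarrow> residue (of_int k) n = k mod int n"
  by (cases k rule: int_cases2) (simp_all add: residue_of_nat residue_uminus mod_simps)

lemma residue_eq_0_imp_multiple:
  assumes "n > 0" "residue x n = 0"
  shows "\<exists>y. x = of_nat n * y"
proof -
  have dvd: "int n dvd residue x (n * m)" for m
    using residue_mod_dvd[of "n * m" n x] assms by (cases "m = 0") auto
  define y where "y = zhat_of (\<lambda>m. residue x (n * m) div int n)"
  have compat: "(residue x (n * k) div int n) mod int m = (residue x (n * m) div int n) mod int m"
    if "0 < k" "m dvd k" for m k
  proof -
    have "residue x (n * k) mod int (n * m) = residue x (n * m)"
      using that assms by (intro residue_mod_dvd) auto
    moreover obtain a b where "residue x (n * k) = int n * a" "residue x (n * m) = int n * b"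
      using dvd by (metis dvdE)
    ultimately show ?thesis
      using assms by (metis mod_mult_mult1 mod_mod_trivial nonzero_mult_div_cancel_left
          of_nat_eq_0_iff of_nat_mult mult_cancel_left neq0_conv)
  qed
  have "residue x m = residue (of_nat n * y) m" if "m > 0" for m
  proof -
    have "residue (of_nat n * y) m = (int n * (residue x (n * m) div int n)) mod int m"
      using that by (simp add: y_def residue_mult residue_of_nat residue_zhat_of[OF compat] mod_simps)
    also have "\<dots> = residue x (n * m) mod int m"
      using dvd by simp
    also have "\<dots> = residue x m"
      using that assms by (intro residue_mod_dvd) auto
    finally show ?thesis ..
  qed
  then show ?thesis
    using zhat_eqI by blast
qed

lemma residue_of_nat_mult_self: "residue (of_nat n * x) n = 0"
  by (cases "n = 0") (simp_all add: residue_mult residue_of_nat)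

instance zhat :: integer_dense
proof
  fix n :: nat and x :: zhat
  show "\<exists>k y. x = of_int k + of_nat n * y" if n: "n > 0"
  proof -
    have "residue (x - of_int (residue x n)) n = 0"
      using n by (simp add: residue_diff residue_of_int)
    then obtain y where "x - of_int (residue x n) = of_nat n * y"
      using residue_eq_0_imp_multiple n by blast
    then show ?thesis
      by (metis add.commute diff_add_cancel)
  qed
  show "x = 0" if "\<And>n. n > 0 \<Longrightarrow> \<exists>y. x = of_nat n * y"
    by (rule zhat_eqI) (metis that residue_of_nat_mult_self residue_zero)
  show "x = 0" if n: "n > 0" and 0: "of_nat n * x = 0"
  proof (rule zhat_eqI)
    fix m :: nat assume m: "m > 0"
    have "(int n * residue x (n * m)) mod int (n * m) = 0"
      using arg_cong[OF 0, of "\<lambda>z. residue z (n * m)"] n m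
      by (simp add: residue_mult residue_of_nat mod_simps)
    then have "int m dvd residue x (n * m)"
      using n by auto
    then show "residue x m = residue 0 m"
      using residue_mod_dvd[of "n * m" m x] n m by simp
  qed
qed

section \<open>Integral vectors and additive maps\<close>

definition additive_on :: "'a::plus set \<Rightarrow> ('a \<Rightarrow> 'b::plus) \<Rightarrow> bool"
  where "additive_on A f \<longleftrightarrow> (\<forall>x\<in>A. \<forall>y\<in>A. f (x + y) = f x + f y)"

definition add_subgroup :: "'a::ab_group_add set \<Rightarrow> bool"
  where "add_subgroup A \<longleftrightarrow> 0 \<in> A \<and> (\<forall>x\<in>A. \<forall>y\<in>A. x - y \<in> A)"

lemma add_subgroup_closed:
  assumes "add_subgroup A"
  shows "0 \<in> A" "x \<in> A \<Longrightarrow> y \<in> A \<Longrightarrow> x - y \<in> A" "x \<in> A \<Longrightarrow> - x \<in> A"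
    "x \<in> A \<Longrightarrow> y \<in> A \<Longrightarrow> x + y \<in> A"
proof -
  show 0: "0 \<in> A"
    using assms by (simp add: add_subgroup_def)
  show diff: "x - y \<in> A" if "x \<in> A" "y \<in> A" for x y
    using assms that by (simp add: add_subgroup_def)
  show uminus: "- x \<in> A" if "x \<in> A" for x
    using diff[OF 0 that] by simp
  show "x + y \<in> A" if "x \<in> A" "y \<in> A"
    using diff[OF that(1) uminus[OF that(2)]] by simp
qed

lemma additive_on_simps:
  fixes f :: "'a::ab_group_add \<Rightarrow> 'b::ab_group_add"
  assumes "additive_on A f" "add_subgroup A"
  shows "f 0 = 0" "x \<in> A \<Longrightarrow> f (- x) = - f x" "x \<in> A \<Longrightarrow> y \<in> A \<Longrightarrow> f (x - y) = f x - f y"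
    "x \<in> A \<Longrightarrow> y \<in> A \<Longrightarrow> f (x + y) = f x + f y"
proof -
  note closed = add_subgroup_closed[OF assms(2)]
  show add: "f (x + y) = f x + f y" if "x \<in> A" "y \<in> A" for x y
    using assms(1) that by (simp add: additive_on_def)
  show zero: "f 0 = 0"
    using add[OF closed(1) closed(1)] by simp
  show uminus: "f (- x) = - f x" if "x \<in> A" for x
    using add[OF that closed(3)[OF that]] zero by (simp add: minus_unique)
  show "f (x - y) = f x - f y" if "x \<in> A" "y \<in> A"
    using add[OF that(1) closed(3)[OF that(2)]] uminus[OF that(2)] by simp
qed

lemma additive_on_inv_into:
  fixes f :: "'a::ab_group_add \<Rightarrow> 'b::ab_group_add"
  assumes "additive_on A f" "add_subgroup A" "bij_betw f A B"
  shows "additive_on B (inv_into A f)"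
  unfolding additive_on_def
proof (intro ballI)
  fix u v assume uv: "u \<in> B" "v \<in> B"
  define x y where "x = inv_into A f u" and "y = inv_into A f v"
  have "x \<in> A" "y \<in> A" "f x = u" "f y = v"
    using uv assms(3) by (auto simp: x_def y_def bij_betw_def inv_into_into f_inv_into_f)
  then have "u + v = f (x + y)" "x + y \<in> A"
    using additive_on_simps[OF assms(1,2)] add_subgroup_closed[OF assms(2)] by auto
  then show "inv_into A f (u + v) = inv_into A f u + inv_into A f v"
    using assms(3) by (simp add: bij_betw_def x_def y_def)
qed

lemma additive_on_of_nat:
  fixes f :: "(nat \<Rightarrow> 'r::comm_ring_1) \<Rightarrow> 'r"
  assumes "additive_on A f" "add_subgroup A" "x \<in> A"
  shows "(\<lambda>i. of_nat n * x i) \<in> A \<and> f (\<lambda>i. of_nat n * x i) = of_nat n * f x"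
proof (induction n)
  case 0
  then show ?case
    using additive_on_simps(1)[OF assms(1,2)] add_subgroup_closed(1)[OF assms(2)]
    by (simp add: zero_fun_def)
next
  case (Suc n)
  have "(\<lambda>i. of_nat (Suc n) * x i) = x + (\<lambda>i. of_nat n * x i)"
    by (simp add: fun_eq_iff algebra_simps)
  then show ?case
    using Suc additive_on_simps(4)[OF assms(1,2)] add_subgroup_closed(4)[OF assms(2)] assms(3)
    by (simp add: algebra_simps)
qed

text \<open>Vectors of varying length are functions on the natural numbers that vanish from some index on, so
  that subgroups of different ranks can occur in one statement.\<close>
definition vecs :: "nat \<Rightarrow> (nat \<Rightarrow> 'r::zero) set"
  where "vecs d = {x. \<forall>i\<ge>d. x i = 0}"

lemma vecs_zero: "x \<in> vecs d \<Longrightarrow> d \<le> i \<Longrightarrow> x i = 0"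
  by (simp add: vecs_def)

lemma vecsI: "(\<And>i. d \<le> i \<Longrightarrow> x i = 0) \<Longrightarrow> x \<in> vecs d"
  by (simp add: vecs_def)

definition unit_vec :: "nat \<Rightarrow> nat \<Rightarrow> 'r::zero_neq_one"
  where "unit_vec i = (\<lambda>j. if j = i then 1 else 0)"

definition vscale :: "'r::times \<Rightarrow> (nat \<Rightarrow> 'r) \<Rightarrow> nat \<Rightarrow> 'r"
  where "vscale s x = (\<lambda>i. s * x i)"

lemma vscale_apply [simp]: "vscale s x i = s * x i"
  by (simp add: vscale_def)

lemma vecs_subgroup [simp]: "add_subgroup (vecs d :: (nat \<Rightarrow> 'r::ab_group_add) set)"
  by (simp add: add_subgroup_def vecs_def)

lemmas vecs_closed [simp] = add_subgroup_closed[OF vecs_subgroup]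

lemma vscale_vecs [simp]: "x \<in> vecs d \<Longrightarrow> vscale s x \<in> vecs d" for s :: "'r::mult_zero"
  by (simp add: vecs_def)

lemma unit_vec_vecs [simp]: "i < d \<Longrightarrow> unit_vec i \<in> vecs d"
  by (simp add: vecs_def unit_vec_def)

lemma vecs_eqI: "x \<in> vecs d \<Longrightarrow> y \<in> vecs d \<Longrightarrow> (\<And>i. i < d \<Longrightarrow> x i = y i) \<Longrightarrow> x = y"
  by (rule ext) (metis (no_types) not_le vecs_zero)

lemma vecs_SucD: "x \<in> vecs (Suc d) \<Longrightarrow> x d = 0 \<Longrightarrow> x \<in> vecs d"
  by (rule vecsI) (metis Suc_leI le_neq_implies_less vecs_zero)

lemma vecs_mono: "x \<in> vecs d \<Longrightarrow> d \<le> d' \<Longrightarrow> x \<in> vecs d'"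
  by (rule vecsI) (meson order.trans vecs_zero)

lemma vscale_steps:
  fixes x :: "nat \<Rightarrow> 'r::comm_ring_1"
  shows "vscale 0 x = 0" "vscale (k + 1) x = vscale k x + x" "vscale (k - 1) x = vscale k x - x"
  by (simp_all add: fun_eq_iff algebra_simps)

lemma add_subgroup_vscale:
  fixes A :: "(nat \<Rightarrow> int) set"
  assumes "add_subgroup A" "x \<in> A"
  shows "vscale k x \<in> A"
  by (induction k rule: int_induct[where k = 0])
    (use assms in \<open>simp_all only: vscale_steps add_subgroup_closed\<close>)

lemma additive_on_vscale:
  fixes f :: "(nat \<Rightarrow> int) \<Rightarrow> nat \<Rightarrow> int"
  assumes "additive_on A f" "add_subgroup A" "x \<in> A"
  shows "f (vscale k x) = vscale k (f x)"
  by (induction k rule: int_induct[where k = 0])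
    (simp_all only: vscale_steps additive_on_simps[OF assms(1,2)] add_subgroup_vscale assms(2,3))

lemma add_subgroup_pair_vscale:
  fixes N :: "((nat \<Rightarrow> int) \<times> (nat \<Rightarrow> int)) set"
  assumes "add_subgroup N" "(a, z) \<in> N"
  shows "(vscale k a, vscale k z) \<in> N"
  by (induction k rule: int_induct[where k = 0])
    (use add_subgroup_closed[OF assms(1)] assms(2) in
      \<open>simp_all only: vscale_steps zero_prod_def[symmetric] add_Pair[symmetric] diff_Pair[symmetric]\<close>)

lemma additive_on_pair_vscale:
  fixes f :: "(nat \<Rightarrow> int) \<times> (nat \<Rightarrow> int) \<Rightarrow> (nat \<Rightarrow> int) \<times> (nat \<Rightarrow> int)"
  assumes "additive_on N f" "add_subgroup N" "(a, z) \<in> N"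
  shows "f (vscale k a, vscale k z) = (vscale k (fst (f (a, z))), vscale k (snd (f (a, z))))"
proof (induction k rule: int_induct[where k = 0])
  case base
  show ?case
    by (simp only: vscale_steps zero_prod_def[symmetric] additive_on_simps[OF assms(1,2)])
next
  case (step1 k)
  have "f (vscale (k + 1) a, vscale (k + 1) z) = f (vscale k a, vscale k z) + f (a, z)"
    unfolding vscale_steps add_Pair[symmetric]
    by (rule additive_on_simps(4)[OF assms(1,2) add_subgroup_pair_vscale[OF assms(2,3)] assms(3)])
  then show ?case
    unfolding step1.IH vscale_steps by (simp only: prod_eq_iff fst_add snd_add fst_conv snd_conv simp_thms)
next
  case (step2 k)
  have "f (vscale (k - 1) a, vscale (k - 1) z) = f (vscale k a, vscale k z) - f (a, z)"
    unfolding vscale_steps diff_Pair[symmetric]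
    by (rule additive_on_simps(3)[OF assms(1,2) add_subgroup_pair_vscale[OF assms(2,3)] assms(3)])
  then show ?case
    unfolding step2.IH vscale_steps by (simp only: prod_eq_iff fst_diff snd_diff fst_conv snd_conv simp_thms)
qed

text \<open>Modulo \<open>n\<close> the scalar \<open>s\<close> agrees with an integer, for which homogeneity follows from additivity.
  Hence \<open>f (vscale s x) - s * f x\<close> is divisible by every positive integer and vanishes.\<close>
lemma additive_linear:
  fixes f :: "(nat \<Rightarrow> 'r::integer_dense) \<Rightarrow> 'r"
  assumes f: "additive_on (vecs d) f" and x: "x \<in> vecs d"
  shows "f (vscale s x) = s * f x"
proof -
  note simps = additive_on_simps[OF f vecs_subgroup]
  have of_nat: "f (vscale (of_nat n) y) = of_nat n * f y" if "y \<in> vecs d" for n y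
    using additive_on_of_nat[OF f vecs_subgroup that] by (simp add: vscale_def)
  have of_int: "f (vscale (of_int k) y) = of_int k * f y" if "y \<in> vecs d" for k y
  proof (cases k rule: int_cases2)
    case (nonpos n)
    then have "vscale (of_int k) y = - vscale (of_nat n) y"
      by (simp add: fun_eq_iff)
    then show ?thesis
      using nonpos of_nat that by (simp add: simps)
  qed (simp add: of_nat that)
  have "f (vscale s x) - s * f x = 0"
  proof (rule divisible_imp_zero)
    fix n :: nat assume "n > 0"
    then obtain k y where s: "s = of_int k + of_nat n * y"
      using integer_approx by blast
    then have "vscale s x = vscale (of_int k) x + vscale (of_nat n) (vscale y x)"
      by (simp add: fun_eq_iff algebra_simps)
    then have "f (vscale s x) = of_int k * f x + of_nat n * f (vscale y x)"
      using x by (simp add: simps of_int of_nat)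
    then have "f (vscale s x) - s * f x = of_nat n * (f (vscale y x) - y * f x)"
      by (simp add: s algebra_simps)
    then show "\<exists>z. f (vscale s x) - s * f x = of_nat n * z" ..
  qed
  then show ?thesis
    by simp
qed

lemma additive_expand:
  fixes f :: "(nat \<Rightarrow> 'r::integer_dense) \<Rightarrow> 'r"
  assumes "additive_on (vecs d) f" and "x \<in> vecs d"
  shows "f x = (\<Sum>i<d. x i * f (unit_vec i))"
  using assms
proof (induction d arbitrary: x)
  case 0
  have "x = 0"
    using "0.prems"(2) by (simp add: vecs_def fun_eq_iff)
  then show ?case
    using additive_on_simps(1)[OF "0.prems"(1) vecs_subgroup] by (simp only:) simp
next
  case (Suc d)
  let ?y = "x(d := 0)"
  have y: "?y \<in> vecs d"
    using Suc.prems(2) by (auto simp: vecs_def)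
  have "additive_on (vecs d) f"
    using Suc.prems(1) unfolding additive_on_def by (meson le_SucI order_refl vecs_mono)
  from Suc.IH[OF this y] have "f ?y = (\<Sum>i<d. x i * f (unit_vec i))"
    by (simp add: fun_upd_def)
  note IH = this
  have "x = ?y + vscale (x d) (unit_vec d)"
    by (simp add: fun_eq_iff unit_vec_def)
  then have "f x = f (?y + vscale (x d) (unit_vec d))"
    by (rule arg_cong)
  also have "\<dots> = f ?y + f (vscale (x d) (unit_vec d))"
    by (rule additive_on_simps(4)[OF Suc.prems(1) vecs_subgroup vecs_mono[OF y]]) simp_all
  also have "f (vscale (x d) (unit_vec d)) = x d * f (unit_vec d)"
    by (rule additive_linear[OF Suc.prems(1)]) simp
  finally have "f x = f ?y + x d * f (unit_vec d)" .
  then show ?case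
    unfolding IH by simp
qed

lemma biadditive_expand:
  fixes g :: "(nat \<Rightarrow> 'r::integer_dense) \<Rightarrow> (nat \<Rightarrow> 'r) \<Rightarrow> 'r"
  assumes left: "\<And>y. y \<in> vecs d \<Longrightarrow> additive_on (vecs d) (\<lambda>x. g x y)"
    and right: "\<And>x. x \<in> vecs d \<Longrightarrow> additive_on (vecs d) (g x)"
    and "x \<in> vecs d" "y \<in> vecs d"
  shows "g x y = (\<Sum>i<d. \<Sum>j<d. g (unit_vec i) (unit_vec j) * x i * y j)"
proof -
  have "g x y = (\<Sum>i<d. x i * g (unit_vec i) y)"
    using additive_expand[OF left] assms(3,4) by simp
  also have "\<dots> = (\<Sum>i<d. x i * (\<Sum>j<d. y j * g (unit_vec i) (unit_vec j)))"
    using assms(4) by (intro sum.cong refl) (simp add: additive_expand[OF right])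
  also have "\<dots> = (\<Sum>i<d. \<Sum>j<d. g (unit_vec i) (unit_vec j) * x i * y j)"
    by (simp add: sum_distrib_left algebra_simps)
  finally show ?thesis .
qed

section \<open>Quadratic functions\<close>

text \<open>Choosing a solution of \<open>2 * h = x * (x - 1)\<close> gives the binomial coefficient \<open>x choose 2\<close> in a ring
  without division.\<close>
definition choose2 :: "'r::integer_dense \<Rightarrow> 'r"
  where "choose2 x = (SOME h. 2 * h = x * (x - 1))"

text \<open>Modulo 2 the element \<open>x\<close> is an integer, and the product of two consecutive integers is even.\<close>
lemma two_choose2: "2 * choose2 x = x * (x - 1)" for x :: "'r::integer_dense"
proof -
  obtain k y where x: "x = of_int k + of_nat 2 * y"
    using integer_approx[of 2 x] by auto
  have "even (k * (k - 1))"
    by simp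
  then obtain l where "k * (k - 1) = 2 * l"
    by (rule evenE)
  then have "of_int k * (of_int k - 1) = (2 * of_int l :: 'r)"
    by (metis of_int_1 of_int_diff of_int_mult of_int_numeral)
  then have "2 * (of_int l + y * (2 * of_int k - 1 + 2 * y)) = x * (x - 1)"
    unfolding x by (simp add: algebra_simps)
  then show ?thesis
    unfolding choose2_def by (rule someI)
qed

lemma choose2_add: "choose2 (x + y) = choose2 x + choose2 y + x * y"
  for x :: "'r::integer_dense"
proof -
  have "2 * choose2 (x + y) = 2 * (choose2 x + choose2 y + x * y)"
    unfolding distrib_left two_choose2 by (simp add: algebra_simps)
  then have "of_nat 2 * (choose2 (x + y) - (choose2 x + choose2 y + x * y)) = 0"
    by (simp add: algebra_simps)
  from of_nat_cancel[OF _ this] show ?thesis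
    by simp
qed

text \<open>For the multiplication \<open>(a, z) (b, w) = (a + b, z + w + \<beta> a b)\<close>, where \<open>\<beta>\<close> is the bilinear form with
  coefficients \<open>s\<close>, the ordered product of the powers of the unit vectors with integral exponents \<open>x i\<close>
  is \<open>(x, quad d s x)\<close>.\<close>
definition quad :: "nat \<Rightarrow> (nat \<Rightarrow> nat \<Rightarrow> 'r) \<Rightarrow> (nat \<Rightarrow> 'r) \<Rightarrow> 'r::integer_dense"
  where "quad d s x = (\<Sum>i<d. choose2 (x i) * s i i + (\<Sum>j<i. x j * x i * s j i))"

text \<open>Up to the coboundary of \<open>quad d s\<close>, the bilinear form \<open>s\<close> depends on its alternating part only. For
  symmetric \<open>s\<close> it is a coboundary; for general \<open>s\<close> what remains takes values in any subgroup that
  contains the values of the alternating part.\<close>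
lemma quad_defect:
  fixes s :: "nat \<Rightarrow> nat \<Rightarrow> 'r::integer_dense" and x y :: "nat \<Rightarrow> 'r"
  shows "quad d s x + quad d s y - quad d s (x + y) + (\<Sum>i<d. \<Sum>j<d. s i j * x i * y j) =
    (\<Sum>i<d. \<Sum>j<i. (s i j - s j i) * x i * y j)"
proof (induction d)
  case (Suc d)
  have form: "(\<Sum>i<Suc d. \<Sum>j<Suc d. s i j * x i * y j) = (\<Sum>i<d. \<Sum>j<d. s i j * x i * y j)
      + (\<Sum>j<d. s j d * x j * y d + s d j * x d * y j) + s d d * x d * y d"
    by (simp add: sum.distrib)
  have quad: "quad (Suc d) s z = quad d s z + choose2 (z d) * s d d + (\<Sum>j<d. z j * z d * s j d)" for z
    by (simp add: quad_def)
  have "(\<Sum>j<d. x j * x d * s j d) + (\<Sum>j<d. y j * y d * s j d)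
      - (\<Sum>j<d. (x + y) j * (x + y) d * s j d) + (\<Sum>j<d. s j d * x j * y d + s d j * x d * y j)
      = (\<Sum>j<d. (s d j - s j d) * x d * y j)"
    unfolding sum.distrib[symmetric] sum_subtractf[symmetric]
    by (intro sum.cong refl) (simp add: algebra_simps)
  moreover have "choose2 (x d) * s d d + choose2 (y d) * s d d - choose2 ((x + y) d) * s d d
      + s d d * x d * y d = 0"
    by (simp add: choose2_add algebra_simps)
  moreover have "quad (Suc d) s x + quad (Suc d) s y - quad (Suc d) s (x + y)
      + (\<Sum>i<Suc d. \<Sum>j<Suc d. s i j * x i * y j)
    = (quad d s x + quad d s y - quad d s (x + y) + (\<Sum>i<d. \<Sum>j<d. s i j * x i * y j))
      + (choose2 (x d) * s d d + choose2 (y d) * s d d - choose2 ((x + y) d) * s d d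
        + s d d * x d * y d)
      + ((\<Sum>j<d. x j * x d * s j d) + (\<Sum>j<d. y j * y d * s j d)
        - (\<Sum>j<d. (x + y) j * (x + y) d * s j d)
        + (\<Sum>j<d. s j d * x j * y d + s d j * x d * y j))"
    unfolding form quad by (simp only: algebra_simps)
  ultimately show ?case
    unfolding Suc.IH sum.lessThan_Suc[of _ d] by (simp only: add_0_right)
qed (simp add: quad_def)

text \<open>Over the rationals this is the statement that a subspace of the dual space is determined by its
  annihilator. The proof eliminates one variable at a time without denominators, which is why only a
  multiple of \<open>g\<close> is obtained.\<close>
lemma multiple_in_subgroup_if_vanishes_on_annihilator:
  fixes F :: "(nat \<Rightarrow> int) set"
  assumes "add_subgroup F" "F \<subseteq> vecs d" "g \<in> vecs d"
    and "\<And>x. x \<in> vecs d \<Longrightarrow> (\<And>f. f \<in> F \<Longrightarrow> (\<Sum>i<d. f i * x i) = 0) \<Longrightarrow> (\<Sum>i<d. g i * x i) = 0"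
  shows "\<exists>n::nat. n > 0 \<and> vscale (int n) g \<in> F"
  using assms
proof (induction d arbitrary: F g)
  case 0
  then have "vscale (int 1) g \<in> F"
    using add_subgroup_closed(1)[OF 0(1)] by (auto simp: vecs_def zero_fun_def vscale_def fun_eq_iff)
  then show ?case
    using zero_less_one by blast
next
  case (Suc d)
  note F_scale = add_subgroup_vscale[OF Suc.prems(1)]
  have vecs_Suc: "x \<in> vecs d \<Longrightarrow> x \<in> vecs (Suc d)" for x :: "nat \<Rightarrow> int"
    by (rule vecs_mono) auto
  show ?case
  proof (cases "\<forall>f\<in>F. f d = 0")
    case True
    have "(\<Sum>i<Suc d. g i * unit_vec d i) = 0"
    proof (rule Suc.prems(4))
      show "(\<Sum>i<Suc d. f i * unit_vec d i) = 0" if "f \<in> F" for f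
        using True that by (simp add: unit_vec_def)
    qed simp
    then have g0: "g d = 0"
      by (simp add: unit_vec_def)
    show ?thesis
    proof (rule Suc.IH)
      show "F \<subseteq> vecs d" "g \<in> vecs d"
        using True Suc.prems(2,3) g0 vecs_SucD by blast+
      show "(\<Sum>i<d. g i * x i) = 0" if "x \<in> vecs d" "\<And>f. f \<in> F \<Longrightarrow> (\<Sum>i<d. f i * x i) = 0" for x
        using Suc.prems(4)[OF vecs_Suc[OF that(1)]] that(2) True g0 by simp
    qed (rule Suc.prems)
  next
    case False
    then obtain h where h: "h \<in> F" "h d \<noteq> 0"
      by blast
    define F' where "F' = {f \<in> F. f d = 0}"
    define g' where "g' = vscale (h d) g - vscale (g d) h"
    have "\<exists>n::nat. n > 0 \<and> vscale (int n) g' \<in> F'"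
    proof (rule Suc.IH)
      show "add_subgroup F'"
        using Suc.prems(1) by (simp add: add_subgroup_def F'_def)
      show "F' \<subseteq> vecs d"
        using Suc.prems(2) vecs_SucD by (auto simp: F'_def)
      show "g' \<in> vecs d"
        using subsetD[OF Suc.prems(2) h(1)] Suc.prems(3) by - (rule vecs_SucD, simp_all add: g'_def)
      fix x assume x: "x \<in> vecs d" "\<And>f. f \<in> F' \<Longrightarrow> (\<Sum>i<d. f i * x i) = 0"
      \<comment> \<open>\<open>y\<close> extends the multiple \<open>h d\<close> of \<open>x\<close> to a zero of \<open>h\<close>, by the choice of its last coordinate.\<close>
      define t where "t = (\<Sum>i<d. h i * x i)"
      define y where "y = vscale (h d) x + vscale (- t) (unit_vec d)"
      have xd: "x d = 0"
        using x(1) by (simp add: vecs_def)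
      have pair_y: "(\<Sum>i<Suc d. f i * y i) = h d * (\<Sum>i<d. f i * x i) - t * f d" for f
      proof -
        have "(\<Sum>i<d. f i * y i) = (\<Sum>i<d. h d * (f i * x i))"
          by (intro sum.cong refl) (simp add: y_def unit_vec_def algebra_simps)
        moreover have "y d = - t"
          using xd by (simp add: y_def unit_vec_def)
        ultimately show ?thesis
          by (simp add: sum_distrib_left)
      qed
      have "(\<Sum>i<Suc d. g i * y i) = 0"
      proof (rule Suc.prems(4))
        show "y \<in> vecs (Suc d)"
          using vecs_Suc[OF x(1)] by (simp add: y_def)
        fix f assume f: "f \<in> F"
        have "vscale (h d) f - vscale (f d) h \<in> F'"
          using F_scale f h add_subgroup_closed(2)[OF Suc.prems(1)] by (simp add: F'_def)
        from x(2)[OF this] have "h d * (\<Sum>i<d. f i * x i) - t * f d = 0"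
          by (simp add: left_diff_distrib sum_subtractf sum_distrib_left t_def mult.assoc mult.commute[of "f d"]
              sum_distrib_right)
        then show "(\<Sum>i<Suc d. f i * y i) = 0"
          unfolding pair_y .
      qed
      then have "h d * (\<Sum>i<d. g i * x i) - t * g d = 0"
        unfolding pair_y .
      moreover have "(\<Sum>i<d. g' i * x i) = h d * (\<Sum>i<d. g i * x i) - g d * t"
        by (simp add: g'_def left_diff_distrib sum_subtractf sum_distrib_left t_def mult.assoc)
      ultimately show "(\<Sum>i<d. g' i * x i) = 0"
        by (simp add: mult.commute)
    qed
    then obtain n :: nat where n: "n > 0" "vscale (int n) g' \<in> F"
      by (auto simp: F'_def)
    have "vscale (int n * h d) g = vscale (int n) g' + vscale (int n * g d) h"
      by (simp add: g'_def fun_eq_iff algebra_simps)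
    then have "vscale (int n * h d) g \<in> F"
      using n F_scale h add_subgroup_closed(4)[OF Suc.prems(1)] by simp
    then have "vscale (sgn (h d)) (vscale (int n * h d) g) \<in> F"
      by (rule F_scale)
    moreover have "vscale (sgn (h d)) (vscale (int n * h d) g) = vscale (int (n * nat \<bar>h d\<bar>)) g"
    proof -
      have "sgn (h d) * (int n * h d) = int (n * nat \<bar>h d\<bar>)"
        by (simp add: sgn_if abs_if)
      then show ?thesis
        by (metis (no_types, lifting) ext mult.assoc vscale_apply)
    qed
    ultimately have "vscale (int (n * nat \<bar>h d\<bar>)) g \<in> F"
      by (simp only:)
    moreover have "n * nat \<bar>h d\<bar> > 0"
      using n(1) h(2) by simp
    ultimately show ?thesis
      by blast
  qed
qed

section \<open>Twisted groups and their Lie algebras\<close>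

text \<open>The coefficients of a bilinear map with integral matrix entries, which makes sense over every
  commutative ring: \<open>coeff D i j k\<close> is the coordinate \<open>k\<close> of the value at the unit vectors \<open>i\<close> and \<open>j\<close>.\<close>
datatype twist = Twist (base_rank: nat) (center_rank: nat) (coeff: "nat \<Rightarrow> nat \<Rightarrow> nat \<Rightarrow> int")

abbreviation base :: "twist \<Rightarrow> (nat \<Rightarrow> 'r::zero) set"
  where "base D \<equiv> vecs (base_rank D)"

abbreviation center :: "twist \<Rightarrow> (nat \<Rightarrow> 'r::zero) set"
  where "center D \<equiv> vecs (center_rank D)"

definition cocycle :: "twist \<Rightarrow> (nat \<Rightarrow> 'r) \<Rightarrow> (nat \<Rightarrow> 'r) \<Rightarrow> nat \<Rightarrow> 'r::comm_ring_1"
  where "cocycle D x y = (\<lambda>k. if k < center_rank D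
    then \<Sum>i<base_rank D. \<Sum>j<base_rank D. of_int (coeff D i j k) * x i * y j else 0)"

definition bracket :: "twist \<Rightarrow> (nat \<Rightarrow> 'r) \<Rightarrow> (nat \<Rightarrow> 'r) \<Rightarrow> nat \<Rightarrow> 'r::comm_ring_1"
  where "bracket D x y = cocycle D x y - cocycle D y x"

lemma cocycle_center [simp]: "cocycle D x y \<in> center D"
  by (simp add: cocycle_def vecs_def)

lemma bracket_center [simp]: "bracket D x y \<in> center D"
  by (simp add: bracket_def)

lemma cocycle_add_left: "cocycle D (x + x') y = cocycle D x y + cocycle D x' y"
  by (rule ext) (simp add: cocycle_def sum.distrib algebra_simps)

lemma cocycle_add_right: "cocycle D x (y + y') = cocycle D x y + cocycle D x y'"
  by (rule ext) (simp add: cocycle_def sum.distrib algebra_simps)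

lemma cocycle_scale_left: "cocycle D (vscale s x) y = vscale s (cocycle D x y)"
  by (rule ext) (simp add: cocycle_def sum_distrib_left mult_ac)

lemma cocycle_scale_right: "cocycle D x (vscale s y) = vscale s (cocycle D x y)"
  by (rule ext) (simp add: cocycle_def sum_distrib_left mult_ac)

lemma cocycle_zero [simp]: "cocycle D 0 y = 0" "cocycle D x 0 = 0"
  by (rule ext, simp add: cocycle_def)+

lemma cocycle_uminus: "cocycle D (- x) y = - cocycle D x y" "cocycle D x (- y) = - cocycle D x y"
  by (rule ext, simp add: cocycle_def sum_negf)+

lemma bracket_add_left: "bracket D (x + x') y = bracket D x y + bracket D x' y"
  and bracket_add_right: "bracket D x (y + y') = bracket D x y + bracket D x y'"
  by (simp_all add: bracket_def cocycle_add_left cocycle_add_right)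

lemma bracket_zero [simp]: "bracket D 0 y = 0" "bracket D x 0 = 0"
  by (simp_all add: bracket_def)

lemma bracket_eq_0_iff: "bracket D x y = 0 \<longleftrightarrow> cocycle D x y = cocycle D y x"
  by (simp add: bracket_def)

text \<open>Over the integers this says that the center of the twisted group is no larger than \<open>center D\<close>.\<close>
definition nondegenerate :: "twist \<Rightarrow> bool"
  where "nondegenerate D \<longleftrightarrow>
    (\<forall>x \<in> base D. (\<forall>y \<in> base D. bracket D x y = (0 :: nat \<Rightarrow> int)) \<longrightarrow> x = 0)"

lemma bracket_unit_vec:
  assumes "j < base_rank D" "k < center_rank D"
  shows "bracket D x (unit_vec j) k
    = (\<Sum>i<base_rank D. of_int (coeff D i j k - coeff D j i k) * x i)"
proof -
  have "(\<Sum>i<base_rank D. \<Sum>l<base_rank D. of_int (coeff D i l k) * x i * unit_vec j l)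
      = (\<Sum>i<base_rank D. of_int (coeff D i j k) * x i)"
    using assms by (simp add: unit_vec_def if_distrib[of "\<lambda>t. _ * t"] sum.delta cong: if_cong)
  moreover have "(\<Sum>l<base_rank D. \<Sum>i<base_rank D. of_int (coeff D l i k) * unit_vec j l * x i)
      = (\<Sum>i<base_rank D. of_int (coeff D j i k) * x i)"
    by (subst sum.swap) (use assms in \<open>simp add: unit_vec_def if_distrib[of "\<lambda>t. _ * t"]
        if_distrib[of "\<lambda>t. t * _"] sum.delta cong: if_cong\<close>)
  ultimately show ?thesis
    using assms(2) by (simp add: bracket_def cocycle_def left_diff_distrib sum_subtractf)
qed

text \<open>Nondegeneracy is a statement on ranks and hence survives the extension of scalars. Since the ring
  need not be a domain, ranks are replaced by the linear relations with integral coefficients between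
  the coordinates of \<open>x\<close>: they include all rows of the bracket, so by nondegeneracy over the integers
  only 0 is annihilated by all of them, and elimination produces a relation \<open>n * x i = 0\<close>.\<close>
lemma nondegenerate_integer_dense:
  fixes x :: "nat \<Rightarrow> 'r::integer_dense"
  assumes nd: "nondegenerate D" and x: "x \<in> base D" "\<And>y. y \<in> base D \<Longrightarrow> bracket D x y = 0"
  shows "x = 0"
proof (rule vecs_eqI[OF x(1)])
  define d where "d = base_rank D"
  \<comment> \<open>the integral linear relations between the coordinates of \<open>x\<close>\<close>
  define F where "F = {f \<in> vecs d. (\<Sum>i<d. of_int (f i) * x i) = 0}"
  fix i assume i: "i < base_rank D"
  have "\<exists>n::nat. n > 0 \<and> vscale (int n) (unit_vec i) \<in> F"
  proof (rule multiple_in_subgroup_if_vanishes_on_annihilator)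
    show "add_subgroup F"
      by (auto simp: F_def add_subgroup_def left_diff_distrib sum_subtractf)
    show "F \<subseteq> vecs d" "unit_vec i \<in> vecs d"
      using i by (auto simp: F_def d_def)
    fix u :: "nat \<Rightarrow> int"
    assume u: "u \<in> vecs d" "\<And>f. f \<in> F \<Longrightarrow> (\<Sum>i<d. f i * u i) = 0"
    have unit: "bracket D u (unit_vec j) k = 0" if j: "j < d" for j k
    proof (cases "k < center_rank D")
      case True
      define f where "f = (\<lambda>i. if i < d then coeff D i j k - coeff D j i k else 0)"
      have "(\<Sum>i<d. of_int (f i) * x i) = bracket D x (unit_vec j) k"
        unfolding bracket_unit_vec[OF j[unfolded d_def] True] d_def[symmetric] by (simp add: f_def)
      then have "f \<in> F"
        using x(2)[OF unit_vec_vecs[OF j[unfolded d_def]]] by (simp add: F_def) (simp add: f_def vecs_def)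
      from u(2)[OF this] show ?thesis
        unfolding bracket_unit_vec[OF j[unfolded d_def] True] d_def[symmetric] by (simp add: f_def)
    qed (use bracket_center[of D u "unit_vec j"] in \<open>simp add: vecs_def\<close>)
    have "bracket D u y = 0" if "y \<in> base D" for y
    proof (rule ext)
      fix k
      have "additive_on (vecs d) (\<lambda>y. bracket D u y k)"
        by (simp add: additive_on_def bracket_add_right)
      from additive_expand[OF this] show "bracket D u y k = 0 k"
        using that unit by (simp add: d_def)
    qed
    then have "u = 0"
      using nd u(1) by (simp add: nondegenerate_def d_def)
    then show "(\<Sum>l<d. unit_vec i l * u l) = 0"
      by simp
  qed
  then obtain n :: nat where n: "n > 0" "(\<Sum>l<d. of_int (vscale (int n) (unit_vec i) l) * x l) = 0"
    unfolding F_def by blast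
  have "(\<Sum>l<d. of_int (vscale (int n) (unit_vec i) l) * x l) = (\<Sum>l<d. if l = i then of_nat n * x i else 0)"
    by (intro sum.cong refl) (simp add: unit_vec_def)
  also have "\<dots> = of_nat n * x i"
    using i by (simp add: d_def)
  finally have "of_nat n * x i = 0"
    using n(2) by simp
  from of_nat_cancel[OF n(1) this] show "x i = 0 i"
    by simp
qed simp

type_synonym 'r vec_pair = "(nat \<Rightarrow> 'r) \<times> (nat \<Rightarrow> 'r)"

definition twisted_group :: "twist \<Rightarrow> 'r::comm_ring_1 vec_pair monoid"
  where "twisted_group D = \<lparr>carrier = base D \<times> center D,
    monoid.mult = (\<lambda>(a, z) (b, w). (a + b, z + w + cocycle D a b)), monoid.one = (0, 0)\<rparr>"

text \<open>The parameter \<open>\<zeta>\<close> lets the scalars be taken from a ring of another type, such as the profinite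
  integers in the form of sequences of cosets.\<close>
definition lie_model :: "('s \<Rightarrow> 'r) \<Rightarrow> twist \<Rightarrow> ('s, 'r::comm_ring_1 vec_pair) module"
  where "lie_model \<zeta> D = \<lparr>carrier = base D \<times> center D,
    monoid.mult = (\<lambda>(a, z) (b, w). (0, bracket D a b)), monoid.one = undefined,
    ring.zero = 0, ring.add = (+),
    module.smult = (\<lambda>s (a, z). (vscale (\<zeta> s) a, vscale (\<zeta> s) z))\<rparr>"

lemma twisted_group_simps [simp]:
  "carrier (twisted_group D) = base D \<times> center D"
  "(a, z) \<otimes>\<^bsub>twisted_group D\<^esub> (b, w) = (a + b, z + w + cocycle D a b)"
  "\<one>\<^bsub>twisted_group D\<^esub> = (0, 0)"
  by (simp_all add: twisted_group_def)

lemma lie_model_simps [simp]: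
  "carrier (lie_model \<zeta> D) = base D \<times> center D"
  "(a, z) \<otimes>\<^bsub>lie_model \<zeta> D\<^esub> (b, w) = (0, bracket D a b)"
  "\<zero>\<^bsub>lie_model \<zeta> D\<^esub> = (0, 0)"
  "u \<oplus>\<^bsub>lie_model \<zeta> D\<^esub> v = u + v"
  "s \<odot>\<^bsub>lie_model \<zeta> D\<^esub> (a, z) = (vscale (\<zeta> s) a, vscale (\<zeta> s) z)"
  by (simp_all add: lie_model_def zero_prod_def)

lemma group_twisted_group: "group (twisted_group D)"
proof (rule groupI)
  fix x :: "'a vec_pair"
  assume x: "x \<in> carrier (twisted_group D)"
  obtain a z where az: "x = (a, z)"
    by (cases x)
  show "\<exists>y\<in>carrier (twisted_group D). y \<otimes>\<^bsub>twisted_group D\<^esub> x = \<one>\<^bsub>twisted_group D\<^esub>"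
    using x unfolding az
    by (intro bexI[of _ "(- a, - z + cocycle D a a)"]) (simp_all add: cocycle_uminus)
qed (auto simp: cocycle_add_left cocycle_add_right algebra_simps)

section \<open>Classification by the bracket\<close>

definition bracket_iso ::
  "twist \<Rightarrow> twist \<Rightarrow> ((nat \<Rightarrow> 'r) \<Rightarrow> nat \<Rightarrow> 'r) \<Rightarrow> ((nat \<Rightarrow> 'r) \<Rightarrow> nat \<Rightarrow> 'r::comm_ring_1) \<Rightarrow> bool"
  where "bracket_iso D D' f g \<longleftrightarrow>
    bij_betw f (base D) (base D') \<and> additive_on (base D) f \<and>
    bij_betw g (center D) (center D') \<and> additive_on (center D) g \<and>
    (\<forall>x \<in> base D. \<forall>y \<in> base D. bracket D' (f x) (f y) = g (bracket D x y))"

lemma additive_vec_linear: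
  fixes f :: "(nat \<Rightarrow> 'r::integer_dense) \<Rightarrow> nat \<Rightarrow> 'r"
  assumes "additive_on (vecs d) f" "x \<in> vecs d"
  shows "f (vscale s x) = vscale s (f x)"
proof (rule ext)
  fix k
  have "additive_on (vecs d) (\<lambda>x. f x k)"
    using assms(1) by (simp add: additive_on_def)
  from additive_linear[OF this assms(2)] show "f (vscale s x) k = vscale s (f x) k"
    by simp
qed

text \<open>The part of the classification common to groups and Lie algebras: a bijection \<open>F\<close> respecting the
  extension of the base by the center induces bijections on both.\<close>
lemma bracket_iso_of_bijection:
  fixes F :: "'r::comm_ring_1 vec_pair \<Rightarrow> 'r vec_pair"
  assumes bij: "bij_betw F (base D \<times> center D) (base D' \<times> center D')"
    and split: "\<And>a z. a \<in> base D \<Longrightarrow> z \<in> center D \<Longrightarrow> F (a, z) = F (a, 0) + F (0, z)"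
    and center: "\<And>z. z \<in> center D \<Longrightarrow> fst (F (0, z)) = 0"
    and kernel: "\<And>a. a \<in> base D \<Longrightarrow> fst (F (a, 0)) = 0 \<Longrightarrow> a = 0"
    and f: "additive_on (base D) (\<lambda>a. fst (F (a, 0)))"
    and g: "additive_on (center D) (\<lambda>z. snd (F (0, z)))"
    and bracket: "\<And>a b. a \<in> base D \<Longrightarrow> b \<in> base D \<Longrightarrow>
      bracket D' (fst (F (a, 0))) (fst (F (b, 0))) = snd (F (0, bracket D a b))"
  shows "bracket_iso D D' (\<lambda>a. fst (F (a, 0))) (\<lambda>z. snd (F (0, z)))"
  unfolding bracket_iso_def
proof (intro conjI ballI f g bracket)
  have range: "fst (F (a, z)) \<in> base D'" "snd (F (a, z)) \<in> center D'"
    if "a \<in> base D" "z \<in> center D" for a z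
    using bij_betwE[OF bij] that by (auto simp: mem_Times_iff)
  have inj: "F p = F q \<Longrightarrow> p \<in> base D \<times> center D \<Longrightarrow> q \<in> base D \<times> center D \<Longrightarrow> p = q" for p q
    by (rule inj_onD[OF bij_betw_imp_inj_on[OF bij]])
  have fst_F: "fst (F (a, z)) = fst (F (a, 0))" if "a \<in> base D" "z \<in> center D" for a z
    using split[OF that] center[OF that(2)] by simp
  have surj: "\<exists>a\<in>base D. \<exists>z\<in>center D. F (a, z) = (b, w)" if "b \<in> base D'" "w \<in> center D'" for b w
  proof -
    have "(b, w) \<in> F ` (base D \<times> center D)"
      using bij that by (simp add: bij_betw_def)
    then obtain p where "p \<in> base D \<times> center D" "F p = (b, w)"
      by (auto simp del: mem_Times_iff)
    then show ?thesis
      by (cases p) auto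
  qed
  show "bij_betw (\<lambda>a. fst (F (a, 0))) (base D) (base D')"
    unfolding bij_betw_def
  proof
    show "inj_on (\<lambda>a. fst (F (a, 0))) (base D)"
    proof (rule inj_onI)
      fix a b assume ab: "a \<in> base D" "b \<in> base D" "fst (F (a, 0)) = fst (F (b, 0))"
      have "fst (F (a - b, 0)) = 0"
        using additive_on_simps(3)[OF f vecs_subgroup ab(1,2)] ab(3) by simp
      then have "a - b = 0"
        using ab by - (rule kernel, simp_all)
      then show "a = b"
        by simp
    qed
    show "(\<lambda>a. fst (F (a, 0))) ` base D = base D'"
    proof
      show "base D' \<subseteq> (\<lambda>a. fst (F (a, 0))) ` base D"
      proof
        fix b :: "nat \<Rightarrow> 'r" assume "b \<in> base D'"
        then obtain a z where "a \<in> base D" "z \<in> center D" "F (a, z) = (b, 0)"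
          using surj[of b 0] by auto
        then show "b \<in> (\<lambda>a. fst (F (a, 0))) ` base D"
          using fst_F[of a z] by (intro image_eqI[of _ _ a]) simp_all
      qed
    qed (use range in auto)
  qed
  show "bij_betw (\<lambda>z. snd (F (0, z))) (center D) (center D')"
    unfolding bij_betw_def
  proof
    show "inj_on (\<lambda>z. snd (F (0, z))) (center D)"
    proof (rule inj_onI)
      fix z w assume zw: "z \<in> center D" "w \<in> center D" "snd (F (0, z)) = snd (F (0, w))"
      have "(0 :: nat \<Rightarrow> 'r, z) = (0, w)"
        using zw center by - (rule inj, simp_all add: prod_eq_iff)
      then show "z = w"
        by simp
    qed
    show "(\<lambda>z. snd (F (0, z))) ` center D = center D'"
    proof
      show "center D' \<subseteq> (\<lambda>z. snd (F (0, z))) ` center D"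
      proof
        fix w :: "nat \<Rightarrow> 'r" assume "w \<in> center D'"
        then obtain a z where az: "a \<in> base D" "z \<in> center D" "F (a, z) = (0, w)"
          using surj[of 0 w] by auto
        then have "a = 0"
          using fst_F[of a z] by - (rule kernel, simp_all)
        then show "w \<in> (\<lambda>z. snd (F (0, z))) ` center D"
          using az by (intro image_eqI[of _ _ z]) simp_all
      qed
    qed (use range in auto)
  qed
qed

text \<open>By nondegeneracy an isomorphism preserves centers, so it induces additive maps on centers and on
  quotients. Comparing the images of the products of \<open>a\<close> and \<open>b\<close> in both orders shows that these respect
  the brackets, which are the commutators.\<close>
lemma twisted_group_iso_imp_bracket_iso:
  fixes F :: "'r::integer_dense vec_pair \<Rightarrow> 'r vec_pair"
  assumes nd: "nondegenerate D" "nondegenerate D'"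
    and F: "F \<in> iso (twisted_group D) (twisted_group D')"
  shows "\<exists>f g. bracket_iso D D' f (g :: _ \<Rightarrow> nat \<Rightarrow> 'r)"
proof -
  have bij: "bij_betw F (base D \<times> center D) (base D' \<times> center D')"
    using F by (simp add: iso_def)
  have range: "fst (F (a, z)) \<in> base D'" "snd (F (a, z)) \<in> center D'"
    if "a \<in> base D" "z \<in> center D" for a z
    using bij_betwE[OF bij] that by (auto simp: mem_Times_iff)
  have hom: "F (a + b, z + w + cocycle D a b) =
      (fst (F (a, z)) + fst (F (b, w)),
       snd (F (a, z)) + snd (F (b, w)) + cocycle D' (fst (F (a, z))) (fst (F (b, w))))"
    if "a \<in> base D" "b \<in> base D" "z \<in> center D" "w \<in> center D" for a b z w
  proof -
    have "F ((a, z) \<otimes>\<^bsub>twisted_group D\<^esub> (b, w))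
      = F (a, z) \<otimes>\<^bsub>twisted_group D'\<^esub> F (b, w)"
      using F that by (intro hom_mult[of F]) (simp_all add: iso_def)
    then show ?thesis
      by (simp add: twisted_group_def case_prod_beta)
  qed
  have inj: "F p = F q \<Longrightarrow> p \<in> base D \<times> center D \<Longrightarrow> q \<in> base D \<times> center D \<Longrightarrow> p = q" for p q
    by (rule inj_onD[OF bij_betw_imp_inj_on[OF bij]])
  have surj: "\<exists>a\<in>base D. \<exists>z\<in>center D. F (a, z) = (b, w)" if "b \<in> base D'" "w \<in> center D'" for b w
  proof -
    have "(b, w) \<in> F ` (base D \<times> center D)"
      using bij that by (simp add: bij_betw_def)
    then obtain p where "p \<in> base D \<times> center D" "F p = (b, w)"
      by (auto simp del: mem_Times_iff)
    then show ?thesis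
      by (cases p) auto
  qed
  have center: "fst (F (0, z)) = 0" if z: "z \<in> center D" for z
  proof (rule nondegenerate_integer_dense[OF nd(2)])
    fix b' :: "nat \<Rightarrow> 'r" assume "b' \<in> base D'"
    then obtain b w where bw: "b \<in> base D" "w \<in> center D" "F (b, w) = (b', 0)"
      using surj[of b' 0] by auto
    have "F (0 + b, z + w + cocycle D 0 b) = F (b + 0, w + z + cocycle D b 0)"
      by (simp add: add.commute)
    then show "bracket D' (fst (F (0, z))) b' = 0"
      using hom[of 0 b z w] hom[of b 0 w z] z bw by (simp add: bracket_eq_0_iff algebra_simps)
  qed (use range z in auto)
  have kernel: "a = 0" if a: "a \<in> base D" "fst (F (a, 0)) = 0" for a
  proof (rule nondegenerate_integer_dense[OF nd(1) a(1)])
    fix b :: "nat \<Rightarrow> 'r" assume b: "b \<in> base D"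
    have "F (a + b, 0 + 0 + cocycle D a b) = F (b + a, 0 + 0 + cocycle D b a)"
      using hom[of a b 0 0] hom[of b a 0 0] a b by (simp add: algebra_simps)
    then have "(a + b, 0 + 0 + cocycle D a b) = (b + a, 0 + 0 + cocycle D b a)"
      by (rule inj) (use a b in simp_all)
    then show "bracket D a b = 0"
      by (simp add: bracket_eq_0_iff)
  qed
  have split: "F (a, z) = F (a, 0) + F (0, z)" if "a \<in> base D" "z \<in> center D" for a z
    using hom[of a 0 0 z] that center[of z] by (simp add: prod_eq_iff)
  have F_add: "F (a + b, cocycle D a b)
      = (fst (F (a, 0)) + fst (F (b, 0)),
         snd (F (a, 0)) + snd (F (b, 0)) + cocycle D' (fst (F (a, 0))) (fst (F (b, 0))))"
    if "a \<in> base D" "b \<in> base D" for a b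
    using hom[of a b 0 0] that by simp
  have f: "fst (F (a + b, 0)) = fst (F (a, 0)) + fst (F (b, 0))" if "a \<in> base D" "b \<in> base D" for a b
  proof -
    have "fst (F (a + b, cocycle D a b)) = fst (F (a + b, 0))"
      using split[of "a + b" "cocycle D a b"] center[of "cocycle D a b"] that by simp
    then show ?thesis
      unfolding F_add[OF that] by simp
  qed
  have g: "snd (F (0, z + w)) = snd (F (0, z)) + snd (F (0, w))" if "z \<in> center D" "w \<in> center D" for z w
    using hom[of 0 0 z w] center that by simp
  have F_cocycle: "snd (F (a + b, 0)) + snd (F (0, cocycle D a b)) =
      snd (F (a, 0)) + snd (F (b, 0)) + cocycle D' (fst (F (a, 0))) (fst (F (b, 0)))"
    if "a \<in> base D" "b \<in> base D" for a b
  proof -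
    have "snd (F (a + b, cocycle D a b)) = snd (F (a + b, 0)) + snd (F (0, cocycle D a b))"
      using split[of "a + b" "cocycle D a b"] that by simp
    then show ?thesis
      unfolding F_add[OF that] by simp
  qed
  have g': "additive_on (center D) (\<lambda>z. snd (F (0, z)))"
    using g by (simp add: additive_on_def)
  have "bracket_iso D D' (\<lambda>a. fst (F (a, 0))) (\<lambda>z. snd (F (0, z)))"
  proof (rule bracket_iso_of_bijection[OF bij split center kernel _ g'])
    show "additive_on (base D) (\<lambda>a. fst (F (a, 0)))"
      using f by (simp add: additive_on_def)
    show "bracket D' (fst (F (a, 0))) (fst (F (b, 0))) = snd (F (0, bracket D a b))"
      if "a \<in> base D" "b \<in> base D" for a b
    proof -
      have "snd (F (0, bracket D a b)) = snd (F (0, cocycle D a b)) - snd (F (0, cocycle D b a))"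
        unfolding bracket_def by (rule additive_on_simps(3)[OF g' vecs_subgroup]) simp_all
      also have "\<dots> = (snd (F (a + b, 0)) + snd (F (0, cocycle D a b)))
          - (snd (F (b + a, 0)) + snd (F (0, cocycle D b a)))"
        by (simp add: add.commute[of b a])
      also have "\<dots> = bracket D' (fst (F (a, 0))) (fst (F (b, 0)))"
        unfolding F_cocycle[OF that] F_cocycle[OF that(2,1)] bracket_def by simp
      finally show ?thesis ..
    qed
  qed auto
  then show ?thesis
    by blast
qed

text \<open>The map \<open>(a, z) \<mapsto> (f a, g z)\<close> need not be multiplicative, because \<open>f\<close> and \<open>g\<close> respect only the
  alternating parts of the cocycles. The difference \<open>\<sigma>\<close> of the cocycles is symmetric, hence the coboundary
  of a quadratic function \<open>q\<close>, and \<open>(a, z) \<mapsto> (f a, g z + q a)\<close> is an isomorphism.\<close>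
lemma bracket_iso_imp_twisted_group_iso:
  fixes f g :: "(nat \<Rightarrow> 'r::integer_dense) \<Rightarrow> nat \<Rightarrow> 'r"
  assumes "bracket_iso D D' f g"
  shows "(twisted_group D :: 'r vec_pair monoid) \<cong> (twisted_group D' :: 'r vec_pair monoid)"
proof -
  define d where "d = base_rank D"
  have f: "bij_betw f (base D) (base D')" "additive_on (base D) f"
    and g: "bij_betw g (center D) (center D')" "additive_on (center D) g"
    and fg: "\<And>x y. x \<in> base D \<Longrightarrow> y \<in> base D \<Longrightarrow> bracket D' (f x) (f y) = g (bracket D x y)"
    using assms by (auto simp: bracket_iso_def)
  note f_simps = additive_on_simps[OF f(2) vecs_subgroup]
  note g_simps = additive_on_simps[OF g(2) vecs_subgroup]
  define \<sigma> where "\<sigma> x y = cocycle D' (f x) (f y) - g (cocycle D x y)" for x y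
  have \<sigma>_sym: "\<sigma> x y = \<sigma> y x" if "x \<in> base D" "y \<in> base D" for x y
    using fg[OF that] by (simp add: \<sigma>_def bracket_def g_simps algebra_simps)
  have \<sigma>_left: "additive_on (base D) (\<lambda>x. \<sigma> x y k)" for y k
    by (simp add: additive_on_def \<sigma>_def f_simps g_simps cocycle_add_left)
  have \<sigma>_right: "additive_on (base D) (\<lambda>y. \<sigma> x y k)" for x k
    by (simp add: additive_on_def \<sigma>_def f_simps g_simps cocycle_add_right)
  have g_range: "g z \<in> center D'" if "z \<in> center D" for z
    using bij_betwE[OF g(1)] that by blast
  have f_range: "f x \<in> base D'" if "x \<in> base D" for x
    using bij_betwE[OF f(1)] that by blast
  \<comment> \<open>By symmetry the right-hand side of \<open>quad_defect\<close> vanishes, so \<open>\<sigma>\<close> is minus the coboundary of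
    the map \<open>q\<close>.\<close>
  define s where "s k i j = \<sigma> (unit_vec i) (unit_vec j) k" for k i j
  define q where "q x = (\<lambda>k. if k < center_rank D' then quad d (s k) x else 0)" for x
  have q_range: "q x \<in> center D'" for x
    by (simp add: q_def vecs_def)
  have q_add: "q (x + y) = q x + q y + \<sigma> x y" if xy: "x \<in> base D" "y \<in> base D" for x y
  proof (rule ext)
    fix k
    show "q (x + y) k = (q x + q y + \<sigma> x y) k"
    proof (cases "k < center_rank D'")
      case True
      have "\<sigma> x y k = (\<Sum>i<d. \<Sum>j<d. s k i j * x i * y j)"
        unfolding s_def d_def
        by (rule biadditive_expand[of _ "\<lambda>x y. \<sigma> x y k"]) (use \<sigma>_left \<sigma>_right xy in auto)
      moreover have "(\<Sum>i<d. \<Sum>j<i. (s k i j - s k j i) * x i * y j) = 0"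
      proof (intro sum.neutral ballI)
        fix i j assume "i \<in> {..<d}" "j \<in> {..<i}"
        then have "s k i j = s k j i"
          unfolding s_def by (subst \<sigma>_sym) (simp_all add: d_def)
        then show "(s k i j - s k j i) * x i * y j = 0"
          by simp
      qed
      ultimately have "quad d (s k) x + quad d (s k) y - quad d (s k) (x + y) + \<sigma> x y k = 0"
        using quad_defect[of d "s k" x y] by simp
      then show ?thesis
        using True by (simp add: q_def algebra_simps)
    next
      case False
      have "\<sigma> x y \<in> center D'"
        by (simp add: \<sigma>_def g_range)
      then show ?thesis
        using False by (simp add: q_def vecs_zero)
    qed
  qed
  define F where "F = (\<lambda>(a, z). (f a, g z + q a))"
  have "F \<in> iso (twisted_group D) (twisted_group D')"
    unfolding iso_def
  proof (intro CollectI conjI)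
    show "F \<in> hom (twisted_group D) (twisted_group D')"
    proof (rule homI)
      fix x y :: "'r vec_pair"
      assume "x \<in> carrier (twisted_group D)" "y \<in> carrier (twisted_group D)"
      moreover obtain a z b w where "x = (a, z)" "y = (b, w)"
        by (cases x, cases y)
      ultimately show "F (x \<otimes>\<^bsub>twisted_group D\<^esub> y) = F x \<otimes>\<^bsub>twisted_group D'\<^esub> F y"
        by (simp add: F_def f_simps g_simps q_add) (simp add: \<sigma>_def)
    qed (auto simp: F_def f_range g_range q_range)
    show "bij_betw F (carrier (twisted_group D)) (carrier (twisted_group D'))"
      unfolding bij_betw_def
    proof
      show "inj_on F (carrier (twisted_group D))"
        using f(1) g(1) by (auto simp: inj_on_def F_def bij_betw_def)
      show "F ` carrier (twisted_group D) = carrier (twisted_group D')"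
      proof
        show "carrier (twisted_group D') \<subseteq> F ` carrier (twisted_group D)"
        proof
          fix y :: "'r vec_pair" assume y: "y \<in> carrier (twisted_group D')"
          obtain b w where bw: "y = (b, w)"
            by (cases y)
          have "b \<in> f ` base D"
            using y bw f(1) by (simp add: bij_betw_def)
          then obtain a where a: "a \<in> base D" "f a = b"
            by blast
          have "w - q a \<in> center D'"
            using y bw q_range by simp
          then have "w - q a \<in> g ` center D"
            by (simp only: bij_betw_imp_surj_on[OF g(1)])
          then obtain z where "w - q a = g z" "z \<in> center D"
            by (rule imageE)
          with a bw have "y = F (a, z)" "(a, z) \<in> carrier (twisted_group D)"
            by (simp_all add: F_def diff_eq_eq)
          then show "y \<in> F ` carrier (twisted_group D)"
            by (rule image_eqI)
        qed
      qed (auto simp: F_def f_range g_range q_range)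
    qed
  qed
  then show ?thesis
    unfolding is_iso_def by blast
qed

theorem twisted_groups_isomorphic_iff:
  assumes "nondegenerate D" "nondegenerate D'"
  shows "(twisted_group D :: 'r::integer_dense vec_pair monoid) \<cong> (twisted_group D' :: 'r vec_pair monoid) \<longleftrightarrow>
    (\<exists>f g. bracket_iso D D' f (g :: _ \<Rightarrow> nat \<Rightarrow> 'r))"
proof
  assume "(twisted_group D :: 'r vec_pair monoid) \<cong> (twisted_group D' :: 'r vec_pair monoid)"
  then obtain F :: "'r vec_pair \<Rightarrow> 'r vec_pair"
    where "F \<in> iso (twisted_group D) (twisted_group D')"
    unfolding is_iso_def by blast
  then show "\<exists>f g. bracket_iso D D' f (g :: _ \<Rightarrow> nat \<Rightarrow> 'r)"
    by (rule twisted_group_iso_imp_bracket_iso[OF assms])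
qed (use bracket_iso_imp_twisted_group_iso in blast)

theorem lie_models_isomorphic_iff:
  fixes \<zeta> :: "'s \<Rightarrow> 'r::integer_dense"
  assumes nd: "nondegenerate D" "nondegenerate D'"
  shows "lie_isomorphic S (lie_model \<zeta> D) (lie_model \<zeta> D') \<longleftrightarrow>
    (\<exists>f g. bracket_iso D D' f (g :: _ \<Rightarrow> nat \<Rightarrow> 'r))"
proof
  assume "lie_isomorphic S (lie_model \<zeta> D) (lie_model \<zeta> D')"
  then obtain F where F: "F \<in> iso (add_monoid (lie_model \<zeta> D)) (add_monoid (lie_model \<zeta> D'))"
    and Fb: "\<forall>x\<in>carrier (lie_model \<zeta> D). \<forall>y\<in>carrier (lie_model \<zeta> D).
      F (x \<otimes>\<^bsub>lie_model \<zeta> D\<^esub> y) = F x \<otimes>\<^bsub>lie_model \<zeta> D'\<^esub> F y"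
    unfolding lie_isomorphic_def by blast
  have bij: "bij_betw F (base D \<times> center D) (base D' \<times> center D')"
    using F by (simp add: iso_def)
  have range: "fst (F (a, z)) \<in> base D'" "snd (F (a, z)) \<in> center D'"
    if "a \<in> base D" "z \<in> center D" for a z
    using bij_betwE[OF bij] that by (auto simp: mem_Times_iff)
  have add: "F (x + y) = F x + F y" if "x \<in> base D \<times> center D" "y \<in> base D \<times> center D" for x y
    using F that by (auto simp: iso_def hom_def)
  have br: "F (0, bracket D a b) = (0, bracket D' (fst (F (a, z))) (fst (F (b, w))))"
    if "a \<in> base D" "b \<in> base D" "z \<in> center D" "w \<in> center D" for a b z w
    using Fb[THEN bspec, THEN bspec, of "(a, z)" "(b, w)"] that
    by (simp add: lie_model_def case_prod_beta)
  have inj: "F p = F q \<Longrightarrow> p \<in> base D \<times> center D \<Longrightarrow> q \<in> base D \<times> center D \<Longrightarrow> p = q" for p q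
    by (rule inj_onD[OF bij_betw_imp_inj_on[OF bij]])
  have F0: "F (0, 0) = 0"
    using add[of "(0, 0)" "(0, 0)"] by simp
  have "bracket_iso D D' (\<lambda>a. fst (F (a, 0))) (\<lambda>z. snd (F (0, z)))"
  proof (rule bracket_iso_of_bijection[OF bij])
    show "F (a, z) = F (a, 0) + F (0, z)" if "a \<in> base D" "z \<in> center D" for a z
      using add[of "(a, 0)" "(0, z)"] that by simp
    show "fst (F (0, z)) = 0" if z: "z \<in> center D" for z
    proof (rule nondegenerate_integer_dense[OF nd(2)])
      fix b' :: "nat \<Rightarrow> 'r" assume "b' \<in> base D'"
      then have "(b', 0) \<in> F ` (base D \<times> center D)"
        using bij by (simp add: bij_betw_def)
      then obtain p where "p \<in> base D \<times> center D" "F p = (b', 0)"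
        by (auto simp del: mem_Times_iff)
      then obtain b w where bw: "b \<in> base D" "w \<in> center D" "F (b, w) = (b', 0)"
        by (cases p) auto
      show "bracket D' (fst (F (0, z))) b' = 0"
        using br[of 0 b z w] z bw F0 by (simp add: zero_prod_def)
    qed (use range z in auto)
    show "a = 0" if a: "a \<in> base D" "fst (F (a, 0)) = 0" for a
    proof (rule nondegenerate_integer_dense[OF nd(1) a(1)])
      fix b :: "nat \<Rightarrow> 'r" assume b: "b \<in> base D"
      have "F (0, bracket D a b) = F (0, 0)"
        using br[of a b 0 0] a b F0 by (simp add: zero_prod_def)
      then have "(0, bracket D a b) = ((0, 0) :: 'r vec_pair)"
        by (rule inj) simp_all
      then show "bracket D a b = 0"
        by simp
    qed
    show "additive_on (base D) (\<lambda>a. fst (F (a, 0)))"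
      using add[of "(_, 0)" "(_, 0)"] by (simp add: additive_on_def)
    show "additive_on (center D) (\<lambda>z. snd (F (0, z)))"
      using add[of "(0, _)" "(0, _)"] by (simp add: additive_on_def)
    show "bracket D' (fst (F (a, 0))) (fst (F (b, 0))) = snd (F (0, bracket D a b))"
      if "a \<in> base D" "b \<in> base D" for a b
      using br[of a b 0 0] that by simp
  qed
  then show "\<exists>f g. bracket_iso D D' f (g :: _ \<Rightarrow> nat \<Rightarrow> 'r)"
    by blast
next
  assume "\<exists>f g. bracket_iso D D' f (g :: _ \<Rightarrow> nat \<Rightarrow> 'r)"
  then obtain f g :: "(nat \<Rightarrow> 'r) \<Rightarrow> nat \<Rightarrow> 'r" where
    f: "bij_betw f (base D) (base D')" "additive_on (base D) f"
    and g: "bij_betw g (center D) (center D')" "additive_on (center D) g"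
    and fg: "\<And>x y. x \<in> base D \<Longrightarrow> y \<in> base D \<Longrightarrow> bracket D' (f x) (f y) = g (bracket D x y)"
    unfolding bracket_iso_def by blast
  note f_simps = additive_on_simps[OF f(2) vecs_subgroup]
  note g_simps = additive_on_simps[OF g(2) vecs_subgroup]
  define F where "F = (\<lambda>(a, z). (f a, g z))"
  have bij: "bij_betw F (base D \<times> center D) (base D' \<times> center D')"
    unfolding F_def using bij_betw_map_prod[OF f(1) g(1)] by (simp add: map_prod_def)
  have "F \<in> iso (add_monoid (lie_model \<zeta> D)) (add_monoid (lie_model \<zeta> D'))"
    unfolding iso_def hom_def using bij
    by (auto simp: F_def f_simps g_simps dest: bij_betwE)
  moreover have "F (s \<odot>\<^bsub>lie_model \<zeta> D\<^esub> x) = s \<odot>\<^bsub>lie_model \<zeta> D'\<^esub> F x"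
    if "x \<in> carrier (lie_model \<zeta> D)" for s x
    using that additive_vec_linear[OF f(2)] additive_vec_linear[OF g(2)]
    by (cases x) (simp add: F_def)
  moreover have "F (x \<otimes>\<^bsub>lie_model \<zeta> D\<^esub> y) = F x \<otimes>\<^bsub>lie_model \<zeta> D'\<^esub> F y"
    if "x \<in> carrier (lie_model \<zeta> D)" "y \<in> carrier (lie_model \<zeta> D)" for x y
    using that by (cases x, cases y) (simp add: F_def fg f_simps(1))
  ultimately show "lie_isomorphic S (lie_model \<zeta> D) (lie_model \<zeta> D')"
    unfolding lie_isomorphic_def by blast
qed

section \<open>Straightening a subgroup\<close>

lemma add_subgroup_sum:
  assumes "add_subgroup A" "\<And>i. i \<in> I \<Longrightarrow> f i \<in> A"
  shows "sum f I \<in> A"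
  using assms(2) by (induction I rule: infinite_finite_induct) (simp_all add: add_subgroup_closed[OF assms(1)])

lemma sum_fun_apply: "sum f I x = (\<Sum>i\<in>I. f i x)"
  for f :: "'i \<Rightarrow> 'a \<Rightarrow> 'b::comm_monoid_add"
  by (induction I rule: infinite_finite_induct) simp_all

lemma unit_vec_expansion: "v \<in> vecs d \<Longrightarrow> (\<Sum>i<d. vscale (v i) (unit_vec i)) = v"
  for v :: "nat \<Rightarrow> 'r::comm_ring_1"
  by (intro vecs_eqI[of _ d]) (auto simp: sum_fun_apply unit_vec_def vecs_def
      if_distrib[of "\<lambda>t. _ * t"] sum.delta cong: if_cong)

text \<open>If some element of \<open>S\<close> has a nonzero last coordinate, the smallest positive one, attained at \<open>b\<close>, divides
  all others. Then \<open>S\<close> is the direct sum of the multiples of \<open>b\<close> and of the subgroup where the last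
  coordinate vanishes.\<close>
lemma subgroup_of_int_vecs_is_free:
  fixes S :: "(nat \<Rightarrow> int) set"
  assumes "add_subgroup S" "S \<subseteq> vecs r"
  shows "\<exists>n \<kappa>. bij_betw \<kappa> S (vecs n :: (nat \<Rightarrow> int) set) \<and> additive_on S \<kappa>"
  using assms
proof (induction r arbitrary: S)
  case 0
  have "x = 0" if "x \<in> vecs 0" for x :: "nat \<Rightarrow> int"
    using that by (intro ext) (simp add: vecs_def)
  then have "S = vecs 0"
    using add_subgroup_closed(1)[OF 0(1)] 0(2) by auto
  then have "bij_betw id S (vecs 0)" "additive_on S id"
    by (simp_all add: additive_on_def)
  then show ?case
    by blast
next
  case (Suc r)
  note closed = add_subgroup_closed[OF Suc.prems(1)]
  define S' where "S' = {x \<in> S. x r = 0}"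
  have S': "add_subgroup S'"
    using Suc.prems(1) by (simp add: add_subgroup_def S'_def)
  moreover have "S' \<subseteq> vecs r"
    using Suc.prems(2) vecs_SucD by (auto simp: S'_def)
  ultimately obtain n and \<kappa> :: "(nat \<Rightarrow> int) \<Rightarrow> nat \<Rightarrow> int"
    where \<kappa>: "bij_betw \<kappa> S' (vecs n)" "additive_on S' \<kappa>"
    using Suc.IH by blast
  show ?case
  proof (cases "S' = S")
    case True
    with \<kappa> show ?thesis
      by blast
  next
    case False
    then obtain x where x: "x \<in> S" "x r \<noteq> 0"
      by (auto simp: S'_def)
    define P where "P = (\<lambda>m. m > 0 \<and> (\<exists>b\<in>S. b r = int m))"
    have "P (nat \<bar>x r\<bar>)"
    proof -
      have "(if x r > 0 then x else - x) \<in> S"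
        using x closed(3) by simp
      then show ?thesis
        unfolding P_def using x(2) by (intro conjI bexI[of _ "if x r > 0 then x else - x"]) auto
    qed
    then have "P (LEAST m. P m)"
      by (rule LeastI)
    then obtain b where b: "b \<in> S" "b r > 0" "\<And>k. P k \<Longrightarrow> b r \<le> int k"
      unfolding P_def using Least_le[of P] by (force simp: P_def)
    have dvd: "b r dvd y r" if "y \<in> S" for y
    proof (rule ccontr)
      assume "\<not> b r dvd y r"
      then have pos: "y r mod b r > 0"
        using b(2) by (simp add: mod_eq_0_iff_dvd[symmetric] order.not_eq_order_implies_strict)
      have "y - vscale (y r div b r) b \<in> S"
        using that b(1) add_subgroup_vscale[OF Suc.prems(1)] closed(2) by blast
      moreover have "(y - vscale (y r div b r) b) r = y r mod b r"
        by (simp add: minus_div_mult_eq_mod)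
      ultimately have "P (nat (y r mod b r))"
        unfolding P_def using pos by (intro conjI bexI[of _ "y - vscale (y r div b r) b"]) simp_all
      then have "b r \<le> y r mod b r"
        using b(3) pos by force
      then show False
        using pos_mod_bound[OF b(2), of "y r"] by linarith
    qed
    define c where "c y = y r div b r" for y
    have c: "y r = c y * b r" if "y \<in> S" for y
      using dvd[OF that] by (simp add: c_def)
    have c_add: "c (y + z) = c y + c z" if "y \<in> S" "z \<in> S" for y z
      using dvd[OF that(1)] dvd[OF that(2)] by (simp add: c_def)
    define \<rho> where "\<rho> y = y - vscale (c y) b" for y
    have \<rho>: "\<rho> y \<in> S'" if "y \<in> S" for y
      using that b(1) add_subgroup_vscale[OF Suc.prems(1)] closed(2) c[OF that]
      by (simp add: S'_def \<rho>_def)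
    have \<rho>_add: "\<rho> (y + z) = \<rho> y + \<rho> z" if "y \<in> S" "z \<in> S" for y z
      using c_add[OF that] by (simp add: \<rho>_def fun_eq_iff algebra_simps)
    have \<kappa>_range: "\<kappa> (\<rho> y) \<in> vecs n" if "y \<in> S" for y
      using \<rho>[OF that] bij_betwE[OF \<kappa>(1)] by blast
    define K where "K y = (\<lambda>i. if i = n then c y else \<kappa> (\<rho> y) i)" for y
    have "bij_betw K S (vecs (Suc n))"
      unfolding bij_betw_def
    proof
      show "inj_on K S"
      proof (rule inj_onI)
        fix y z assume yz: "y \<in> S" "z \<in> S" "K y = K z"
        have "c y = c z"
          using fun_cong[OF yz(3), of n] by (simp add: K_def)
        moreover have "\<kappa> (\<rho> y) = \<kappa> (\<rho> z)"
        proof (rule vecs_eqI)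
          show "\<kappa> (\<rho> y) i = \<kappa> (\<rho> z) i" if "i < n" for i
            using fun_cong[OF yz(3), of i] that by (simp add: K_def)
        qed (use yz \<kappa>_range in auto)
        then have "\<rho> y = \<rho> z"
          by (rule inj_onD[OF bij_betw_imp_inj_on[OF \<kappa>(1)]]) (use \<rho> yz in auto)
        ultimately show "y = z"
          by (simp add: \<rho>_def)
      qed
      show "K ` S = vecs (Suc n)"
      proof
        show "K ` S \<subseteq> vecs (Suc n)"
          using \<kappa>_range by (auto simp: K_def vecs_def)
        show "vecs (Suc n) \<subseteq> K ` S"
        proof
          fix a :: "nat \<Rightarrow> int" assume a: "a \<in> vecs (Suc n)"
          have "a(n := 0) \<in> vecs (Suc n)" "(a(n := 0)) n = 0"
            using a by (simp_all add: vecs_def)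
          then have "a(n := 0) \<in> vecs n"
            by (rule vecs_SucD)
          then have "a(n := 0) \<in> \<kappa> ` S'"
            by (simp only: bij_betw_imp_surj_on[OF \<kappa>(1)])
          then obtain y' where y': "a(n := 0) = \<kappa> y'" "y' \<in> S'"
            by (rule imageE)
          define y where "y = y' + vscale (a n) b"
          have y: "y \<in> S"
            using y'(2) b(1) add_subgroup_vscale[OF Suc.prems(1)] closed(4) by (simp add: y_def S'_def)
          have "c y = a n"
            using y'(2) b(2) by (simp add: c_def y_def S'_def)
          moreover from this have "\<rho> y = y'"
            by (simp add: \<rho>_def y_def)
          ultimately have "K y = a"
            unfolding K_def by (simp only: y'(1)[symmetric]) (simp add: fun_eq_iff)
          with y show "a \<in> K ` S"
            by blast
        qed
      qed
    qed
    moreover have "additive_on S K"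
      unfolding additive_on_def
    proof (intro ballI ext)
      fix y z i assume yz: "y \<in> S" "z \<in> S"
      have "\<kappa> (\<rho> y + \<rho> z) = \<kappa> (\<rho> y) + \<kappa> (\<rho> z)"
        using yz \<rho> \<kappa>(2) by (simp add: additive_on_def)
      then show "K (y + z) i = (K y + K z) i"
        using c_add[OF yz] \<rho>_add[OF yz] by (simp add: K_def)
    qed
    ultimately show ?thesis
      by blast
  qed
qed

text \<open>In the coordinates \<open>(a, z - q a)\<close> the product of the twisted group has the defect as its cocycle.\<close>
definition defect :: "twist \<Rightarrow> ((nat \<Rightarrow> int) \<Rightarrow> nat \<Rightarrow> int) \<Rightarrow> (nat \<Rightarrow> int) \<Rightarrow> (nat \<Rightarrow> int) \<Rightarrow> nat \<Rightarrow> int"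
  where "defect D q u v = q u + q v - q (u + v) + cocycle D u v"

text \<open>Values of the defect in \<open>Y\<close> make the product additive modulo \<open>Y\<close>, which is what turns subgroups into
  additive subgroups; biadditivity makes the defect itself a twist over \<open>W\<close>.\<close>
definition straightens ::
  "twist \<Rightarrow> (nat \<Rightarrow> int) set \<Rightarrow> (nat \<Rightarrow> int) set \<Rightarrow> ((nat \<Rightarrow> int) \<Rightarrow> nat \<Rightarrow> int) \<Rightarrow> bool"
  where "straightens D W Y q \<longleftrightarrow> (\<forall>u. q u \<in> center D) \<and>
    (\<forall>u\<in>W. \<forall>v\<in>W. defect D q u v \<in> Y) \<and>
    (\<forall>v\<in>W. additive_on W (\<lambda>u. defect D q u v)) \<and>
    (\<forall>u\<in>W. additive_on W (defect D q u))"

text \<open>In a basis of \<open>W\<close>, the quadratic function of the cocycle leaves a defect that is a sum of multiples of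
  brackets of basis vectors, by \<open>quad_defect\<close>.\<close>
lemma straightening_exists:
  assumes W: "add_subgroup W" "W \<subseteq> base D" and Y: "add_subgroup Y"
    and WY: "\<And>u v. u \<in> W \<Longrightarrow> v \<in> W \<Longrightarrow> bracket D u v \<in> Y"
  shows "\<exists>q. straightens D W Y q"
proof -
  obtain n and \<kappa> :: "(nat \<Rightarrow> int) \<Rightarrow> nat \<Rightarrow> int"
    where \<kappa>: "bij_betw \<kappa> W (vecs n)" "additive_on W \<kappa>"
    using subgroup_of_int_vecs_is_free[OF W] by blast
  define \<iota> where "\<iota> = inv_into W \<kappa>"
  have \<iota>_range: "\<iota> a \<in> W" if "a \<in> vecs n" for a
    using that \<kappa>(1) by (simp add: \<iota>_def bij_betw_def inv_into_into)
  have \<iota>_\<kappa>: "\<iota> (\<kappa> u) = u" if "u \<in> W" for u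
    using that \<kappa>(1) by (simp add: \<iota>_def bij_betw_def)
  have \<kappa>_range: "\<kappa> u \<in> vecs n" if "u \<in> W" for u
    using that bij_betwE[OF \<kappa>(1)] by blast
  have \<iota>_add: "\<iota> (a + b) = \<iota> a + \<iota> b" if "a \<in> vecs n" "b \<in> vecs n" for a b
    using additive_on_inv_into[OF \<kappa>(2) W(1) \<kappa>(1)] that by (simp add: additive_on_def \<iota>_def)
  define w where "w i = \<iota> (unit_vec i)" for i
  define s where "s k i j = cocycle D (w i) (w j) k" for k i j
  define q where "q u = (\<lambda>k. if k < center_rank D then quad n (s k) (\<kappa> u) else 0)" for u
  have defect: "defect D q u v = (\<Sum>i<n. \<Sum>j<i. vscale (\<kappa> u i * \<kappa> v j) (bracket D (w i) (w j)))"
    if uv: "u \<in> W" "v \<in> W" for u v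
  proof (rule ext)
    fix k
    show "defect D q u v k = (\<Sum>i<n. \<Sum>j<i. vscale (\<kappa> u i * \<kappa> v j) (bracket D (w i) (w j))) k"
    proof (cases "k < center_rank D")
      case True
      have "cocycle D (\<iota> (\<kappa> u)) (\<iota> (\<kappa> v)) k = (\<Sum>i<n. \<Sum>j<n. s k i j * \<kappa> u i * \<kappa> v j)"
        unfolding s_def w_def
      proof (rule biadditive_expand[of _ "\<lambda>a b. cocycle D (\<iota> a) (\<iota> b) k"])
        show "additive_on (vecs n) (\<lambda>a. cocycle D (\<iota> a) (\<iota> b) k)" for b
          by (simp add: additive_on_def \<iota>_add cocycle_add_left)
        show "additive_on (vecs n) (\<lambda>b. cocycle D (\<iota> a) (\<iota> b) k)" for a
          by (simp add: additive_on_def \<iota>_add cocycle_add_right)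
      qed (use \<kappa>_range uv in auto)
      moreover have "\<kappa> (u + v) = \<kappa> u + \<kappa> v"
        using \<kappa>(2) uv by (simp add: additive_on_def)
      ultimately have "defect D q u v k = (\<Sum>i<n. \<Sum>j<i. (s k i j - s k j i) * \<kappa> u i * \<kappa> v j)"
        unfolding quad_defect[symmetric] defect_def
        using True uv by (simp add: q_def \<iota>_\<kappa>)
      then show ?thesis
        by (simp add: sum_fun_apply s_def bracket_def algebra_simps)
    next
      case False
      have "bracket D (w i) (w j) k = 0" "cocycle D u v k = 0" for i j
        using False by (simp_all add: bracket_def cocycle_def)
      then show ?thesis
        using False by (simp add: defect_def q_def sum_fun_apply)
    qed
  qed
  have \<kappa>_add: "\<kappa> (u + v) i = \<kappa> u i + \<kappa> v i" "u + v \<in> W" if "u \<in> W" "v \<in> W" for u v i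
    using that \<kappa>(2) add_subgroup_closed(4)[OF W(1)] by (simp_all add: additive_on_def)
  have "straightens D W Y q"
    unfolding straightens_def
  proof (intro conjI allI ballI)
    show "q u \<in> center D" for u
      by (simp add: q_def vecs_def)
    show "defect D q u v \<in> Y" if "u \<in> W" "v \<in> W" for u v
      unfolding defect[OF that]
      by (intro add_subgroup_sum[OF Y] add_subgroup_vscale[OF Y] WY)
        (auto simp: w_def intro!: \<iota>_range unit_vec_vecs)
    show "additive_on W (\<lambda>u. defect D q u v)" if "v \<in> W" for v
      unfolding additive_on_def
    proof (intro ballI ext)
      fix x y k assume "x \<in> W" "y \<in> W"
      then show "defect D q (x + y) v k = (defect D q x v + defect D q y v) k"
        using that by (simp add: defect \<kappa>_add sum_fun_apply algebra_simps sum.distrib)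
    qed
    show "additive_on W (defect D q u)" if "u \<in> W" for u
      unfolding additive_on_def
    proof (intro ballI ext)
      fix x y k assume "x \<in> W" "y \<in> W"
      then show "defect D q u (x + y) k = (defect D q u x + defect D q u y) k"
        using that by (simp add: defect \<kappa>_add sum_fun_apply algebra_simps sum.distrib)
    qed
  qed
  then show ?thesis
    by blast
qed

text \<open>The subalgebras of \<open>lie_model id D\<close>; integral multiples are implied by the subgroup condition.\<close>
definition lie_subset :: "twist \<Rightarrow> int vec_pair set \<Rightarrow> bool"
  where "lie_subset D M \<longleftrightarrow> M \<subseteq> base D \<times> center D \<and> add_subgroup M \<and>
    (\<forall>x\<in>M. \<forall>y\<in>M. (0, bracket D (fst x) (fst y)) \<in> M)"

definition fibre :: "int vec_pair set \<Rightarrow> (nat \<Rightarrow> int) set"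
  where "fibre H = {z. (0, z) \<in> H}"

lemma subgroup_twisted_groupD:
  assumes "subgroup H (twisted_group D)"
  shows "H \<subseteq> base D \<times> center D" "(0, 0) \<in> H"
    "(a, z) \<in> H \<Longrightarrow> (b, w) \<in> H \<Longrightarrow> (a + b, z + w + cocycle D a b) \<in> H"
    "(a, z) \<in> H \<Longrightarrow> (- a, - z + cocycle D a a) \<in> H"
proof -
  interpret group "twisted_group D" by (rule group_twisted_group)
  interpret subgroup H "twisted_group D" by fact
  show sub: "H \<subseteq> base D \<times> center D"
    using subset by simp
  show "(0, 0) \<in> H"
    using subgroup.one_closed[OF assms] unfolding twisted_group_simps(3) .
  show "(a + b, z + w + cocycle D a b) \<in> H" if "(a, z) \<in> H" "(b, w) \<in> H"
    using m_closed[OF that] by simp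
  show "(- a, - z + cocycle D a a) \<in> H" if "(a, z) \<in> H"
  proof -
    have "inv\<^bsub>twisted_group D\<^esub> (a, z) = (- a, - z + cocycle D a a)"
      by (rule inv_equality) (use that sub in \<open>auto simp: cocycle_uminus\<close>)
    then show ?thesis
      using m_inv_closed[OF that] by simp
  qed
qed

lemma subgroup_twisted_groupI:
  assumes "H \<subseteq> base D \<times> center D" "(0, 0) \<in> H"
    "\<And>a z b w. (a, z) \<in> H \<Longrightarrow> (b, w) \<in> H \<Longrightarrow> (a + b, z + w + cocycle D a b) \<in> H"
    "\<And>a z. (a, z) \<in> H \<Longrightarrow> (- a, - z + cocycle D a a) \<in> H"
  shows "subgroup H (twisted_group D)"
proof (rule group.subgroupI[OF group_twisted_group])
  fix x assume x: "x \<in> H"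
  obtain a z where az: "x = (a, z)"
    by (cases x)
  have "inv\<^bsub>twisted_group D\<^esub> (a, z) = (- a, - z + cocycle D a a)"
    by (rule group.inv_equality[OF group_twisted_group])
      (use x az assms(1) in \<open>auto simp: cocycle_uminus\<close>)
  then show "inv\<^bsub>twisted_group D\<^esub> x \<in> H"
    using assms(4) x az by simp
next
  fix x y assume "x \<in> H" "y \<in> H"
  then show "x \<otimes>\<^bsub>twisted_group D\<^esub> y \<in> H"
    by (cases x, cases y) (simp add: assms(3))
qed (use assms(1,2) in auto)

definition straighten :: "((nat \<Rightarrow> int) \<Rightarrow> nat \<Rightarrow> int) \<Rightarrow> int vec_pair \<Rightarrow> int vec_pair"
  where "straighten q = (\<lambda>(a, z). (a, z - q a))"

definition unstraighten :: "((nat \<Rightarrow> int) \<Rightarrow> nat \<Rightarrow> int) \<Rightarrow> int vec_pair \<Rightarrow> int vec_pair"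
  where "unstraighten q = (\<lambda>(a, z). (a, z + q a))"

lemma unstraighten_straighten [simp]: "unstraighten q (straighten q x) = x"
  and straighten_unstraighten [simp]: "straighten q (unstraighten q x) = x"
  by (simp_all add: straighten_def unstraighten_def case_prod_beta)

lemma in_straighten_image_iff: "(a, z) \<in> straighten q ` H \<longleftrightarrow> (a, z + q a) \<in> H"
proof
  assume "(a, z + q a) \<in> H"
  then have "straighten q (a, z + q a) \<in> straighten q ` H"
    by (rule imageI)
  then show "(a, z) \<in> straighten q ` H"
    by (simp add: straighten_def)
qed (auto simp: straighten_def)

lemma in_unstraighten_image_iff: "(a, z) \<in> unstraighten q ` H \<longleftrightarrow> (a, z - q a) \<in> H"
proof
  assume "(a, z - q a) \<in> H"
  then have "unstraighten q (a, z - q a) \<in> unstraighten q ` H"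
    by (rule imageI)
  then show "(a, z) \<in> unstraighten q ` H"
    by (simp add: unstraighten_def)
qed (auto simp: unstraighten_def)

lemma fst_straighten_image: "fst ` straighten q ` H = fst ` H"
  and fst_unstraighten_image: "fst ` unstraighten q ` H = fst ` H"
  by (simp_all add: image_image straighten_def unstraighten_def case_prod_beta)

lemma fst_imageI: "(a, z) \<in> H \<Longrightarrow> a \<in> fst ` H"
  by (rule image_eqI[of _ _ "(a, z)"]) simp_all

text \<open>The image \<open>fst ` H\<close> and the fibre carry all information on \<open>H\<close> except for the choice of one element over
  each point of the image. The fibre contains the brackets because these are commutators. The analogous
  statement \<open>lie_subset_base_fibre\<close> for subalgebras has the same conclusions.\<close>
lemma subgroup_base_fibre:
  assumes "subgroup H (twisted_group D)"
  shows "add_subgroup (fst ` H)" "fst ` H \<subseteq> base D" "add_subgroup (fibre H)" "fibre H \<subseteq> center D"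
    "\<And>u v. u \<in> fst ` H \<Longrightarrow> v \<in> fst ` H \<Longrightarrow> bracket D u v \<in> fibre H"
    "\<And>a z w. (a, z) \<in> H \<Longrightarrow> (a, w) \<in> H \<longleftrightarrow> w - z \<in> fibre H"
proof -
  note H = subgroup_twisted_groupD[OF assms]
  have diff: "(a - b, z - w + cocycle D b b - cocycle D a b) \<in> H" if "(a, z) \<in> H" "(b, w) \<in> H" for a b z w
    using H(3)[OF that(1) H(4)[OF that(2)]] by (simp add: cocycle_uminus algebra_simps)
  show "add_subgroup (fst ` H)"
    unfolding add_subgroup_def
  proof (intro conjI ballI)
    show "0 \<in> fst ` H"
      using H(2) by (rule fst_imageI)
    fix u v assume "u \<in> fst ` H" "v \<in> fst ` H"
    then obtain z w where "(u, z) \<in> H" "(v, w) \<in> H"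
      by auto
    from diff[OF this] show "u - v \<in> fst ` H"
      by (rule fst_imageI)
  qed
  show "fst ` H \<subseteq> base D" "fibre H \<subseteq> center D"
    using H(1) by (auto simp: fibre_def)
  show "add_subgroup (fibre H)"
    unfolding add_subgroup_def fibre_def using H(2) diff[of 0 _ 0] by auto
  show "bracket D u v \<in> fibre H" if uv: "u \<in> fst ` H" "v \<in> fst ` H" for u v
  proof -
    obtain z w where zw: "(u, z) \<in> H" "(v, w) \<in> H"
      using uv by auto
    have "(0, bracket D u v) \<in> H"
      using diff[OF H(3)[OF zw] H(3)[OF zw(2,1)]]
      by (simp add: bracket_def cocycle_add_left cocycle_add_right add.commute)
    then show ?thesis
      by (simp add: fibre_def)
  qed
  show "(a, w) \<in> H \<longleftrightarrow> w - z \<in> fibre H" if az: "(a, z) \<in> H" for a z w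
  proof
    assume "(a, w) \<in> H"
    from diff[OF this az] show "w - z \<in> fibre H"
      by (simp add: fibre_def)
  next
    assume "w - z \<in> fibre H"
    then show "(a, w) \<in> H"
      using H(3)[OF az, of 0 "w - z"] by (simp add: fibre_def)
  qed
qed

lemma lie_subset_base_fibre:
  assumes "lie_subset D M"
  shows "add_subgroup (fst ` M)" "fst ` M \<subseteq> base D" "add_subgroup (fibre M)" "fibre M \<subseteq> center D"
    "\<And>u v. u \<in> fst ` M \<Longrightarrow> v \<in> fst ` M \<Longrightarrow> bracket D u v \<in> fibre M"
    "\<And>a z w. (a, z) \<in> M \<Longrightarrow> (a, w) \<in> M \<longleftrightarrow> w - z \<in> fibre M"
proof -
  have M: "M \<subseteq> base D \<times> center D" "add_subgroup M"
    "\<And>x y. x \<in> M \<Longrightarrow> y \<in> M \<Longrightarrow> (0, bracket D (fst x) (fst y)) \<in> M"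
    using assms by (auto simp: lie_subset_def)
  note closed = add_subgroup_closed[OF M(2)]
  show "add_subgroup (fst ` M)"
    unfolding add_subgroup_def
  proof (intro conjI ballI)
    show "0 \<in> fst ` M"
      using closed(1) unfolding zero_prod_def by (rule fst_imageI)
    fix u v assume "u \<in> fst ` M" "v \<in> fst ` M"
    then obtain z w where "(u, z) \<in> M" "(v, w) \<in> M"
      by auto
    from closed(2)[OF this] show "u - v \<in> fst ` M"
      unfolding diff_Pair by (rule fst_imageI)
  qed
  show "fst ` M \<subseteq> base D" "fibre M \<subseteq> center D"
    using M(1) by (auto simp: fibre_def)
  show "add_subgroup (fibre M)"
    unfolding add_subgroup_def fibre_def using closed(1) closed(2)[of "(0, _)" "(0, _)"]
    by (auto simp: zero_prod_def)
  show "bracket D u v \<in> fibre M" if "u \<in> fst ` M" "v \<in> fst ` M" for u v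
    using M(3) that by (auto simp: fibre_def)
  show "(a, w) \<in> M \<longleftrightarrow> w - z \<in> fibre M" if az: "(a, z) \<in> M" for a z w
    using closed(2)[OF _ az, of "(a, w)"] closed(4)[OF az, of "(0, w - z)"] by (auto simp: fibre_def)
qed

lemma straightens_zero:
  assumes "straightens D W Y q" "add_subgroup W"
  shows "q 0 = 0"
proof -
  have "defect D q 0 0 = 0"
    using assms additive_on_simps(1)[of W "defect D q 0"] add_subgroup_closed(1)[OF assms(2)]
    by (simp add: straightens_def)
  then show ?thesis
    by (simp add: defect_def)
qed

text \<open>The straightened difference of two elements of \<open>H\<close> differs from a straightened element of \<open>H\<close> by a
  value of the defect, which lies in the fibre.\<close>
lemma lie_subset_straighten:
  assumes H: "subgroup H (twisted_group D)" and q: "straightens D (fst ` H) (fibre H) q"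
  shows "lie_subset D (straighten q ` H)" "fibre (straighten q ` H) = fibre H"
proof -
  note H' = subgroup_twisted_groupD[OF H]
  note WY = subgroup_base_fibre[OF H]
  have q0: "q 0 = 0"
    by (rule straightens_zero[OF q WY(1)])
  show fib: "fibre (straighten q ` H) = fibre H"
    by (simp add: fibre_def in_straighten_image_iff q0)
  have add: "(u - v, z - w) \<in> straighten q ` H"
    if "(u, z) \<in> straighten q ` H" "(v, w) \<in> straighten q ` H" for u v z w
  proof -
    have uz: "(u, z + q u) \<in> H" and vw: "(v, w + q v) \<in> H"
      using that by (simp_all add: in_straighten_image_iff)
    have u: "u \<in> fst ` H" and v: "v \<in> fst ` H"
      using uz vw by (auto intro: fst_imageI)
    have uv: "u - v \<in> fst ` H"
      by (rule add_subgroup_closed(2)[OF WY(1) u v])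
    have mem: "(u - v, z + q u + (- (w + q v) + cocycle D v v) + cocycle D u (- v)) \<in> H"
      using H'(3)[OF uz H'(4)[OF vw]] by simp
    have eq: "(z - w + q (u - v)) - (z + q u + (- (w + q v) + cocycle D v v) + cocycle D u (- v))
        = defect D q (u - v) v"
      unfolding defect_def using cocycle_add_left[of D "u - v" v v]
      by (simp add: cocycle_uminus)
    have "defect D q (u - v) v \<in> fibre H"
      using q uv v unfolding straightens_def by blast
    then have "(u - v, z - w + q (u - v)) \<in> H"
      by (intro iffD2[OF WY(6)[OF mem]]) (simp only: eq)
    then show ?thesis
      by (simp add: in_straighten_image_iff)
  qed
  show "lie_subset D (straighten q ` H)"
    unfolding lie_subset_def
  proof (intro conjI ballI)
    have "q u \<in> center D" for u
      using q by (simp add: straightens_def)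
    then show "straighten q ` H \<subseteq> base D \<times> center D"
      using H'(1) by (auto simp: straighten_def)
    show "add_subgroup (straighten q ` H)"
      unfolding add_subgroup_def
    proof (intro conjI ballI)
      show "0 \<in> straighten q ` H"
        using H'(2) by (simp add: zero_prod_def in_straighten_image_iff q0)
      show "x - y \<in> straighten q ` H" if "x \<in> straighten q ` H" "y \<in> straighten q ` H" for x y
        using that add by (cases x, cases y) simp
    qed
    show "(0, bracket D (fst x) (fst y)) \<in> straighten q ` H"
      if "x \<in> straighten q ` H" "y \<in> straighten q ` H" for x y
    proof -
      have "fst x \<in> fst ` H" "fst y \<in> fst ` H"
        using that fst_straighten_image[of q H] by blast+
      then have "bracket D (fst x) (fst y) \<in> fibre H"
        by (rule WY(5))
      then show ?thesis
        by (simp add: in_straighten_image_iff q0 fibre_def)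
    qed
  qed
qed

lemma subgroup_unstraighten:
  assumes M: "lie_subset D M" and q: "straightens D (fst ` M) (fibre M) q"
  shows "subgroup (unstraighten q ` M) (twisted_group D)" "fibre (unstraighten q ` M) = fibre M"
proof -
  have M': "M \<subseteq> base D \<times> center D" "add_subgroup M"
    using M by (auto simp: lie_subset_def)
  note closed = add_subgroup_closed[OF M'(2)]
  note WY = lie_subset_base_fibre[OF M]
  have q0: "q 0 = 0"
    by (rule straightens_zero[OF q WY(1)])
  show "fibre (unstraighten q ` M) = fibre M"
    by (simp add: fibre_def in_unstraighten_image_iff q0)
  have defect: "defect D q u v \<in> fibre M" if "u \<in> fst ` M" "v \<in> fst ` M" for u v
    using q that unfolding straightens_def by blast
  show "subgroup (unstraighten q ` M) (twisted_group D)"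
  proof (rule subgroup_twisted_groupI)
    have "q u \<in> center D" for u
      using q by (simp add: straightens_def)
    then show "unstraighten q ` M \<subseteq> base D \<times> center D"
      using M'(1) by (auto simp: unstraighten_def)
    show "(0, 0) \<in> unstraighten q ` M"
      using closed(1) by (simp add: zero_prod_def in_unstraighten_image_iff q0)
    fix u z assume uz: "(u, z) \<in> unstraighten q ` M"
    then have uz': "(u, z - q u) \<in> M"
      by (simp add: in_unstraighten_image_iff)
    then have u: "u \<in> fst ` M"
      by (rule fst_imageI)
    show "(u + v, z + w + cocycle D u v) \<in> unstraighten q ` M"
      if "(v, w) \<in> unstraighten q ` M" for v w
    proof -
      have vw': "(v, w - q v) \<in> M"
        using that by (simp add: in_unstraighten_image_iff)
      then have v: "v \<in> fst ` M"
        by (rule fst_imageI)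
      have mem: "(u + v, (z - q u) + (w - q v)) \<in> M"
        using closed(4)[OF uz' vw'] by simp
      have eq: "(z + w + cocycle D u v - q (u + v)) - ((z - q u) + (w - q v)) = defect D q u v"
        by (simp add: defect_def algebra_simps)
      have "(u + v, z + w + cocycle D u v - q (u + v)) \<in> M"
        using defect[OF u v] by (intro iffD2[OF WY(6)[OF mem]]) (simp only: eq)
      then show ?thesis
        by (simp add: in_unstraighten_image_iff)
    qed
    have mem: "(- u, - (z - q u)) \<in> M"
      using closed(3)[OF uz'] by simp
    have eq: "(- z + cocycle D u u - q (- u)) - (- (z - q u)) = - defect D q u (- u)"
      by (simp add: defect_def q0 cocycle_uminus algebra_simps)
    have "- defect D q u (- u) \<in> fibre M"
      by (intro add_subgroup_closed(3)[OF WY(3)] defect u add_subgroup_closed(3)[OF WY(1)])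
    then have "(- u, - z + cocycle D u u - q (- u)) \<in> M"
      by (intro iffD2[OF WY(6)[OF mem]]) (simp only: eq)
    then show "(- u, - z + cocycle D u u) \<in> unstraighten q ` M"
      by (simp add: in_unstraighten_image_iff)
  qed
qed

section \<open>The index of a subgroup\<close>

definition coset_rep :: "'a::ab_group_add set \<Rightarrow> 'a \<Rightarrow> 'a"
  where "coset_rep A x = (SOME y. x - y \<in> A)"

lemma diff_coset_rep: "add_subgroup A \<Longrightarrow> x - coset_rep A x \<in> A"
  unfolding coset_rep_def by (rule someI[of _ x]) (simp add: add_subgroup_closed)

lemma coset_rep_eq:
  assumes A: "add_subgroup A" and "x - y \<in> A"
  shows "coset_rep A x = coset_rep A y"
proof -
  have "x - z \<in> A \<longleftrightarrow> y - z \<in> A" for z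
    using add_subgroup_closed(2)[OF A, of "x - z" "x - y"] add_subgroup_closed(4)[OF A, of "x - y" "y - z"]
      assms(2) by auto
  then show ?thesis
    by (simp add: coset_rep_def)
qed

lemma coset_rep_in: "add_subgroup A \<Longrightarrow> A \<subseteq> V \<Longrightarrow> add_subgroup V \<Longrightarrow> x \<in> V \<Longrightarrow> coset_rep A x \<in> V"
  using diff_coset_rep[of A x] add_subgroup_closed(2)[of V x "x - coset_rep A x"] by auto

lemma coset_reps_inj:
  assumes "add_subgroup A" "s \<in> coset_rep A ` V" "t \<in> coset_rep A ` V" "s - t \<in> A"
  shows "s = t"
proof -
  obtain x y where xy: "s = coset_rep A x" "t = coset_rep A y"
    using assms(2,3) by auto
  have idem: "coset_rep A (coset_rep A z) = coset_rep A z" for z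
    by (rule coset_rep_eq[OF assms(1) diff_coset_rep[OF assms(1)], symmetric])
  have "s = coset_rep A s"
    unfolding xy(1) by (rule idem[symmetric])
  also have "\<dots> = coset_rep A t"
    by (rule coset_rep_eq[OF assms(1,4)])
  also have "\<dots> = t"
    unfolding xy(2) by (rule idem)
  finally show ?thesis .
qed

text \<open>A transversal that sees only the image and the fibre, so that it serves subgroups and subalgebras
  alike.\<close>
definition pair_reps :: "twist \<Rightarrow> (nat \<Rightarrow> int) set \<Rightarrow> (nat \<Rightarrow> int) set \<Rightarrow> int vec_pair set"
  where "pair_reps D W Y = coset_rep W ` base D \<times> coset_rep Y ` center D"

text \<open>A right coset of \<open>H\<close> is determined by its image modulo \<open>fst ` H\<close> and, once the base component is a
  chosen representative, by the central component modulo the fibre. Equality of cardinalities covers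
  infinite index as well, where both sides are 0.\<close>
lemma index_eq_card_pair_reps:
  assumes H: "subgroup H (twisted_group D)"
  shows "card (rcosets\<^bsub>twisted_group D\<^esub> H) = card (pair_reps D (fst ` H) (fibre H))"
proof -
  let ?G = "twisted_group D :: int vec_pair monoid"
  interpret group ?G by (rule group_twisted_group)
  note H' = subgroup_twisted_groupD[OF H]
  note WY = subgroup_base_fibre[OF H]
  let ?T = "coset_rep (fst ` H) ` base D" and ?U = "coset_rep (fibre H) ` center D"
  have T: "?T \<subseteq> base D" and U: "?U \<subseteq> center D"
    using coset_rep_in[OF WY(1,2)] coset_rep_in[OF WY(3,4)] by auto
  have mem_coset: "x \<in> H #>\<^bsub>?G\<^esub> y \<longleftrightarrow> (\<exists>h\<in>H. x = h \<otimes>\<^bsub>?G\<^esub> y)" for x y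
    by (auto simp: r_coset_def)
  have "bij_betw (\<lambda>y. H #>\<^bsub>?G\<^esub> y) (?T \<times> ?U) (rcosets\<^bsub>?G\<^esub> H)"
    unfolding bij_betw_def
  proof
    show "inj_on (\<lambda>y. H #>\<^bsub>?G\<^esub> y) (?T \<times> ?U)"
    proof (rule inj_onI)
      fix x y assume x: "x \<in> ?T \<times> ?U" and y: "y \<in> ?T \<times> ?U" and eq: "H #>\<^bsub>?G\<^esub> x = H #>\<^bsub>?G\<^esub> y"
      obtain t u where tu: "x = (t, u)" "t \<in> ?T" "u \<in> ?U"
        using x by auto
      obtain t' u' where tu': "y = (t', u')" "t' \<in> ?T" "u' \<in> ?U"
        using y by auto
      have "x \<in> carrier ?G"
        using tu T U by auto
      then have "x \<in> H #>\<^bsub>?G\<^esub> y"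
        unfolding eq[symmetric] by (rule rcos_self[OF _ H])
      then obtain a z where az: "(a, z) \<in> H" "(t, u) = (a, z) \<otimes>\<^bsub>?G\<^esub> (t', u')"
        by (auto simp: mem_coset tu tu')
      then have "t - t' = a"
        by simp
      with az(1) have "t - t' \<in> fst ` H"
        by (simp add: fst_imageI)
      with tu(2) tu'(2) have t: "t = t'"
        by (rule coset_reps_inj[OF WY(1)])
      then have "a = 0" "u - u' = z"
        using az(2) by simp_all
      then have "u - u' \<in> fibre H"
        using az(1) by (simp add: fibre_def)
      with tu(3) tu'(3) have "u = u'"
        by (rule coset_reps_inj[OF WY(3)])
      with t show "x = y"
        by (simp add: tu tu')
    qed
    show "(\<lambda>y. H #>\<^bsub>?G\<^esub> y) ` (?T \<times> ?U) = rcosets\<^bsub>?G\<^esub> H"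
    proof
      show "(\<lambda>y. H #>\<^bsub>?G\<^esub> y) ` (?T \<times> ?U) \<subseteq> rcosets\<^bsub>?G\<^esub> H"
      proof
        fix C assume "C \<in> (\<lambda>y. H #>\<^bsub>?G\<^esub> y) ` (?T \<times> ?U)"
        then obtain y where y: "y \<in> ?T \<times> ?U" "C = H #>\<^bsub>?G\<^esub> y"
          by blast
        then have "y \<in> carrier ?G"
          using T U by auto
        with y(2) show "C \<in> rcosets\<^bsub>?G\<^esub> H"
          unfolding RCOSETS_def by blast
      qed
      show "rcosets\<^bsub>?G\<^esub> H \<subseteq> (\<lambda>y. H #>\<^bsub>?G\<^esub> y) ` (?T \<times> ?U)"
      proof
        fix C assume "C \<in> rcosets\<^bsub>?G\<^esub> H"
        then obtain b w where C: "C = H #>\<^bsub>?G\<^esub> (b, w)" and bw: "b \<in> base D" "w \<in> center D"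
          by (auto simp: RCOSETS_def)
        define t where "t = coset_rep (fst ` H) b"
        have t: "t \<in> ?T" "b - t \<in> fst ` H"
          using bw diff_coset_rep[OF WY(1)] by (simp_all add: t_def)
        then obtain h where h: "(b - t, h) \<in> H"
          by auto
        define v where "v = w - h - cocycle D (b - t) t"
        define u where "u = coset_rep (fibre H) v"
        have "h \<in> center D"
          using h H'(1) by auto
        then have "v \<in> center D"
          using bw by (simp add: v_def)
        then have u: "u \<in> ?U" "v - u \<in> fibre H"
          using diff_coset_rep[OF WY(3)] by (simp_all add: u_def)
        have "(b - t, h + (v - u)) \<in> H"
          using WY(6)[OF h, of "h + (v - u)"] u(2) by simp
        moreover have "(b, w) = (b - t, h + (v - u)) \<otimes>\<^bsub>?G\<^esub> (t, u)"
          by (simp add: v_def)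
        ultimately have "(b, w) \<in> H #>\<^bsub>?G\<^esub> (t, u)"
          unfolding mem_coset by blast
        moreover have "(t, u) \<in> carrier ?G"
          using t u T U by auto
        ultimately have "H #>\<^bsub>?G\<^esub> (t, u) = C"
          unfolding C by (rule repr_independence[OF _ _ H])
        with t(1) u(1) show "C \<in> (\<lambda>y. H #>\<^bsub>?G\<^esub> y) ` (?T \<times> ?U)"
          by blast
      qed
    qed
  qed
  then show ?thesis
    unfolding pair_reps_def by (metis bij_betw_same_card)
qed

text \<open>Among the multiples of \<open>x\<close> two agree modulo \<open>W\<close> by the pigeonhole principle. As the cardinality of an
  infinite set is 0, the positive cardinality expresses finiteness.\<close>
lemma multiples_in_base_of_finite_index:
  assumes "add_subgroup W" "W \<subseteq> base D" "card (pair_reps D W Y) > 0" "x \<in> base D"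
  shows "\<exists>k::nat. k > 0 \<and> vscale (int k) x \<in> W"
proof -
  have "finite (coset_rep W ` base D \<times> coset_rep Y ` center D)"
    using assms(3) card_gt_0_iff unfolding pair_reps_def by blast
  moreover have "coset_rep Y ` center D \<noteq> {}"
    using vecs_closed(1) by blast
  ultimately have fin: "finite (coset_rep W ` base D)"
    by (rule finite_cartesian_productD1)
  have "\<not> inj_on (\<lambda>k. coset_rep W (vscale (int k) x)) UNIV"
  proof
    assume "inj_on (\<lambda>k. coset_rep W (vscale (int k) x)) UNIV"
    moreover have "range (\<lambda>k. coset_rep W (vscale (int k) x)) \<subseteq> coset_rep W ` base D"
      using assms(4) by auto
    ultimately show False
      using fin infinite_UNIV_nat by (metis finite_imageD finite_subset)
  qed
  then obtain j l where "j \<noteq> l" "coset_rep W (vscale (int j) x) = coset_rep W (vscale (int l) x)"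
    by (auto simp: inj_on_def)
  then obtain j l where jl: "j < l" "coset_rep W (vscale (int j) x) = coset_rep W (vscale (int l) x)"
    by (metis linorder_neqE_nat)
  have "vscale (int l) x - vscale (int j) x
      = (vscale (int l) x - coset_rep W (vscale (int l) x)) - (vscale (int j) x - coset_rep W (vscale (int j) x))"
    using jl(2) by simp
  also have "\<dots> \<in> W"
    by (intro add_subgroup_closed(2)[OF assms(1)] diff_coset_rep[OF assms(1)])
  also have "vscale (int l) x - vscale (int j) x = vscale (int (l - j)) x"
    using jl(1) by (simp add: fun_eq_iff of_nat_diff algebra_simps)
  finally show ?thesis
    using jl(1) zero_less_diff by blast
qed

section \<open>A common twist for a subgroup and its subalgebra\<close>

lemma twist_of_bilinear_map:
  fixes g :: "(nat \<Rightarrow> int) \<Rightarrow> (nat \<Rightarrow> int) \<Rightarrow> nat \<Rightarrow> int"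
  assumes left: "\<And>y. y \<in> vecs n \<Longrightarrow> additive_on (vecs n) (\<lambda>x. g x y)"
    and right: "\<And>x. x \<in> vecs n \<Longrightarrow> additive_on (vecs n) (g x)"
    and range: "\<And>x y. x \<in> vecs n \<Longrightarrow> y \<in> vecs n \<Longrightarrow> g x y \<in> vecs m"
    and xy: "x \<in> vecs n" "y \<in> vecs n"
  shows "g x y = cocycle (Twist n m (\<lambda>i j k. g (unit_vec i) (unit_vec j) k)) x y"
proof (rule vecs_eqI[OF range[OF xy]])
  fix k assume "k < m"
  have "g x y k = (\<Sum>i<n. \<Sum>j<n. g (unit_vec i) (unit_vec j) k * x i * y j)"
    by (rule biadditive_expand[of _ "\<lambda>x y. g x y k"])
      (use left right xy in \<open>simp_all add: additive_on_def\<close>)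
  with \<open>k < m\<close> show "g x y k = cocycle (Twist n m (\<lambda>i j k. g (unit_vec i) (unit_vec j) k)) x y k"
    by (simp add: cocycle_def)
qed (simp add: cocycle_def vecs_def)

text \<open>The projection of \<open>M\<close> to the base splits because its image is free: choose preimages of a basis.\<close>
lemma additive_section:
  assumes M: "add_subgroup (M :: int vec_pair set)" "M \<subseteq> base D \<times> center D"
    and \<kappa>: "bij_betw \<kappa> (fst ` M) (vecs n :: (nat \<Rightarrow> int) set)" "additive_on (fst ` M) \<kappa>"
  shows "\<exists>\<tau> :: _ \<Rightarrow> nat \<Rightarrow> int. additive_on (fst ` M) \<tau> \<and> (\<forall>u\<in>fst ` M. (u, \<tau> u) \<in> M)"
proof -
  note closed = add_subgroup_closed[OF M(1)]
  have W: "add_subgroup (fst ` M)"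
    unfolding add_subgroup_def
  proof (intro conjI ballI)
    show "0 \<in> fst ` M"
      using closed(1) unfolding zero_prod_def by (rule fst_imageI)
    fix u v assume "u \<in> fst ` M" "v \<in> fst ` M"
    then obtain z w where "(u, z) \<in> M" "(v, w) \<in> M"
      by auto
    from closed(2)[OF this] show "u - v \<in> fst ` M"
      unfolding diff_Pair by (rule fst_imageI)
  qed
  define w where "w i = inv_into (fst ` M) \<kappa> (unit_vec i)" for i
  have w: "w i \<in> fst ` M" "\<kappa> (w i) = unit_vec i" if "i < n" for i
  proof -
    have "unit_vec i \<in> \<kappa> ` fst ` M"
      unfolding bij_betw_imp_surj_on[OF \<kappa>(1)] using that by simp
    then show "w i \<in> fst ` M" "\<kappa> (w i) = unit_vec i"
      unfolding w_def by (rule inv_into_into, rule f_inv_into_f)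
  qed
  have "\<exists>t. (w i, t) \<in> M" if "i < n" for i
    using w(1)[OF that] by auto
  then obtain t where t: "\<And>i. i < n \<Longrightarrow> (w i, t i) \<in> M"
    by metis
  define \<tau> where "\<tau> u = (\<Sum>i<n. vscale (\<kappa> u i) (t i))" for u
  note scale = add_subgroup_pair_vscale[OF M(1)]
  have mem: "(u, \<tau> u) \<in> M" if u: "u \<in> fst ` M" for u
  proof -
    have sum: "(\<Sum>i<l. (vscale (\<kappa> u i) (w i), vscale (\<kappa> u i) (t i))) \<in> M" if "l \<le> n" for l
      by (rule add_subgroup_sum[OF M(1)]) (use that scale t in auto)
    have split: "(\<Sum>i<l. (vscale (\<kappa> u i) (w i), vscale (\<kappa> u i) (t i)))
        = (\<Sum>i<l. vscale (\<kappa> u i) (w i), \<Sum>i<l. vscale (\<kappa> u i) (t i))" for l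
      by (rule sum_prod)
    define u' where "u' = (\<Sum>i<n. vscale (\<kappa> u i) (w i))"
    have "(u', \<tau> u) \<in> M"
      using sum[OF order_refl] unfolding split u'_def \<tau>_def .
    moreover have "u' = u"
    proof (rule inj_onD[OF bij_betw_imp_inj_on[OF \<kappa>(1)]])
      show u': "u' \<in> fst ` M"
        using \<open>(u', \<tau> u) \<in> M\<close> by (rule fst_imageI)
      have partial: "(\<Sum>i<l. vscale (\<kappa> u i) (w i)) \<in> fst ` M \<and>
          \<kappa> (\<Sum>i<l. vscale (\<kappa> u i) (w i)) = (\<Sum>i<l. vscale (\<kappa> u i) (unit_vec i))" if "l \<le> n" for l
        using that
      proof (induction l)
        case 0
        then show ?case
          using additive_on_simps(1)[OF \<kappa>(2) W] add_subgroup_closed(1)[OF W]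
          by (simp only: lessThan_0 sum.empty simp_thms)
      next
        case (Suc l)
        have wl: "vscale (\<kappa> u l) (w l) \<in> fst ` M"
          using Suc.prems w(1) by (intro add_subgroup_vscale[OF W]) simp
        have "\<kappa> (vscale (\<kappa> u l) (w l)) = vscale (\<kappa> u l) (\<kappa> (w l))"
          by (rule additive_on_vscale[OF \<kappa>(2) W]) (use Suc.prems w(1) in simp)
        moreover have "\<kappa> (w l) = unit_vec l"
          using Suc.prems w(2) by simp
        moreover have IH: "(\<Sum>i<l. vscale (\<kappa> u i) (w i)) \<in> fst ` M"
          "\<kappa> (\<Sum>i<l. vscale (\<kappa> u i) (w i)) = (\<Sum>i<l. vscale (\<kappa> u i) (unit_vec i))"
          using Suc.IH Suc.prems by (blast intro: Suc_leD)+
        ultimately show ?case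
          unfolding sum.lessThan_Suc
          using add_subgroup_closed(4)[OF W IH(1) wl] additive_on_simps(4)[OF \<kappa>(2) W IH(1) wl]
          by (simp only: simp_thms)
      qed
      have "\<kappa> u \<in> vecs n"
        using bij_betwE[OF \<kappa>(1)] u by blast
      then have "\<kappa> u = (\<Sum>i<n. vscale (\<kappa> u i) (unit_vec i))"
        by (rule unit_vec_expansion[symmetric])
      then show "\<kappa> u' = \<kappa> u"
        using partial[OF order_refl] by (simp add: u'_def)
    qed (rule u)
    ultimately show ?thesis
      by simp
  qed
  have "additive_on (fst ` M) \<tau>"
    unfolding additive_on_def
  proof (intro ballI ext)
    fix u v k assume "u \<in> fst ` M" "v \<in> fst ` M"
    then have "\<kappa> (u + v) = \<kappa> u + \<kappa> v"
      by (rule additive_on_simps(4)[OF \<kappa>(2) W])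
    then show "\<tau> (u + v) k = (\<tau> u + \<tau> v) k"
      by (simp add: \<tau>_def sum_fun_apply sum.distrib algebra_simps)
  qed
  with mem show ?thesis
    by blast
qed

text \<open>An isomorphism onto \<open>lie_model id D'\<close>, stated for a subset \<open>M\<close> of another model.\<close>
definition lie_coordinates :: "twist \<Rightarrow> int vec_pair set \<Rightarrow> twist \<Rightarrow> (int vec_pair \<Rightarrow> int vec_pair) \<Rightarrow> bool"
  where "lie_coordinates D M D' \<phi> \<longleftrightarrow> bij_betw \<phi> M (base D' \<times> center D') \<and> additive_on M \<phi> \<and>
    (\<forall>x\<in>M. \<forall>y\<in>M. \<phi> (0, bracket D (fst x) (fst y)) = (0, bracket D' (fst (\<phi> x)) (fst (\<phi> y))))"

text \<open>The twist \<open>D'\<close> is the defect in coordinates of the base and the fibre. The splitting \<open>\<tau>\<close> of the subalgebra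
  gives coordinates \<open>\<phi>\<close> on it, and because the product of \<open>H\<close> has the defect as cocycle after straightening,
  the same coordinates identify \<open>H\<close> with the twisted group of \<open>D'\<close>. Its bracket is the restriction of
  the bracket of \<open>D\<close>, which remains nondegenerate since every vector of the base has a multiple in the
  image of \<open>H\<close>.\<close>
lemma common_twist:
  assumes nd: "nondegenerate D" and H: "subgroup H (twisted_group D)"
    and q: "straightens D (fst ` H) (fibre H) q"
    and fin: "card (rcosets\<^bsub>twisted_group D\<^esub> H) > 0"
  shows "\<exists>D' \<phi>. nondegenerate D' \<and> lie_coordinates D (straighten q ` H) D' \<phi> \<and>
    (twisted_group D)\<lparr>carrier := H\<rparr> \<cong> (twisted_group D' :: int vec_pair monoid)"
proof -
  note WY = subgroup_base_fibre[OF H]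
  define W where "W = fst ` H"
  define Y where "Y = fibre H"
  define M where "M = straighten q ` H"
  have M: "lie_subset D M" "fibre M = Y" "fst ` M = W"
    using lie_subset_straighten[OF H q] by (simp_all add: M_def Y_def W_def fst_straighten_image)
  have M': "add_subgroup M" "M \<subseteq> base D \<times> center D"
    using M(1) by (auto simp: lie_subset_def)
  have W: "add_subgroup W" "W \<subseteq> base D" and Y: "add_subgroup Y" "Y \<subseteq> center D"
    using WY by (simp_all add: W_def Y_def)
  obtain n and \<kappa> :: "(nat \<Rightarrow> int) \<Rightarrow> nat \<Rightarrow> int"
    where \<kappa>: "bij_betw \<kappa> W (vecs n)" "additive_on W \<kappa>"
    using subgroup_of_int_vecs_is_free[OF W] by blast
  obtain m and \<mu> :: "(nat \<Rightarrow> int) \<Rightarrow> nat \<Rightarrow> int"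
    where \<mu>: "bij_betw \<mu> Y (vecs m)" "additive_on Y \<mu>"
    using subgroup_of_int_vecs_is_free[OF Y] by blast
  obtain \<tau> :: "(nat \<Rightarrow> int) \<Rightarrow> nat \<Rightarrow> int" where \<tau>: "additive_on W \<tau>" "\<And>u. u \<in> W \<Longrightarrow> (u, \<tau> u) \<in> M"
    using additive_section[OF M', unfolded M(3), OF \<kappa>] by blast
  note \<kappa>_simps = additive_on_simps[OF \<kappa>(2) W(1)]
  note \<mu>_simps = additive_on_simps[OF \<mu>(2) Y(1)]
  note \<tau>_simps = additive_on_simps[OF \<tau>(1) W(1)]
  define \<iota> where "\<iota> = inv_into W \<kappa>"
  have \<iota>_range: "\<iota> a \<in> W" if "a \<in> vecs n" for a
    using that \<kappa>(1) by (simp add: \<iota>_def bij_betw_def inv_into_into)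
  have \<iota>_\<kappa>: "\<iota> (\<kappa> u) = u" if "u \<in> W" for u
    using that \<kappa>(1) by (simp add: \<iota>_def bij_betw_def)
  have \<kappa>_\<iota>: "\<kappa> (\<iota> a) = a" if "a \<in> vecs n" for a
    using that \<kappa>(1) by (simp add: \<iota>_def bij_betw_def f_inv_into_f)
  have \<kappa>_range: "\<kappa> u \<in> vecs n" if "u \<in> W" for u
    using that bij_betwE[OF \<kappa>(1)] by blast
  have \<mu>_range: "\<mu> u \<in> vecs m" if "u \<in> Y" for u
    using that bij_betwE[OF \<mu>(1)] by blast
  have \<iota>_add: "\<iota> (a + b) = \<iota> a + \<iota> b" if "a \<in> vecs n" "b \<in> vecs n" for a b
    using additive_on_inv_into[OF \<kappa>(2) W(1) \<kappa>(1)] that by (simp add: additive_on_def \<iota>_def)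
  have defect: "defect D q u v \<in> Y" if "u \<in> W" "v \<in> W" for u v
    using q that unfolding straightens_def W_def Y_def by blast
  have defect_left: "defect D q (u + u') v = defect D q u v + defect D q u' v"
    if "u \<in> W" "u' \<in> W" "v \<in> W" for u u' v
    using q that unfolding straightens_def W_def additive_on_def by blast
  have defect_right: "defect D q u (v + v') = defect D q u v + defect D q u v'"
    if "u \<in> W" "v' \<in> W" "v \<in> W" for u v v'
    using q that unfolding straightens_def W_def additive_on_def by blast
  define D' where "D' = Twist n m (\<lambda>i j k. \<mu> (defect D q (\<iota> (unit_vec i)) (\<iota> (unit_vec j))) k)"
  have ranks: "base_rank D' = n" "center_rank D' = m"
    by (simp_all add: D'_def)
  have cocycle: "cocycle D' (\<kappa> u) (\<kappa> v) = \<mu> (defect D q u v)" if "u \<in> W" "v \<in> W" for u v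
  proof -
    have "\<mu> (defect D q (\<iota> (\<kappa> u)) (\<iota> (\<kappa> v))) = cocycle D' (\<kappa> u) (\<kappa> v)"
      unfolding D'_def
      by (rule twist_of_bilinear_map[of n "\<lambda>a b. \<mu> (defect D q (\<iota> a) (\<iota> b))"])
        (use that in \<open>simp_all add: additive_on_def \<iota>_add \<iota>_range defect defect_left defect_right \<mu>_simps
          \<mu>_range \<kappa>_range\<close>)
    then show ?thesis
      by (simp add: \<iota>_\<kappa> that)
  qed
  have bracket: "bracket D' (\<kappa> u) (\<kappa> v) = \<mu> (bracket D u v)" if "u \<in> W" "v \<in> W" for u v
  proof -
    have "bracket D u v = defect D q u v - defect D q v u"
      by (simp add: bracket_def defect_def add.commute)
    then show ?thesis
      using that by (simp add: bracket_def[of D'] cocycle \<mu>_simps defect)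
  qed
  have nd': "nondegenerate D'"
    unfolding nondegenerate_def ranks
  proof (intro ballI impI)
    fix a :: "nat \<Rightarrow> int" assume a: "a \<in> vecs n" "\<forall>b\<in>vecs n. bracket D' a b = 0"
    have WW: "bracket D (\<iota> a) v = 0" if v: "v \<in> W" for v
    proof -
      have "bracket D' (\<kappa> (\<iota> a)) (\<kappa> v) = 0"
        using a \<kappa>_range[OF v] by (simp add: \<kappa>_\<iota>)
      then have "\<mu> (bracket D (\<iota> a) v) = \<mu> 0"
        using bracket[OF \<iota>_range[OF a(1)] v] by (simp add: \<mu>_simps)
      then show ?thesis
        by (rule inj_onD[OF bij_betw_imp_inj_on[OF \<mu>(1)]])
          (use v \<iota>_range[OF a(1)] WY(5) add_subgroup_closed(1)[OF Y(1)] in \<open>simp_all add: W_def Y_def\<close>)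
    qed
    have "\<iota> a = 0"
    proof (rule nondegenerate_integer_dense[OF nd])
      show "\<iota> a \<in> base D"
        using \<iota>_range[OF a(1)] W(2) by blast
      fix y :: "nat \<Rightarrow> int" assume "y \<in> base D"
      then obtain k :: nat where k: "k > 0" "vscale (int k) y \<in> W"
        using multiples_in_base_of_finite_index[OF WY(1,2), of "fibre H" y] fin
          index_eq_card_pair_reps[OF H] unfolding W_def by auto
      have "vscale (int k) (bracket D (\<iota> a) y) = bracket D (\<iota> a) (vscale (int k) y)"
        by (simp add: bracket_def cocycle_scale_left cocycle_scale_right fun_eq_iff algebra_simps)
      also have "\<dots> = 0"
        by (rule WW[OF k(2)])
      finally have zero: "vscale (int k) (bracket D (\<iota> a) y) = 0" .
      show "bracket D (\<iota> a) y = 0"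
        using k(1) fun_cong[OF zero] by (intro ext) simp
    qed
    then have "\<kappa> (\<iota> a) = 0"
      by (simp add: \<kappa>_simps)
    then show "a = 0"
      by (simp add: \<kappa>_\<iota> a)
  qed
  define \<phi> where "\<phi> = (\<lambda>(u, z). (\<kappa> u, \<mu> (z - \<tau> u)))"
  have M_mem: "u \<in> W" "z - \<tau> u \<in> Y" if "(u, z) \<in> M" for u z
  proof -
    show u: "u \<in> W"
      unfolding M(3)[symmetric] using that by (rule fst_imageI)
    show "z - \<tau> u \<in> Y"
      using lie_subset_base_fibre(6)[OF M(1) \<tau>(2)[OF u]] that M(2) by blast
  qed
  have M_iff: "(u, z) \<in> M \<longleftrightarrow> u \<in> W \<and> z - \<tau> u \<in> Y" for u z
    using M_mem[of u z] lie_subset_base_fibre(6)[OF M(1) \<tau>(2)] M(2) by blast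
  have bij: "bij_betw \<phi> M (vecs n \<times> vecs m)"
    unfolding bij_betw_def
  proof
    show "inj_on \<phi> M"
    proof (rule inj_onI)
      fix x y assume xy: "x \<in> M" "y \<in> M" "\<phi> x = \<phi> y"
      obtain u z v w where uz: "x = (u, z)" "y = (v, w)"
        by (cases x, cases y)
      have "\<kappa> u = \<kappa> v"
        using xy(3) by (simp add: uz \<phi>_def)
      then have uv: "u = v"
        by (rule inj_onD[OF bij_betw_imp_inj_on[OF \<kappa>(1)]]) (use xy M_mem uz in auto)
      have "\<mu> (z - \<tau> u) = \<mu> (w - \<tau> v)"
        using xy(3) by (simp add: uz \<phi>_def)
      then have "z - \<tau> u = w - \<tau> v"
        by (rule inj_onD[OF bij_betw_imp_inj_on[OF \<mu>(1)]]) (use xy M_mem uz in auto)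
      with uv show "x = y"
        by (simp add: uz)
    qed
    show "\<phi> ` M = vecs n \<times> vecs m"
    proof
      show "\<phi> ` M \<subseteq> vecs n \<times> vecs m"
        using M_mem \<kappa>_range \<mu>_range by (auto simp: \<phi>_def)
      show "vecs n \<times> vecs m \<subseteq> \<phi> ` M"
      proof
        fix p :: "int vec_pair" assume "p \<in> vecs n \<times> vecs m"
        then obtain a b where p: "p = (a, b)" "a \<in> vecs n" "b \<in> vecs m"
          by auto
        have "b \<in> \<mu> ` Y"
          unfolding bij_betw_imp_surj_on[OF \<mu>(1)] by (rule p)
        then obtain y where y: "b = \<mu> y" "y \<in> Y"
          by (rule imageE)
        have "(\<iota> a, \<tau> (\<iota> a) + y) \<in> M" "p = \<phi> (\<iota> a, \<tau> (\<iota> a) + y)"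
          using p y by (simp_all add: M_iff \<iota>_range \<phi>_def \<kappa>_\<iota>)
        then show "p \<in> \<phi> ` M"
          by blast
      qed
    qed
  qed
  have coordinates: "lie_coordinates D M D' \<phi>"
    unfolding lie_coordinates_def ranks
  proof (intro conjI bij ballI)
    show "additive_on M \<phi>"
      unfolding additive_on_def
    proof (intro ballI)
      fix x y assume xy: "x \<in> M" "y \<in> M"
      obtain u z v w where uz: "x = (u, z)" "y = (v, w)"
        by (cases x, cases y)
      have mem: "u \<in> W" "v \<in> W" "z - \<tau> u \<in> Y" "w - \<tau> v \<in> Y"
        using xy M_mem uz by auto
      have "z + w - (\<tau> u + \<tau> v) = (z - \<tau> u) + (w - \<tau> v)"
        by simp
      then show "\<phi> (x + y) = \<phi> x + \<phi> y"
        using mem by (simp only: uz \<phi>_def add_Pair case_prod_conv \<tau>_simps \<mu>_simps \<kappa>_simps)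
    qed
    fix x y assume xy: "x \<in> M" "y \<in> M"
    obtain u z v w where uz: "x = (u, z)" "y = (v, w)"
      by (cases x, cases y)
    have mem: "u \<in> W" "v \<in> W"
      using xy M_mem uz by auto
    show "\<phi> (0, bracket D (fst x) (fst y)) = (0, bracket D' (fst (\<phi> x)) (fst (\<phi> y)))"
      using bracket[OF mem] by (simp add: uz \<phi>_def \<kappa>_simps(1) \<tau>_simps(1))
  qed
  have "(\<lambda>x. \<phi> (straighten q x)) \<in> iso ((twisted_group D)\<lparr>carrier := H\<rparr>) (twisted_group D')"
    unfolding iso_def
  proof (intro CollectI conjI)
    have "bij_betw (straighten q) H M"
      unfolding M_def by (rule inj_on_imp_bij_betw) (metis inj_onI unstraighten_straighten)
    from bij_betw_trans[OF this bij]
    show bij': "bij_betw (\<lambda>x. \<phi> (straighten q x)) (carrier ((twisted_group D)\<lparr>carrier := H\<rparr>))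
        (carrier (twisted_group D'))"
      by (simp add: ranks comp_def)
    show "(\<lambda>x. \<phi> (straighten q x)) \<in> hom ((twisted_group D)\<lparr>carrier := H\<rparr>) (twisted_group D')"
    proof (rule homI)
      show "\<phi> (straighten q x) \<in> carrier (twisted_group D')"
        if "x \<in> carrier ((twisted_group D)\<lparr>carrier := H\<rparr>)" for x
        using that bij_betwE[OF bij'] by blast
      fix x y assume "x \<in> carrier ((twisted_group D)\<lparr>carrier := H\<rparr>)" "y \<in> carrier ((twisted_group D)\<lparr>carrier := H\<rparr>)"
      then have xy: "straighten q x \<in> M" "straighten q y \<in> M"
        by (simp_all add: M_def)
      obtain u z v w where uz: "x = (u, z)" "y = (v, w)"
        by (cases x, cases y)
      have mem: "u \<in> W" "v \<in> W" "z - q u - \<tau> u \<in> Y" "w - q v - \<tau> v \<in> Y"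
        using xy M_mem by (simp_all add: uz straighten_def)
      have eq: "z + w + cocycle D u v - q (u + v) - (\<tau> u + \<tau> v)
          = (z - q u - \<tau> u) + (w - q v - \<tau> v) + defect D q u v"
        by (simp add: defect_def)
      have "\<mu> (z + w + cocycle D u v - q (u + v) - (\<tau> u + \<tau> v))
          = \<mu> (z - q u - \<tau> u) + \<mu> (w - q v - \<tau> v) + \<mu> (defect D q u v)"
        unfolding eq using mem defect[OF mem(1,2)] add_subgroup_closed(4)[OF Y(1) mem(3,4)]
        by (simp only: \<mu>_simps)
      then show "\<phi> (straighten q (x \<otimes>\<^bsub>(twisted_group D)\<lparr>carrier := H\<rparr>\<^esub> y))
          = \<phi> (straighten q x) \<otimes>\<^bsub>twisted_group D'\<^esub> \<phi> (straighten q y)"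
        using mem by (simp add: uz straighten_def \<phi>_def \<tau>_simps \<kappa>_simps cocycle)
    qed
  qed
  then show ?thesis
    using nd' coordinates unfolding is_iso_def M_def by blast
qed

section \<open>Structure constants of a group of class two\<close>

lemma int_pow_additive:
  fixes k :: "'a \<Rightarrow> nat \<Rightarrow> int" and n :: int
  assumes "group A" and add: "\<And>x y. x \<in> carrier A \<Longrightarrow> y \<in> carrier A \<Longrightarrow> k (x \<otimes>\<^bsub>A\<^esub> y) = k x + k y"
    and x: "x \<in> carrier A"
  shows "k (x [^]\<^bsub>A\<^esub> n) = vscale n (k x)"
proof -
  interpret group A by fact
  have one: "k \<one>\<^bsub>A\<^esub> = 0"
    using add[of "\<one>\<^bsub>A\<^esub>" "\<one>\<^bsub>A\<^esub>"] by simp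
  have inv: "k (inv\<^bsub>A\<^esub> y) = - k y" if "y \<in> carrier A" for y
    using add[OF that inv_closed[OF that]] one that by (simp add: eq_neg_iff_add_eq_0 add.commute)
  show ?thesis
  proof (induction n rule: int_induct[where k = 0])
    case base
    show ?case
      by (simp only: int_pow_0 one vscale_steps)
  next
    case (step1 i)
    have "x [^]\<^bsub>A\<^esub> (i + 1) = x [^]\<^bsub>A\<^esub> i \<otimes>\<^bsub>A\<^esub> x"
      using x by (simp add: int_pow_mult)
    then show ?case
      using x by (simp only: add int_pow_closed step1.IH vscale_steps)
  next
    case (step2 i)
    have "x [^]\<^bsub>A\<^esub> (i - 1) = x [^]\<^bsub>A\<^esub> i \<otimes>\<^bsub>A\<^esub> inv\<^bsub>A\<^esub> x"
      using x by (simp add: int_pow_diff)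
    then show ?case
      using x by (simp only: add inv int_pow_closed inv_closed step2.IH vscale_steps add_uminus_conv_diff)
  qed
qed

lemma free_of_embedding:
  fixes k :: "'a \<Rightarrow> nat \<Rightarrow> int"
  assumes "group A" and add: "\<And>x y. x \<in> carrier A \<Longrightarrow> y \<in> carrier A \<Longrightarrow> k (x \<otimes>\<^bsub>A\<^esub> y) = k x + k y"
    and inj: "inj_on k (carrier A)" and range: "k ` carrier A \<subseteq> vecs r"
  shows "\<exists>d (l :: 'a \<Rightarrow> nat \<Rightarrow> int). bij_betw l (carrier A) (vecs d) \<and>
    (\<forall>x\<in>carrier A. \<forall>y\<in>carrier A. l (x \<otimes>\<^bsub>A\<^esub> y) = l x + l y)"
proof -
  interpret group A by fact
  have one: "k \<one>\<^bsub>A\<^esub> = 0"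
    using add[of "\<one>\<^bsub>A\<^esub>" "\<one>\<^bsub>A\<^esub>"] by simp
  have inv: "k (inv\<^bsub>A\<^esub> y) = - k y" if "y \<in> carrier A" for y
    using add[OF that inv_closed[OF that]] one that by (simp add: eq_neg_iff_add_eq_0 add.commute)
  have "add_subgroup (k ` carrier A)"
    unfolding add_subgroup_def
  proof (intro conjI ballI)
    show "0 \<in> k ` carrier A"
      using one by (intro image_eqI[of _ _ "\<one>\<^bsub>A\<^esub>"]) simp_all
    fix u v assume "u \<in> k ` carrier A" "v \<in> k ` carrier A"
    then obtain x y where xy: "u = k x" "v = k y" "x \<in> carrier A" "y \<in> carrier A"
      by auto
    have "k (x \<otimes>\<^bsub>A\<^esub> inv\<^bsub>A\<^esub> y) = u - v"
      using xy by (simp add: add inv)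
    then show "u - v \<in> k ` carrier A"
      using xy by (metis imageI inv_closed m_closed)
  qed
  from subgroup_of_int_vecs_is_free[OF this range] obtain d and \<kappa> :: "(nat \<Rightarrow> int) \<Rightarrow> nat \<Rightarrow> int"
    where \<kappa>: "bij_betw \<kappa> (k ` carrier A) (vecs d)" "additive_on (k ` carrier A) \<kappa>"
    by blast
  have "bij_betw (\<kappa> \<circ> k) (carrier A) (vecs d)"
    using inj_on_imp_bij_betw[OF inj] \<kappa>(1) by (rule bij_betw_trans)
  moreover have "(\<kappa> \<circ> k) (x \<otimes>\<^bsub>A\<^esub> y) = (\<kappa> \<circ> k) x + (\<kappa> \<circ> k) y" if "x \<in> carrier A" "y \<in> carrier A" for x y
    using \<kappa>(2) that by (simp add: additive_on_def add)
  ultimately show ?thesis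
    by blast
qed

lemma group_centerD:
  "z \<in> group_center G \<Longrightarrow> z \<in> carrier G"
  "z \<in> group_center G \<Longrightarrow> x \<in> carrier G \<Longrightarrow> z \<otimes>\<^bsub>G\<^esub> x = x \<otimes>\<^bsub>G\<^esub> z"
  unfolding group_center_def by blast+

lemma (in group) group_center_subgroup: "subgroup (group_center G) G"
proof (rule subgroupI)
  have "\<one> \<in> group_center G"
    by (simp add: group_center_def)
  then show "group_center G \<noteq> {}"
    by blast
  show "group_center G \<subseteq> carrier G"
    unfolding group_center_def by blast
  fix a assume a: "a \<in> group_center G"
  note a_carrier = group_centerD(1)[OF a]
  show "inv a \<in> group_center G"
    unfolding group_center_def
  proof (intro CollectI conjI ballI)
    show "inv a \<in> carrier G"
      using a_carrier by simp
    fix x assume x: "x \<in> carrier G"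
    have "inv (a \<otimes> inv x) = inv (inv x \<otimes> a)"
      using group_centerD(2)[OF a inv_closed[OF x]] by (rule arg_cong)
    then show "inv a \<otimes> x = x \<otimes> inv a"
      using a_carrier x by (simp add: inv_mult_group)
  qed
  fix b assume b: "b \<in> group_center G"
  note b_carrier = group_centerD(1)[OF b]
  show "a \<otimes> b \<in> group_center G"
    unfolding group_center_def
  proof (intro CollectI conjI ballI)
    show "a \<otimes> b \<in> carrier G"
      using a_carrier b_carrier by simp
    fix x assume x: "x \<in> carrier G"
    have "a \<otimes> b \<otimes> x = a \<otimes> (b \<otimes> x)"
      using a_carrier b_carrier x by (simp add: m_assoc)
    also have "b \<otimes> x = x \<otimes> b"
      by (rule group_centerD(2)[OF b x])
    also have "a \<otimes> (x \<otimes> b) = (a \<otimes> x) \<otimes> b"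
      using a_carrier b_carrier x by (simp add: m_assoc)
    also have "a \<otimes> x = x \<otimes> a"
      by (rule group_centerD(2)[OF a x])
    finally show "a \<otimes> b \<otimes> x = x \<otimes> (a \<otimes> b)"
      using a_carrier b_carrier x by (simp add: m_assoc)
  qed
qed

lemma (in group) group_center_normal: "group_center G \<lhd> G"
proof (rule normalI[OF group_center_subgroup])
  show "\<forall>x\<in>carrier G. group_center G #> x = x <# group_center G"
    unfolding r_coset_def l_coset_def using group_centerD(2) by fastforce
qed

text \<open>The product \<open>g 0 [^] x 0 \<otimes> g 1 [^] x 1 \<otimes> \<dots>\<close> of \<open>k\<close> factors, in this order.\<close>
primrec (in monoid) ordered_power_product :: "(nat \<Rightarrow> 'a) \<Rightarrow> nat \<Rightarrow> (nat \<Rightarrow> int) \<Rightarrow> 'a"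
  where "ordered_power_product g 0 x = \<one>"
  | "ordered_power_product g (Suc k) x = ordered_power_product g k x \<otimes> (g k [^] x k)"

lemma (in group) commutator_eqI:
  assumes "x \<in> carrier G" "y \<in> carrier G" "z \<in> carrier G" "x \<otimes> y = y \<otimes> x \<otimes> z"
  shows "group_commutator G x y = z"
proof -
  have "group_commutator G x y = inv (y \<otimes> x) \<otimes> (x \<otimes> y)"
    using assms by (simp add: group_commutator_def inv_mult_group m_assoc)
  also have "\<dots> = z"
    unfolding assms(4) using assms(1-3) by (metis inv_closed l_inv l_one m_assoc m_closed)
  finally show ?thesis .
qed

lemma (in group) commutator_closed:
  "x \<in> carrier G \<Longrightarrow> y \<in> carrier G \<Longrightarrow> group_commutator G x y \<in> carrier G"
  by (simp add: group_commutator_def)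

lemma (in group) commutator_swap:
  "x \<in> carrier G \<Longrightarrow> y \<in> carrier G \<Longrightarrow> x \<otimes> y = y \<otimes> x \<otimes> group_commutator G x y"
  by (simp add: group_commutator_def m_assoc[symmetric])
    (simp add: m_assoc)

lemma (in group) class_two_commutator_central:
  assumes "group_lcs G 2 = {\<one>}" "x \<in> carrier G" "y \<in> carrier G"
  shows "group_commutator G x y \<in> group_center G"
  unfolding group_center_def
proof (intro CollectI conjI ballI)
  let ?c = "group_commutator G x y"
  show c: "?c \<in> carrier G"
    using assms(2,3) by (rule commutator_closed)
  fix w assume w: "w \<in> carrier G"
  have "?c \<in> group_lcs G 1"
    using assms(2,3) by (auto intro!: generate.incl)
  then have "group_commutator G ?c w \<in> group_lcs G 2"
    using w unfolding numeral_2_eq_2 One_nat_def group_lcs.simps(2)[of G "Suc 0"] by (blast intro: generate.incl)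
  then have "group_commutator G ?c w = \<one>"
    using assms(1) by simp
  then show "?c \<otimes> w = w \<otimes> ?c"
    using commutator_swap[OF c w] c w by simp
qed

text \<open>Here \<open>\<pi>\<close> and \<open>b\<close> are coordinates on the quotient by the center and on the center. In class two,
  commutators are central and hence biadditive. Let \<open>g\<close> lift the unit vectors. The ordered power products
  \<open>s d x\<close> represent the cosets of the center, and collecting the product of \<open>s d x\<close> and \<open>s d y\<close>, which means
  moving each power of \<open>g k\<close> in the first to the right past the powers of \<open>g i\<close> with \<open>i < k\<close> in the second,
  produces the cocycle \<open>\<gamma> d x y\<close>, bilinear in the exponents.\<close>
lemma (in group) class_two_group_twist:
  fixes \<pi> b :: "'a \<Rightarrow> nat \<Rightarrow> int"
  assumes central: "\<And>x y. x \<in> carrier G \<Longrightarrow> y \<in> carrier G \<Longrightarrow> group_commutator G x y \<in> group_center G"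
    and \<pi>: "\<And>x y. x \<in> carrier G \<Longrightarrow> y \<in> carrier G \<Longrightarrow> \<pi> (x \<otimes> y) = \<pi> x + \<pi> y"
    and \<pi>_surj: "\<pi> ` carrier G = vecs d"
    and \<pi>_kernel: "\<And>x. x \<in> carrier G \<Longrightarrow> \<pi> x = 0 \<longleftrightarrow> x \<in> group_center G"
    and b: "\<And>x y. x \<in> group_center G \<Longrightarrow> y \<in> group_center G \<Longrightarrow> b (x \<otimes> y) = b x + b y"
    and b_bij: "bij_betw b (group_center G) (vecs e)"
  shows "\<exists>D. base_rank D = d \<and> center_rank D = e \<and> nondegenerate D \<and>
    G \<cong> (twisted_group D :: int vec_pair monoid) \<and>
    (\<forall>x\<in>carrier G. \<forall>y\<in>carrier G. b (group_commutator G x y) = bracket D (\<pi> x) (\<pi> y))"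
proof -
  let ?Z = "group_center G" and ?C = "group_commutator G"
  interpret Z: subgroup ?Z G by (rule group_center_subgroup)
  have Z_comm: "z \<otimes> x = x \<otimes> z" if "z \<in> ?Z" "x \<in> carrier G" for x z
    using that by (rule group_centerD(2))
  have C_left: "?C (x \<otimes> x') y = ?C x y \<otimes> ?C x' y"
    if [simp]: "x \<in> carrier G" "x' \<in> carrier G" "y \<in> carrier G" for x x' y
  proof (rule commutator_eqI)
    have [simp]: "?C x y \<in> carrier G" "?C x' y \<in> carrier G"
      by (simp_all add: commutator_closed)
    have "x \<otimes> x' \<otimes> y = x \<otimes> (y \<otimes> x' \<otimes> ?C x' y)"
      using commutator_swap[of x' y] by (simp add: m_assoc)
    also have "\<dots> = (x \<otimes> y) \<otimes> x' \<otimes> ?C x' y"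
      by (simp add: m_assoc)
    also have "x \<otimes> y = y \<otimes> x \<otimes> ?C x y"
      by (rule commutator_swap) simp_all
    also have "y \<otimes> x \<otimes> ?C x y \<otimes> x' = y \<otimes> x \<otimes> (x' \<otimes> ?C x y)"
      using Z_comm[OF central[of x y]] by (simp add: m_assoc)
    finally show "x \<otimes> x' \<otimes> y = y \<otimes> (x \<otimes> x') \<otimes> (?C x y \<otimes> ?C x' y)"
      by (simp add: m_assoc)
  qed (simp_all add: commutator_closed)
  have C_right: "?C y (x \<otimes> x') = ?C y x \<otimes> ?C y x'"
    if [simp]: "x \<in> carrier G" "x' \<in> carrier G" "y \<in> carrier G" for x x' y
  proof (rule commutator_eqI)
    have [simp]: "?C y x \<in> carrier G" "?C y x' \<in> carrier G"
      by (simp_all add: commutator_closed)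
    have "y \<otimes> (x \<otimes> x') = (y \<otimes> x) \<otimes> x'"
      by (simp add: m_assoc)
    also have "y \<otimes> x = x \<otimes> y \<otimes> ?C y x"
      by (rule commutator_swap) simp_all
    also have "x \<otimes> y \<otimes> ?C y x \<otimes> x' = x \<otimes> (y \<otimes> x') \<otimes> ?C y x"
      using Z_comm[OF central[of y x]] by (simp add: m_assoc)
    also have "y \<otimes> x' = x' \<otimes> y \<otimes> ?C y x'"
      by (rule commutator_swap) simp_all
    finally show "y \<otimes> (x \<otimes> x') = x \<otimes> x' \<otimes> y \<otimes> (?C y x \<otimes> ?C y x')"
      using Z_comm[OF central[of y x], of "?C y x'"] by (simp add: m_assoc)
  qed (simp_all add: commutator_closed)
  define c where "c x y = b (?C x y)" for x y
  have c_left: "c (x \<otimes> x') y = c x y + c x' y"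
    and c_right: "c y (x \<otimes> x') = c y x + c y x'"
    if "x \<in> carrier G" "x' \<in> carrier G" "y \<in> carrier G" for x x' y
    using that by (simp_all add: c_def C_left C_right b central)
  have c_center: "c y z = 0" if "z \<in> ?Z" "y \<in> carrier G" for y z
  proof -
    have "?C y z = \<one>"
      by (rule commutator_eqI) (use that Z_comm[OF that] in simp_all)
    moreover have "b \<one> = 0"
      using b[OF Z.one_closed Z.one_closed] by simp
    ultimately show ?thesis
      by (simp add: c_def)
  qed
  have c_range: "c x y \<in> vecs e" if "x \<in> carrier G" "y \<in> carrier G" for x y
    using bij_betwE[OF b_bij] central[OF that] by (simp add: c_def)
  have c_pow: "c (x [^] n) y = vscale n (c x y)" if "x \<in> carrier G" "y \<in> carrier G" for x y and n :: int
    by (rule int_pow_additive[of G "\<lambda>x. c x y"]) (use that c_left is_group in auto)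
  define b' where "b' = inv_into ?Z b"
  have b': "b' v \<in> ?Z" "b (b' v) = v" if "v \<in> vecs e" for v
    using that b_bij by (simp_all add: b'_def bij_betw_def inv_into_into f_inv_into_f)
  have b'_b: "b' (b z) = z" if "z \<in> ?Z" for z
    using that b_bij by (simp add: b'_def bij_betw_def)
  have b'_add: "b' (u + v) = b' u \<otimes> b' v" if "u \<in> vecs e" "v \<in> vecs e" for u v
  proof -
    have "b (b' u \<otimes> b' v) = u + v"
      using that by (simp add: b b')
    then show ?thesis
      using b'_b[of "b' u \<otimes> b' v"] b'[OF that(1)] b'[OF that(2)] by simp
  qed
  have "\<exists>g. g \<in> carrier G \<and> \<pi> g = unit_vec i" if "i < d" for i
    using \<pi>_surj unit_vec_vecs[OF that] by (metis imageE)
  then obtain g where g': "\<And>i. i < d \<Longrightarrow> g i \<in> carrier G \<and> \<pi> (g i) = unit_vec i"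
    by metis
  then have g: "\<And>i. i < d \<Longrightarrow> g i \<in> carrier G" "\<And>i. i < d \<Longrightarrow> \<pi> (g i) = unit_vec i"
    by blast+
  define s where "s = ordered_power_product g"
  have s_simps: "s 0 x = \<one>" "s (Suc k) x = s k x \<otimes> (g k [^] x k)" for k x
    by (simp_all add: s_def)
  have s_closed: "s k x \<in> carrier G" if "k \<le> d" for k x
    using that by (induction k) (simp_all add: s_simps g)
  define \<gamma> where "\<gamma> k x y = (\<Sum>i<k. vscale (x i) (c (g i) (s i y)))" for k x y
  have \<gamma>_Suc: "\<gamma> (Suc k) x y = \<gamma> k x y + vscale (x k) (c (g k) (s k y))" for k x y
    unfolding \<gamma>_def by (rule sum.lessThan_Suc)
  have \<gamma>_range: "\<gamma> k x y \<in> vecs e" if "k \<le> d" for k x y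
    unfolding \<gamma>_def using that by (intro add_subgroup_sum[OF vecs_subgroup] vscale_vecs c_range g s_closed) auto
  \<comment> \<open>Moving \<open>g k [^] x k\<close> to the right past \<open>s k y\<close> contributes \<open>x k\<close> times the commutator of \<open>g k\<close> and
    \<open>s k y\<close>.\<close>
  have s_mult: "s k x \<otimes> s k y = s k (x + y) \<otimes> b' (\<gamma> k x y)" if "k \<le> d" for k x y
    using that
  proof (induction k)
    case 0
    have "b' 0 = \<one>"
      using b'_b[OF Z.one_closed] b[OF Z.one_closed Z.one_closed] by simp
    then have "b' (\<gamma> 0 x y) = \<one>"
      unfolding \<gamma>_def lessThan_0 sum.empty .
    then show ?case
      by (simp add: s_simps)
  next
    case (Suc k)
    have k: "k < d" "k \<le> d"
      using Suc.prems by auto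
    let ?p = "g k [^] x k" and ?q = "g k [^] y k" and ?w = "?C (g k [^] x k) (s k y)"
    note [simp] = g(1)[OF k(1)] s_closed[OF k(2)]
    have wZ: "?w \<in> ?Z"
      by (rule central) simp_all
    have [simp]: "?w \<in> carrier G" "b' (\<gamma> k x y) \<in> carrier G"
      using wZ b'(1)[OF \<gamma>_range[OF k(2)]] by simp_all
    have w: "?w = b' (vscale (x k) (c (g k) (s k y)))"
      using b'_b[OF wZ] c_pow[of "g k" "s k y" "x k"] by (simp add: c_def)
    have "s k x \<otimes> ?p \<otimes> (s k y \<otimes> ?q) = s k x \<otimes> (?p \<otimes> s k y) \<otimes> ?q"
      by (simp add: m_assoc)
    also have "?p \<otimes> s k y = s k y \<otimes> ?p \<otimes> ?w"
      by (rule commutator_swap) simp_all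
    also have "s k x \<otimes> (s k y \<otimes> ?p \<otimes> ?w) \<otimes> ?q = (s k x \<otimes> s k y) \<otimes> (?p \<otimes> (?w \<otimes> ?q))"
      by (simp add: m_assoc)
    also have "?w \<otimes> ?q = ?q \<otimes> ?w"
      by (rule Z_comm[OF wZ]) simp
    also have "s k x \<otimes> s k y = s k (x + y) \<otimes> b' (\<gamma> k x y)"
      by (rule Suc.IH[OF k(2)])
    also have "s k (x + y) \<otimes> b' (\<gamma> k x y) \<otimes> (?p \<otimes> (?q \<otimes> ?w))
        = s k (x + y) \<otimes> (b' (\<gamma> k x y) \<otimes> (?p \<otimes> ?q)) \<otimes> ?w"
      by (simp add: m_assoc)
    also have "b' (\<gamma> k x y) \<otimes> (?p \<otimes> ?q) = (?p \<otimes> ?q) \<otimes> b' (\<gamma> k x y)"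
      by (rule Z_comm[OF b'(1)[OF \<gamma>_range[OF k(2)]]]) simp
    also have "s k (x + y) \<otimes> (?p \<otimes> ?q \<otimes> b' (\<gamma> k x y)) \<otimes> ?w
        = s k (x + y) \<otimes> (?p \<otimes> ?q) \<otimes> (b' (\<gamma> k x y) \<otimes> ?w)"
      by (simp add: m_assoc)
    also have "?p \<otimes> ?q = g k [^] (x + y) k"
      by (simp add: int_pow_mult)
    also have "b' (\<gamma> k x y) \<otimes> ?w = b' (\<gamma> (Suc k) x y)"
      unfolding w \<gamma>_Suc by (rule b'_add[symmetric]) (use \<gamma>_range[OF k(2)] c_range in auto)
    finally show ?case
      unfolding s_simps .
  qed
  have \<gamma>_left: "\<gamma> d (x + x') y = \<gamma> d x y + \<gamma> d x' y" for x x' y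
    by (rule ext) (simp add: \<gamma>_def sum_fun_apply sum.distrib algebra_simps)
  have \<gamma>_right: "\<gamma> d x (y + y') = \<gamma> d x y + \<gamma> d x y'" for x y y'
  proof -
    have "c (g i) (s i (y + y')) = c (g i) (s i y) + c (g i) (s i y')" if i: "i < d" for i
    proof -
      have "c (g i) (s i y \<otimes> s i y') = c (g i) (s i (y + y')) + c (g i) (b' (\<gamma> i y y'))"
        unfolding s_mult[OF less_imp_le[OF i]]
        by (rule c_right) (use i g s_closed b'(1)[OF \<gamma>_range] in simp_all)
      also have "c (g i) (b' (\<gamma> i y y')) = 0"
        by (rule c_center) (use i g b'(1)[OF \<gamma>_range] in simp_all)
      finally have "c (g i) (s i (y + y')) = c (g i) (s i y \<otimes> s i y')"
        by (metis add_0_right)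
      also have "\<dots> = c (g i) (s i y) + c (g i) (s i y')"
        by (rule c_right) (use i g s_closed in simp_all)
      finally show ?thesis .
    qed
    then show ?thesis
      unfolding \<gamma>_def sum.distrib[symmetric] by (intro sum.cong refl ext) (simp add: algebra_simps)
  qed
  define D where "D = Twist d e (\<lambda>i j k. \<gamma> d (unit_vec i) (unit_vec j) k)"
  have ranks: "base_rank D = d" "center_rank D = e"
    by (simp_all add: D_def)
  have cocycle: "cocycle D x y = \<gamma> d x y" if "x \<in> vecs d" "y \<in> vecs d" for x y
    unfolding D_def
    by (rule twist_of_bilinear_map[symmetric])
      (use that \<gamma>_range in \<open>simp_all add: additive_on_def \<gamma>_left \<gamma>_right\<close>)
  note s_closed' = s_closed[OF order_refl]
  have \<pi>_one: "\<pi> \<one> = 0"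
    using \<pi>[OF one_closed one_closed] by simp
  have \<pi>_s: "\<pi> (s d x) = x" if x: "x \<in> vecs d" for x
  proof -
    have "\<pi> (s k x) = (\<Sum>i<k. vscale (x i) (unit_vec i))" if "k \<le> d" for k
      using that
    proof (induction k)
      case 0
      show ?case
        unfolding s_simps lessThan_0 sum.empty by (rule \<pi>_one)
    next
      case (Suc k)
      then have k: "k < d" "k \<le> d"
        by auto
      have "\<pi> (s (Suc k) x) = \<pi> (s k x) + \<pi> (g k [^] x k)"
        unfolding s_simps by (rule \<pi>) (use k s_closed g in auto)
      also have "\<pi> (g k [^] x k) = vscale (x k) (\<pi> (g k))"
        by (rule int_pow_additive[OF is_group, where k = \<pi>]) (use k g \<pi> in auto)
      finally show ?case
        unfolding sum.lessThan_Suc using Suc.IH[OF k(2)] g(2)[OF k(1)] by (simp only:)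
    qed
    from this[OF order_refl] show ?thesis
      by (simp only: unit_vec_expansion[OF x])
  qed
  have bracket_s: "c (s d x) (s d y) = bracket D x y" if xy: "x \<in> vecs d" "y \<in> vecs d" for x y
  proof -
    have Cxy: "?C (s d x) (s d y) \<in> ?Z"
      by (rule central) (rule s_closed')+
    have "s d (x + y) \<otimes> b' (\<gamma> d x y) = s d (x + y) \<otimes> b' (\<gamma> d y x) \<otimes> ?C (s d x) (s d y)"
      using commutator_swap[OF s_closed' s_closed', of x y] s_mult[OF order_refl, of x y]
        s_mult[OF order_refl, of y x] by (simp add: add.commute)
    then have "b' (\<gamma> d x y) = b' (\<gamma> d y x) \<otimes> ?C (s d x) (s d y)"
      using s_closed' b'(1)[OF \<gamma>_range[OF order_refl]] Cxy by (simp add: m_assoc)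
    then have "b (b' (\<gamma> d x y)) = b (b' (\<gamma> d y x)) + c (s d x) (s d y)"
      unfolding c_def using b[OF b'(1)[OF \<gamma>_range[OF order_refl]] Cxy, of y x] by (simp only:)
    then have "\<gamma> d x y = \<gamma> d y x + c (s d x) (s d y)"
      by (simp only: b'(2)[OF \<gamma>_range[OF order_refl]])
    then show ?thesis
      by (simp add: bracket_def cocycle xy)
  qed
  have decompose: "\<exists>z\<in>?Z. x = s d (\<pi> x) \<otimes> z" "\<pi> x \<in> vecs d" if x: "x \<in> carrier G" for x
  proof -
    show \<pi>x: "\<pi> x \<in> vecs d"
      using x \<pi>_surj by blast
    define z where "z = inv (s d (\<pi> x)) \<otimes> x"
    have z: "z \<in> carrier G" "x = s d (\<pi> x) \<otimes> z"
      using x s_closed' by (simp_all add: z_def m_assoc[symmetric])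
    then have "\<pi> x = \<pi> x + \<pi> z"
      using \<pi>[OF s_closed' z(1), of "\<pi> x"] \<pi>_s[OF \<pi>x] by simp
    then have "z \<in> ?Z"
      using \<pi>_kernel[OF z(1)] by simp
    with z(2) show "\<exists>z\<in>?Z. x = s d (\<pi> x) \<otimes> z"
      by blast
  qed
  have c_center': "c z y = 0" if "z \<in> ?Z" "y \<in> carrier G" for y z
  proof -
    have "?C z y = \<one>"
      by (rule commutator_eqI) (use that Z_comm[OF that] in simp_all)
    moreover have "b \<one> = 0"
      using b[OF Z.one_closed Z.one_closed] by simp
    ultimately show ?thesis
      by (simp add: c_def)
  qed
  have bracket: "c x y = bracket D (\<pi> x) (\<pi> y)" if xy: "x \<in> carrier G" "y \<in> carrier G" for x y
  proof -
    obtain z where z: "z \<in> ?Z" "x = s d (\<pi> x) \<otimes> z"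
      using decompose(1)[OF xy(1)] by (rule bexE)
    obtain w where w: "w \<in> ?Z" "y = s d (\<pi> y) \<otimes> w"
      using decompose(1)[OF xy(2)] by (rule bexE)
    have "c x y = c (s d (\<pi> x)) y + c z y"
      using c_left[OF s_closed' Z.mem_carrier[OF z(1)] xy(2), of "\<pi> x"] unfolding z(2)[symmetric] .
    also have "c z y = 0"
      by (rule c_center'[OF z(1) xy(2)])
    also have "c (s d (\<pi> x)) y = c (s d (\<pi> x)) (s d (\<pi> y)) + c (s d (\<pi> x)) w"
      using c_right[OF s_closed' Z.mem_carrier[OF w(1)] s_closed', of "\<pi> x" "\<pi> y"] unfolding w(2)[symmetric] .
    also have "c (s d (\<pi> x)) w = 0"
      by (rule c_center[OF w(1) s_closed'])
    finally show ?thesis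
      using bracket_s decompose(2) xy by simp
  qed
  have "nondegenerate D"
    unfolding nondegenerate_def ranks
  proof (intro ballI impI)
    fix x :: "nat \<Rightarrow> int" assume x: "x \<in> vecs d" "\<forall>y\<in>vecs d. bracket D x y = 0"
    have "s d x \<in> ?Z"
      unfolding group_center_def
    proof (intro CollectI conjI ballI s_closed')
      fix y assume y: "y \<in> carrier G"
      have "c (s d x) y = 0"
        unfolding bracket[OF s_closed' y] \<pi>_s[OF x(1)] using x(2) decompose(2)[OF y] by blast
      then have "b (?C (s d x) y) = b \<one>"
        using b[OF Z.one_closed Z.one_closed] by (simp add: c_def)
      then have "?C (s d x) y = \<one>"
        by (rule inj_onD[OF bij_betw_imp_inj_on[OF b_bij] _ central[OF s_closed' y] Z.one_closed])
      then show "s d x \<otimes> y = y \<otimes> s d x"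
        using commutator_swap[OF s_closed' y, of x] s_closed' y by simp
    qed
    then show "x = 0"
      using \<pi>_kernel[OF s_closed', of x] \<pi>_s[OF x(1)] by simp
  qed
  moreover have "G \<cong> (twisted_group D :: int vec_pair monoid)"
  proof (rule group.iso_sym[OF group_twisted_group])
    define \<Psi> where "\<Psi> = (\<lambda>(x, z). s d x \<otimes> b' z)"
    have "\<Psi> \<in> iso (twisted_group D) G"
      unfolding iso_def
    proof (intro CollectI conjI)
      show "\<Psi> \<in> hom (twisted_group D) G"
      proof (rule homI)
        fix p q :: "int vec_pair"
        assume pq: "p \<in> carrier (twisted_group D)" "q \<in> carrier (twisted_group D)"
        obtain x z y w where eqs: "p = (x, z)" "q = (y, w)"
          by (cases p, cases q)
        have mem: "x \<in> vecs d" "y \<in> vecs d" "z \<in> vecs e" "w \<in> vecs e"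
          using pq by (simp_all add: eqs ranks)
        note Zs = b'(1)[OF mem(3)] b'(1)[OF mem(4)] b'(1)[OF \<gamma>_range[OF order_refl]]
        note cs = Zs[THEN Z.mem_carrier] s_closed'
        have "\<Psi> p \<otimes> \<Psi> q = s d x \<otimes> (b' z \<otimes> s d y) \<otimes> b' w"
          using cs by (simp add: \<Psi>_def eqs m_assoc)
        also have "b' z \<otimes> s d y = s d y \<otimes> b' z"
          by (rule Z_comm[OF Zs(1) s_closed'])
        also have "s d x \<otimes> (s d y \<otimes> b' z) \<otimes> b' w = (s d x \<otimes> s d y) \<otimes> (b' z \<otimes> b' w)"
          using cs by (simp add: m_assoc)
        also have "\<dots> = s d (x + y) \<otimes> (b' (\<gamma> d x y) \<otimes> (b' z \<otimes> b' w))"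
          unfolding s_mult[OF order_refl] using cs by (simp add: m_assoc)
        also have "b' (\<gamma> d x y) \<otimes> (b' z \<otimes> b' w) = b' (\<gamma> d x y + (z + w))"
          using mem \<gamma>_range[OF order_refl] by (simp add: b'_add)
        also have "\<gamma> d x y + (z + w) = z + w + cocycle D x y"
          using mem by (simp add: cocycle)
        finally have "\<Psi> p \<otimes> \<Psi> q = s d (x + y) \<otimes> b' (z + w + cocycle D x y)" .
        then show "\<Psi> (p \<otimes>\<^bsub>twisted_group D\<^esub> q) = \<Psi> p \<otimes> \<Psi> q"
          by (simp only: eqs twisted_group_simps \<Psi>_def case_prod_conv)
      next
        fix p :: "int vec_pair" assume "p \<in> carrier (twisted_group D)"
        then show "\<Psi> p \<in> carrier G"
          using s_closed' b'(1) by (cases p) (simp add: \<Psi>_def ranks)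
      qed
      show "bij_betw \<Psi> (carrier (twisted_group D)) (carrier G)"
        unfolding bij_betw_def
      proof
        show "inj_on \<Psi> (carrier (twisted_group D))"
        proof (rule inj_onI)
          fix p q :: "int vec_pair"
          assume pq: "p \<in> carrier (twisted_group D)" "q \<in> carrier (twisted_group D)" "\<Psi> p = \<Psi> q"
          obtain x z y w where eqs: "p = (x, z)" "q = (y, w)"
            by (cases p, cases q)
          have mem: "x \<in> vecs d" "y \<in> vecs d" "z \<in> vecs e" "w \<in> vecs e"
            using pq by (simp_all add: eqs ranks)
          have \<pi>_\<Psi>: "\<pi> (s d x \<otimes> b' z) = x" if "x \<in> vecs d" "z \<in> vecs e" for x z
            using \<pi>[OF s_closed', of "b' z" x] \<pi>_kernel[of "b' z"] b'(1)[OF that(2)] \<pi>_s[OF that(1)]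
            by simp
          have eq: "s d x \<otimes> b' z = s d y \<otimes> b' w"
            using pq(3) by (simp add: \<Psi>_def eqs)
          then have xy: "x = y"
            using \<pi>_\<Psi>[OF mem(1,3)] \<pi>_\<Psi>[OF mem(2,4)] by simp
          then have "b' z = b' w"
            using eq s_closed' b'(1)[OF mem(3)] b'(1)[OF mem(4)] by simp
          then have "b (b' z) = b (b' w)"
            by (rule arg_cong)
          then have "z = w"
            by (simp only: b'(2)[OF mem(3)] b'(2)[OF mem(4)])
          with xy show "p = q"
            by (simp add: eqs)
        qed
        show "\<Psi> ` carrier (twisted_group D) = carrier G"
        proof
          show "\<Psi> ` carrier (twisted_group D) \<subseteq> carrier G"
            using s_closed' b'(1) by (auto simp: \<Psi>_def ranks)
          show "carrier G \<subseteq> \<Psi> ` carrier (twisted_group D)"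
          proof
            fix x assume x: "x \<in> carrier G"
            obtain z where z: "z \<in> ?Z" "x = s d (\<pi> x) \<otimes> z"
              using decompose(1)[OF x] by (rule bexE)
            have "\<Psi> (\<pi> x, b z) = s d (\<pi> x) \<otimes> z"
              by (simp add: \<Psi>_def b'_b[OF z(1)])
            then have "x = \<Psi> (\<pi> x, b z)"
              unfolding z(2)[symmetric] by (rule sym)
            moreover have "(\<pi> x, b z) \<in> carrier (twisted_group D)"
              using decompose(2)[OF x] bij_betwE[OF b_bij] z(1) by (simp add: ranks)
            ultimately show "x \<in> \<Psi> ` carrier (twisted_group D)"
              by (rule image_eqI)
          qed
        qed
      qed
    qed
    then show "(twisted_group D :: int vec_pair monoid) \<cong> G"
      by (rule is_isoI)
  qed
  moreover have "\<forall>x\<in>carrier G. \<forall>y\<in>carrier G. b (?C x y) = bracket D (\<pi> x) (\<pi> y)"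
    by (intro ballI) (rule bracket[unfolded c_def])
  ultimately show ?thesis
    using ranks by - (rule exI[of _ D], simp only: simp_thms)
qed

section \<open>Structure constants of a Lie algebra\<close>

text \<open>Enough of the axioms for an inverse of an isomorphism to be one, so that restrictions of Lie algebras
  to subsets and tensor products can be handled without verifying the remaining axioms.\<close>
definition lie_closed :: "('r, 'm) ring_scheme \<Rightarrow> ('r, 'a, 'n) module_scheme \<Rightarrow> bool"
  where "lie_closed S L \<longleftrightarrow>
    (\<forall>x\<in>carrier L. \<forall>y\<in>carrier L. x \<oplus>\<^bsub>L\<^esub> y \<in> carrier L \<and> x \<otimes>\<^bsub>L\<^esub> y \<in> carrier L) \<and>
    (\<forall>c\<in>carrier S. \<forall>x\<in>carrier L. c \<odot>\<^bsub>L\<^esub> x \<in> carrier L)"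

lemma lie_isomorphic_iff:
  "lie_isomorphic S L M \<longleftrightarrow> (\<exists>h. bij_betw h (carrier L) (carrier M) \<and>
    (\<forall>x\<in>carrier L. \<forall>y\<in>carrier L. h (x \<oplus>\<^bsub>L\<^esub> y) = h x \<oplus>\<^bsub>M\<^esub> h y \<and> h (x \<otimes>\<^bsub>L\<^esub> y) = h x \<otimes>\<^bsub>M\<^esub> h y) \<and>
    (\<forall>c\<in>carrier S. \<forall>x\<in>carrier L. h (c \<odot>\<^bsub>L\<^esub> x) = c \<odot>\<^bsub>M\<^esub> h x))"
proof -
  have "h \<in> iso (add_monoid L) (add_monoid M) \<longleftrightarrow> bij_betw h (carrier L) (carrier M) \<and>
      (\<forall>x\<in>carrier L. \<forall>y\<in>carrier L. h (x \<oplus>\<^bsub>L\<^esub> y) = h x \<oplus>\<^bsub>M\<^esub> h y)" for h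
    by (auto simp: iso_def hom_def dest: bij_betwE)
  then show ?thesis
    unfolding lie_isomorphic_def by blast
qed

lemma lie_isomorphic_trans:
  assumes "lie_isomorphic S L M" "lie_isomorphic S M N"
  shows "lie_isomorphic S L N"
proof -
  obtain h where h: "bij_betw h (carrier L) (carrier M)"
    "\<forall>x\<in>carrier L. \<forall>y\<in>carrier L. h (x \<oplus>\<^bsub>L\<^esub> y) = h x \<oplus>\<^bsub>M\<^esub> h y \<and> h (x \<otimes>\<^bsub>L\<^esub> y) = h x \<otimes>\<^bsub>M\<^esub> h y"
    "\<forall>c\<in>carrier S. \<forall>x\<in>carrier L. h (c \<odot>\<^bsub>L\<^esub> x) = c \<odot>\<^bsub>M\<^esub> h x"
    using assms(1) unfolding lie_isomorphic_iff by blast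
  obtain k where k: "bij_betw k (carrier M) (carrier N)"
    "\<forall>x\<in>carrier M. \<forall>y\<in>carrier M. k (x \<oplus>\<^bsub>M\<^esub> y) = k x \<oplus>\<^bsub>N\<^esub> k y \<and> k (x \<otimes>\<^bsub>M\<^esub> y) = k x \<otimes>\<^bsub>N\<^esub> k y"
    "\<forall>c\<in>carrier S. \<forall>x\<in>carrier M. k (c \<odot>\<^bsub>M\<^esub> x) = c \<odot>\<^bsub>N\<^esub> k x"
    using assms(2) unfolding lie_isomorphic_iff by blast
  have "h x \<in> carrier M" if "x \<in> carrier L" for x
    using bij_betwE[OF h(1)] that by blast
  then show ?thesis
    unfolding lie_isomorphic_iff using bij_betw_trans[OF h(1) k(1)] h(2,3) k(2,3)
    by (intro exI[of _ "k \<circ> h"]) simp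
qed

lemma lie_isomorphic_sym:
  assumes "lie_isomorphic S L M" "lie_closed S L"
  shows "lie_isomorphic S M L"
proof -
  obtain h where h: "bij_betw h (carrier L) (carrier M)"
    "\<And>x y. x \<in> carrier L \<Longrightarrow> y \<in> carrier L \<Longrightarrow> h (x \<oplus>\<^bsub>L\<^esub> y) = h x \<oplus>\<^bsub>M\<^esub> h y"
    "\<And>x y. x \<in> carrier L \<Longrightarrow> y \<in> carrier L \<Longrightarrow> h (x \<otimes>\<^bsub>L\<^esub> y) = h x \<otimes>\<^bsub>M\<^esub> h y"
    "\<And>c x. c \<in> carrier S \<Longrightarrow> x \<in> carrier L \<Longrightarrow> h (c \<odot>\<^bsub>L\<^esub> x) = c \<odot>\<^bsub>M\<^esub> h x"
    using assms(1) unfolding lie_isomorphic_iff by blast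
  define k where "k = inv_into (carrier L) h"
  have k: "k y \<in> carrier L" "h (k y) = y" if "y \<in> carrier M" for y
    using h(1) that by (simp_all add: k_def bij_betw_def inv_into_into f_inv_into_f)
  have k_eqI: "k y = x" if "x \<in> carrier L" "h x = y" for x y
    using h(1) that by (auto simp: k_def bij_betw_def)
  have "bij_betw k (carrier M) (carrier L)"
    unfolding k_def using h(1) by (rule bij_betw_inv_into)
  moreover have "k (x \<oplus>\<^bsub>M\<^esub> y) = k x \<oplus>\<^bsub>L\<^esub> k y" "k (x \<otimes>\<^bsub>M\<^esub> y) = k x \<otimes>\<^bsub>L\<^esub> k y"
    if "x \<in> carrier M" "y \<in> carrier M" for x y
    using assms(2) that by (auto intro!: k_eqI simp: lie_closed_def h k)
  moreover have "k (c \<odot>\<^bsub>M\<^esub> x) = c \<odot>\<^bsub>L\<^esub> k x" if "c \<in> carrier S" "x \<in> carrier M" for c x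
    using assms(2) that by (auto intro!: k_eqI simp: lie_closed_def h k)
  ultimately show ?thesis
    unfolding lie_isomorphic_iff by blast
qed

lemma lie_isomorphic_cong:
  assumes "lie_isomorphic S L L'" "lie_isomorphic S M M'" "lie_closed S L" "lie_closed S M"
  shows "lie_isomorphic S L M \<longleftrightarrow> lie_isomorphic S L' M'"
  using assms lie_isomorphic_trans lie_isomorphic_sym by metis

text \<open>The bases of the quotient by the center and of the center are chosen once; the twist they define for the
  group has the bracket of \<open>lie_of_group G\<close> because this bracket is the commutator.\<close>
lemma twist_of_group_and_lie_algebra:
  fixes L :: "(int, 'a) module" and G :: "'g monoid" (structure)
  assumes L: "lie_algebra \<Z> L" "free_of_finite_rank L"
    and G: "group G" "group_lcs G 2 = {\<one>\<^bsub>G\<^esub>}"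
    and iso: "lie_isomorphic \<Z> L (lie_of_group G)"
  shows "\<exists>D. nondegenerate D \<and> G \<cong> (twisted_group D :: int vec_pair monoid) \<and>
    lie_isomorphic \<Z> L (lie_model id D)"
proof -
  interpret group G by fact
  interpret L: lie_algebra \<Z> L by fact
  let ?Z = "group_center G"
  define V where "V = G Mod ?Z"
  define K where "K = G\<lparr>carrier := ?Z\<rparr>"
  interpret Z: normal ?Z G by (rule group_center_normal)
  interpret V: group V
    unfolding V_def by (rule Z.factorgroup_is_group)
  interpret K: group K
    unfolding K_def by (rule subgroup.subgroup_is_group[OF group_center_subgroup is_group])
  define A where "A = V \<times>\<times> K"
  interpret A: group A
    unfolding A_def by (rule DirProd_group) (rule V.is_group K.is_group)+
  have A: "carrier A = carrier V \<times> carrier K" "\<one>\<^bsub>A\<^esub> = (\<one>\<^bsub>V\<^esub>, \<one>\<^bsub>K\<^esub>)"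
    "\<And>U a W b. (U, a) \<otimes>\<^bsub>A\<^esub> (W, b) = (U \<otimes>\<^bsub>V\<^esub> W, a \<otimes>\<^bsub>K\<^esub> b)"
    by (simp_all add: A_def)
  have K: "carrier K = ?Z" "\<one>\<^bsub>K\<^esub> = \<one>" "\<And>a b. a \<otimes>\<^bsub>K\<^esub> b = a \<otimes> b"
    by (simp_all add: K_def)
  have lie: "carrier (lie_of_group G) = carrier A"
    "\<And>u v. u \<oplus>\<^bsub>lie_of_group G\<^esub> v = u \<otimes>\<^bsub>A\<^esub> v"
    "\<And>n u. n \<odot>\<^bsub>lie_of_group G\<^esub> u = u [^]\<^bsub>A\<^esub> n"
    "\<And>U a W b. (U, a) \<otimes>\<^bsub>lie_of_group G\<^esub> (W, b)
      = (\<one>\<^bsub>V\<^esub>, the_elem (\<Union>x\<in>U. \<Union>y\<in>W. {group_commutator G x y}))"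
    by (simp_all add: lie_of_group_def Let_def A_def V_def K_def)
  have central: "group_commutator G x y \<in> ?Z" if "x \<in> carrier G" "y \<in> carrier G" for x y
    by (rule class_two_commutator_central[OF G(2) that])
  \<comment> \<open>Through \<open>L\<close> the additive group of \<open>lie_of_group G\<close> embeds into a free abelian group of finite
    rank, and so do its two factors, which are therefore free.\<close>
  have "\<exists>E r. inj_on E (carrier A) \<and> E ` carrier A \<subseteq> (vecs r :: (nat \<Rightarrow> int) set) \<and>
      (\<forall>u\<in>carrier A. \<forall>v\<in>carrier A. E (u \<otimes>\<^bsub>A\<^esub> v) = E u + E v)"
  proof -
    obtain h where h: "h \<in> iso (add_monoid L) (add_monoid (lie_of_group G))"
      using iso unfolding lie_isomorphic_def by blast
    obtain r :: nat and p where p: "p \<in> iso (add_monoid L) (free_Abelian_group {..<r})"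
      using L(2) unfolding free_of_finite_rank_def is_iso_def by blast
    define k where "k = inv_into (carrier (add_monoid L)) h"
    have k: "k \<in> iso (add_monoid (lie_of_group G)) (add_monoid L)"
      unfolding k_def by (rule group.iso_set_sym[OF L.add.is_group h])
    define E where "E u = Poly_Mapping.lookup (p (k u))" for u
    have k_mem: "k u \<in> carrier L" if "u \<in> carrier A" for u
      using k that bij_betwE[of k "carrier A" "carrier L"] by (simp add: iso_def lie)
    have "inj_on E (carrier A)"
    proof (rule inj_onI)
      fix u v assume uv: "u \<in> carrier A" "v \<in> carrier A" "E u = E v"
      then have "p (k u) = p (k v)"
        by (simp add: E_def lookup_inject)
      moreover have "inj_on p (carrier L)" "inj_on k (carrier A)"
        using p k by (simp_all add: iso_def bij_betw_def lie)
      ultimately show "u = v"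
        using k_mem uv by (metis inj_onD)
    qed
    moreover have "E u \<in> vecs r" if "u \<in> carrier A" for u
    proof -
      have "p (k u) \<in> carrier (free_Abelian_group {..<r})"
        using p k_mem[OF that] by (auto simp only: iso_def bij_betw_def monoid.simps partial_object.simps)
      then have keys: "Poly_Mapping.keys (p (k u)) \<subseteq> {..<r}"
        by simp
      show ?thesis
        unfolding E_def
      proof (rule vecsI)
        fix i assume "r \<le> i"
        then have "i \<notin> Poly_Mapping.keys (p (k u))"
          using keys by auto
        then show "Poly_Mapping.lookup (p (k u)) i = 0"
          by (simp add: in_keys_iff)
      qed
    qed
    moreover have "E (u \<otimes>\<^bsub>A\<^esub> v) = E u + E v" if "u \<in> carrier A" "v \<in> carrier A" for u v
    proof -
      have "k (u \<otimes>\<^bsub>A\<^esub> v) = k u \<oplus>\<^bsub>L\<^esub> k v"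
        using k that by (simp add: iso_def hom_def lie)
      then have "p (k (u \<otimes>\<^bsub>A\<^esub> v)) = p (k u) + p (k v)"
        using p k_mem that by (simp add: iso_def hom_def)
      then show ?thesis
        by (intro ext) (simp add: E_def lookup_add)
    qed
    ultimately show ?thesis
      by blast
  qed
  then obtain E r where E: "inj_on E (carrier A)" "E ` carrier A \<subseteq> (vecs r :: (nat \<Rightarrow> int) set)"
    "\<And>u v. u \<in> carrier A \<Longrightarrow> v \<in> carrier A \<Longrightarrow> E (u \<otimes>\<^bsub>A\<^esub> v) = E u + E v"
    by blast
  have "\<exists>d (l :: _ \<Rightarrow> nat \<Rightarrow> int). bij_betw l (carrier V) (vecs d) \<and>
      (\<forall>x\<in>carrier V. \<forall>y\<in>carrier V. l (x \<otimes>\<^bsub>V\<^esub> y) = l x + l y)"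
  proof (rule free_of_embedding[OF V.is_group])
    show "E (x \<otimes>\<^bsub>V\<^esub> y, \<one>\<^bsub>K\<^esub>) = E (x, \<one>\<^bsub>K\<^esub>) + E (y, \<one>\<^bsub>K\<^esub>)" if "x \<in> carrier V" "y \<in> carrier V" for x y
      using E(3)[of "(x, \<one>\<^bsub>K\<^esub>)" "(y, \<one>\<^bsub>K\<^esub>)"] that A K.one_closed by simp
    show "inj_on (\<lambda>x. E (x, \<one>\<^bsub>K\<^esub>)) (carrier V)"
      using E(1) A(1) K.one_closed unfolding inj_on_def by blast
    show "(\<lambda>x. E (x, \<one>\<^bsub>K\<^esub>)) ` carrier V \<subseteq> vecs r"
      using E(2) A(1) K.one_closed by blast
  qed
  then obtain d and l :: "'g set \<Rightarrow> nat \<Rightarrow> int" where l: "bij_betw l (carrier V) (vecs d)"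
    "\<And>x y. x \<in> carrier V \<Longrightarrow> y \<in> carrier V \<Longrightarrow> l (x \<otimes>\<^bsub>V\<^esub> y) = l x + l y"
    by blast
  have "\<exists>e (b :: _ \<Rightarrow> nat \<Rightarrow> int). bij_betw b (carrier K) (vecs e) \<and>
      (\<forall>x\<in>carrier K. \<forall>y\<in>carrier K. b (x \<otimes>\<^bsub>K\<^esub> y) = b x + b y)"
  proof (rule free_of_embedding[OF K.is_group])
    show "E (\<one>\<^bsub>V\<^esub>, x \<otimes>\<^bsub>K\<^esub> y) = E (\<one>\<^bsub>V\<^esub>, x) + E (\<one>\<^bsub>V\<^esub>, y)" if "x \<in> carrier K" "y \<in> carrier K" for x y
      using E(3)[of "(\<one>\<^bsub>V\<^esub>, x)" "(\<one>\<^bsub>V\<^esub>, y)"] that A V.one_closed V.l_one[OF V.one_closed] by simp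
    show "inj_on (\<lambda>x. E (\<one>\<^bsub>V\<^esub>, x)) (carrier K)"
      using E(1) A(1) V.one_closed unfolding inj_on_def by blast
    show "(\<lambda>x. E (\<one>\<^bsub>V\<^esub>, x)) ` carrier K \<subseteq> vecs r"
      using E(2) A(1) V.one_closed by blast
  qed
  then obtain e and b :: "'g \<Rightarrow> nat \<Rightarrow> int" where b: "bij_betw b ?Z (vecs e)"
    "\<And>x y. x \<in> ?Z \<Longrightarrow> y \<in> ?Z \<Longrightarrow> b (x \<otimes> y) = b x + b y"
    unfolding K by blast
  define \<pi> where "\<pi> x = l (?Z #> x)" for x
  have carrier_V: "carrier V = (\<lambda>x. ?Z #> x) ` carrier G"
    by (simp add: V_def carrier_FactGroup)
  have proj: "(?Z #> x) \<otimes>\<^bsub>V\<^esub> (?Z #> y) = ?Z #> (x \<otimes> y)" if "x \<in> carrier G" "y \<in> carrier G" for x y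
    using that by (simp add: V_def Z.rcos_sum)
  have l_one: "l ?Z = 0"
    using l(2)[OF V.one_closed V.one_closed] V.l_one[OF V.one_closed] by (simp add: V_def)
  have \<pi>_coset: "\<pi> x = l U" if U: "U \<in> carrier V" "x \<in> U" for x U
  proof -
    obtain y where y: "y \<in> carrier G" "U = ?Z #> y"
      using U(1) unfolding carrier_V by (rule imageE)
    have "U = ?Z #> x"
      unfolding y(2) by (rule repr_independence[OF U(2)[unfolded y(2)] y(1) group_center_subgroup])
    then show ?thesis
      by (simp add: \<pi>_def)
  qed
  have "\<exists>D. base_rank D = d \<and> center_rank D = e \<and> nondegenerate D \<and>
      G \<cong> (twisted_group D :: int vec_pair monoid) \<and>
      (\<forall>x\<in>carrier G. \<forall>y\<in>carrier G. b (group_commutator G x y) = bracket D (\<pi> x) (\<pi> y))"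
  proof (rule class_two_group_twist[OF central _ _ _ b(2,1)])
    show "\<pi> (x \<otimes> y) = \<pi> x + \<pi> y" if "x \<in> carrier G" "y \<in> carrier G" for x y
      unfolding \<pi>_def proj[OF that, symmetric] by (rule l(2)) (simp_all add: carrier_V that)
    show "\<pi> ` carrier G = vecs d"
      using bij_betw_imp_surj_on[OF l(1)] unfolding carrier_V \<pi>_def by (simp add: image_image)
    show "\<pi> x = 0 \<longleftrightarrow> x \<in> ?Z" if x: "x \<in> carrier G" for x
    proof
      assume "\<pi> x = 0"
      then have "l (?Z #> x) = l ?Z"
        by (simp add: \<pi>_def l_one)
      then have "?Z #> x = ?Z"
      proof (rule inj_onD[OF bij_betw_imp_inj_on[OF l(1)]])
        show "?Z #> x \<in> carrier V"
          using x by (simp add: carrier_V)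
        show "?Z \<in> carrier V"
          using V.one_closed by (simp add: V_def)
      qed
      then show "x \<in> ?Z"
        using rcos_self[OF x group_center_subgroup] by simp
    next
      assume "x \<in> ?Z"
      then have "?Z #> x = ?Z"
        by (rule coset_join2[OF x group_center_subgroup])
      then show "\<pi> x = 0"
        by (simp add: \<pi>_def l_one)
    qed
  qed
  then obtain D where D: "base_rank D = d" "center_rank D = e" "nondegenerate D"
    "G \<cong> (twisted_group D :: int vec_pair monoid)"
    "\<And>x y. x \<in> carrier G \<Longrightarrow> y \<in> carrier G \<Longrightarrow> b (group_commutator G x y) = bracket D (\<pi> x) (\<pi> y)"
    by blast
  define k where "k = (\<lambda>(U, z). (l U, b z))"
  have "lie_isomorphic \<Z> (lie_of_group G) (lie_model id D)"
    unfolding lie_isomorphic_iff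
  proof (intro exI[of _ k] conjI ballI)
    show "bij_betw k (carrier (lie_of_group G)) (carrier (lie_model id D))"
      using bij_betw_map_prod[OF l(1) b(1)] by (simp add: lie A K D k_def map_prod_def)
    fix u assume u: "u \<in> carrier (lie_of_group G)"
    obtain U z where Uz: "u = (U, z)" "U \<in> carrier V" "z \<in> ?Z"
      using u by (auto simp: lie A K)
    {
      fix v assume v: "v \<in> carrier (lie_of_group G)"
      obtain W w where Ww: "v = (W, w)" "W \<in> carrier V" "w \<in> ?Z"
        using v by (auto simp: lie A K)
      show "k (u \<oplus>\<^bsub>lie_of_group G\<^esub> v) = k u \<oplus>\<^bsub>lie_model id D\<^esub> k v"
        using Uz Ww by (simp add: lie A K k_def l b)
      obtain x where x: "x \<in> carrier G" "U = ?Z #> x"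
        using Uz(2) unfolding carrier_V by (rule imageE)
      obtain y where y: "y \<in> carrier G" "W = ?Z #> y"
        using Ww(2) unfolding carrier_V by (rule imageE)
      note xy = x y
      have mem: "x \<in> U" "y \<in> W"
        unfolding xy(2,4) using rcos_self[OF _ group_center_subgroup] xy by blast+
      have sub: "U \<subseteq> carrier G" "W \<subseteq> carrier G"
        unfolding xy(2,4) using r_coset_subset_G[OF Z.subset] xy by blast+
      have "group_commutator G x' y' = group_commutator G x y" if "x' \<in> U" "y' \<in> W" for x' y'
      proof (rule inj_onD[OF bij_betw_imp_inj_on[OF b(1)]])
        have "x' \<in> carrier G" "y' \<in> carrier G"
          using that sub by blast+
        then show "b (group_commutator G x' y') = b (group_commutator G x y)" "group_commutator G x' y' \<in> ?Z"
          using D(5) xy mem that Uz(2) Ww(2) by (simp_all add: \<pi>_coset central)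
      qed (use central xy in blast)
      then have "(\<Union>x'\<in>U. \<Union>y'\<in>W. {group_commutator G x' y'}) = (\<Union>x'\<in>U. \<Union>y'\<in>W. {group_commutator G x y})"
        by (intro SUP_cong refl) blast
      also have "\<dots> = {group_commutator G x y}"
        using mem by blast
      finally have "(\<Union>x\<in>U. \<Union>y\<in>W. {group_commutator G x y}) = {group_commutator G x y}" .
      then have "(U, z) \<otimes>\<^bsub>lie_of_group G\<^esub> (W, w) = (\<one>\<^bsub>V\<^esub>, group_commutator G x y)"
        unfolding lie(4) by simp
      then have "k (u \<otimes>\<^bsub>lie_of_group G\<^esub> v) = (l \<one>\<^bsub>V\<^esub>, b (group_commutator G x y))"
        by (simp add: Uz Ww k_def)
      also have "\<dots> = (0, bracket D (l U) (l W))"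
        using D(5)[OF xy(1,3)] l_one \<pi>_coset[OF Uz(2) mem(1)] \<pi>_coset[OF Ww(2) mem(2)]
        by (simp add: V_def)
      finally show "k (u \<otimes>\<^bsub>lie_of_group G\<^esub> v) = k u \<otimes>\<^bsub>lie_model id D\<^esub> k v"
        by (simp add: Uz Ww k_def)
    }
    fix n :: int assume "n \<in> carrier \<Z>"
    have "u \<in> carrier A"
      using u by (simp add: lie)
    have add: "k (v \<otimes>\<^bsub>A\<^esub> w) = k v + k w" if "v \<in> carrier A" "w \<in> carrier A" for v w
      using that by (cases v, cases w) (simp add: A K k_def l b)
    have "fst (k (u [^]\<^bsub>A\<^esub> n)) = vscale n (fst (k u))"
      by (rule int_pow_additive[OF A.is_group, where k = "\<lambda>u. fst (k u)"]) (simp_all add: add \<open>u \<in> carrier A\<close>)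
    moreover have "snd (k (u [^]\<^bsub>A\<^esub> n)) = vscale n (snd (k u))"
      by (rule int_pow_additive[OF A.is_group, where k = "\<lambda>u. snd (k u)"]) (simp_all add: add \<open>u \<in> carrier A\<close>)
    ultimately have "k (u [^]\<^bsub>A\<^esub> n) = (vscale n (fst (k u)), vscale n (snd (k u)))"
      by (simp only: prod_eq_iff fst_conv snd_conv simp_thms)
    then show "k (n \<odot>\<^bsub>lie_of_group G\<^esub> u) = n \<odot>\<^bsub>lie_model id D\<^esub> k u"
      unfolding lie(3) by (cases "k u") (simp only: lie_model_simps fst_conv snd_conv id_apply)
  qed
  with iso have "lie_isomorphic \<Z> L (lie_model id D)"
    by (rule lie_isomorphic_trans)
  with D(3,4) show ?thesis
    by blast
qed

section \<open>The correspondence of subgroups and subalgebras\<close>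

text \<open>The choice depends on the image and the fibre only. These agree for a subgroup and the subalgebra
  obtained from it, so both directions of the correspondence use the same function and are inverse to
  each other.\<close>
definition straightening :: "twist \<Rightarrow> (nat \<Rightarrow> int) set \<Rightarrow> (nat \<Rightarrow> int) set \<Rightarrow> (nat \<Rightarrow> int) \<Rightarrow> nat \<Rightarrow> int"
  where "straightening D W Y = (SOME q. straightens D W Y q)"

definition to_lie :: "twist \<Rightarrow> int vec_pair set \<Rightarrow> int vec_pair set"
  where "to_lie D H = straighten (straightening D (fst ` H) (fibre H)) ` H"

definition of_lie :: "twist \<Rightarrow> int vec_pair set \<Rightarrow> int vec_pair set"
  where "of_lie D M = unstraighten (straightening D (fst ` M) (fibre M)) ` M"

lemma straightens_straightening_subgroup:
  assumes "subgroup H (twisted_group D)"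
  shows "straightens D (fst ` H) (fibre H) (straightening D (fst ` H) (fibre H))"
proof -
  have "\<exists>q. straightens D (fst ` H) (fibre H) q"
    by (rule straightening_exists) (use subgroup_base_fibre[OF assms] in simp_all)
  then show ?thesis
    unfolding straightening_def by (rule someI_ex)
qed

lemma straightens_straightening_lie_subset:
  assumes "lie_subset D M"
  shows "straightens D (fst ` M) (fibre M) (straightening D (fst ` M) (fibre M))"
proof -
  have "\<exists>q. straightens D (fst ` M) (fibre M) q"
    by (rule straightening_exists) (use lie_subset_base_fibre[OF assms] in simp_all)
  then show ?thesis
    unfolding straightening_def by (rule someI_ex)
qed

lemma to_lie_base_fibre:
  assumes "subgroup H (twisted_group D)"
  shows "lie_subset D (to_lie D H)" "fst ` to_lie D H = fst ` H" "fibre (to_lie D H) = fibre H"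
  using lie_subset_straighten[OF assms straightens_straightening_subgroup[OF assms]]
  unfolding to_lie_def fst_straighten_image by simp_all

lemma of_lie_base_fibre:
  assumes "lie_subset D M"
  shows "subgroup (of_lie D M) (twisted_group D)" "fst ` of_lie D M = fst ` M" "fibre (of_lie D M) = fibre M"
  using subgroup_unstraighten[OF assms straightens_straightening_lie_subset[OF assms]]
  unfolding of_lie_def fst_unstraighten_image by simp_all

theorem bij_betw_to_lie:
  "bij_betw (to_lie D) {H. subgroup H (twisted_group D)} {M. lie_subset D M}"
proof (rule bij_betw_byWitness[where f' = "of_lie D"])
  show "\<forall>H\<in>{H. subgroup H (twisted_group D)}. of_lie D (to_lie D H) = H"
  proof
    fix H :: "int vec_pair set" assume "H \<in> {H. subgroup H (twisted_group D)}"
    then have H: "subgroup H (twisted_group D)"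
      by simp
    show "of_lie D (to_lie D H) = H"
      unfolding of_lie_def to_lie_base_fibre[OF H] unfolding to_lie_def by (simp add: image_image)
  qed
  show "\<forall>M\<in>{M. lie_subset D M}. to_lie D (of_lie D M) = M"
  proof
    fix M assume "M \<in> {M. lie_subset D M}"
    then have M: "lie_subset D M"
      by simp
    show "to_lie D (of_lie D M) = M"
      unfolding to_lie_def of_lie_base_fibre[OF M] unfolding of_lie_def by (simp add: image_image)
  qed
qed (use to_lie_base_fibre(1) of_lie_base_fibre(1) in auto)

text \<open>The additive group of the Lie algebra is the twisted group with zero cocycle, so that the formula for
  the index applies to both sides, and it depends only on the image and the fibre.\<close>
lemma index_to_lie:
  assumes H: "subgroup H (twisted_group D)"
  shows "card (a_rcosets\<^bsub>lie_model id D\<^esub> to_lie D H) = card (rcosets\<^bsub>twisted_group D\<^esub> H)"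
proof -
  define D0 where "D0 = Twist (base_rank D) (center_rank D) (\<lambda>_ _ _. 0)"
  have cocycle0: "cocycle D0 x y = 0" for x y :: "nat \<Rightarrow> int"
    by (intro ext) (simp add: cocycle_def D0_def)
  have ranks: "base_rank D0 = base_rank D" "center_rank D0 = center_rank D"
    by (simp_all add: D0_def)
  have mult: "u \<otimes>\<^bsub>twisted_group D0\<^esub> v = u + v" for u v :: "int vec_pair"
    by (cases u, cases v) (simp add: cocycle0)
  let ?M = "to_lie D H"
  note M = to_lie_base_fibre[OF H]
  have sub: "?M \<subseteq> base D \<times> center D" "add_subgroup ?M"
    using M(1) by (simp_all add: lie_subset_def)
  have "subgroup ?M (twisted_group D0)"
  proof (rule subgroup_twisted_groupI)
    show "(0, 0) \<in> ?M"
      using add_subgroup_closed(1)[OF sub(2)] by (simp only: zero_prod_def)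
    show "(a + b, z + w + cocycle D0 a b) \<in> ?M" if "(a, z) \<in> ?M" "(b, w) \<in> ?M" for a z b w
      using add_subgroup_closed(4)[OF sub(2) that] by (simp only: cocycle0 add_Pair add_0_right)
    show "(- a, - z + cocycle D0 a a) \<in> ?M" if "(a, z) \<in> ?M" for a z
      using add_subgroup_closed(3)[OF sub(2) that] by (simp only: cocycle0 uminus_Pair add_0_right)
  qed (use sub(1) ranks in simp)
  then have "card (rcosets\<^bsub>twisted_group D0\<^esub> ?M) = card (pair_reps D0 (fst ` ?M) (fibre ?M))"
    by (rule index_eq_card_pair_reps)
  also have "\<dots> = card (rcosets\<^bsub>twisted_group D\<^esub> H)"
    unfolding index_eq_card_pair_reps[OF H] M(2,3) by (simp add: pair_reps_def ranks)
  finally show ?thesis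
    unfolding A_RCOSETS_def RCOSETS_def r_coset_def by (simp add: mult ranks)
qed

section \<open>Transport to a group and a Lie algebra\<close>

lemma iso_image_subgroup:
  assumes \<theta>: "\<theta> \<in> iso G G'" and G: "group G" "group G'" and H: "subgroup H G"
  shows "subgroup (\<theta> ` H) G'" "card (rcosets\<^bsub>G'\<^esub> (\<theta> ` H)) = card (rcosets\<^bsub>G\<^esub> H)"
    "G\<lparr>carrier := H\<rparr> \<cong> G'\<lparr>carrier := \<theta> ` H\<rparr>"
proof -
  interpret group_hom G G' \<theta>
    using \<theta> G by (simp add: group_hom_def group_hom_axioms_def iso_def)
  have bij: "bij_betw \<theta> (carrier G) (carrier G')"
    using \<theta> by (simp add: iso_def)
  have sub: "H \<subseteq> carrier G"
    by (rule subgroup.subset[OF H])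
  show "subgroup (\<theta> ` H) G'"
    by (rule subgroup_img_is_subgroup[OF H])
  have coset: "\<theta> ` (H #>\<^bsub>G\<^esub> x) = (\<theta> ` H) #>\<^bsub>G'\<^esub> (\<theta> x)" if x: "x \<in> carrier G" for x
  proof -
    have "\<theta> (h \<otimes>\<^bsub>G\<^esub> x) = \<theta> h \<otimes>\<^bsub>G'\<^esub> \<theta> x" if "h \<in> H" for h
      using sub that x by (intro hom_mult) auto
    then show ?thesis
      unfolding r_coset_def by (auto simp: image_UN image_iff)
  qed
  have "(\<lambda>C. \<theta> ` C) ` (rcosets\<^bsub>G\<^esub> H) = rcosets\<^bsub>G'\<^esub> (\<theta> ` H)"
  proof -
    have "(\<lambda>C. \<theta> ` C) ` (rcosets\<^bsub>G\<^esub> H) = (\<lambda>x. (\<theta> ` H) #>\<^bsub>G'\<^esub> (\<theta> x)) ` carrier G"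
      unfolding RCOSETS_def by (auto simp: coset image_iff)
    also have "\<dots> = (\<lambda>y. (\<theta> ` H) #>\<^bsub>G'\<^esub> y) ` carrier G'"
      unfolding bij_betw_imp_surj_on[OF bij, symmetric] by (simp add: image_image)
    finally show ?thesis
      unfolding RCOSETS_def by auto
  qed
  moreover have "inj_on (\<lambda>C. \<theta> ` C) (rcosets\<^bsub>G\<^esub> H)"
  proof (rule inj_on_subset[OF inj_on_image_Pow[OF bij_betw_imp_inj_on[OF bij]]])
    show "rcosets\<^bsub>G\<^esub> H \<subseteq> Pow (carrier G)"
      using G.r_coset_subset_G[OF sub] by (auto simp: RCOSETS_def)
  qed
  ultimately show "card (rcosets\<^bsub>G'\<^esub> (\<theta> ` H)) = card (rcosets\<^bsub>G\<^esub> H)"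
    using card_image by metis
  have "\<theta> \<in> iso (G\<lparr>carrier := H\<rparr>) (G'\<lparr>carrier := \<theta> ` H\<rparr>)"
    unfolding iso_def
  proof (intro CollectI conjI)
    show "\<theta> \<in> hom (G\<lparr>carrier := H\<rparr>) (G'\<lparr>carrier := \<theta> ` H\<rparr>)"
      using sub by (auto simp: hom_def intro!: hom_mult)
    show "bij_betw \<theta> (carrier (G\<lparr>carrier := H\<rparr>)) (carrier (G'\<lparr>carrier := \<theta> ` H\<rparr>))"
      using bij_betw_subset[OF bij sub refl] by simp
  qed
  then show "G\<lparr>carrier := H\<rparr> \<cong> G'\<lparr>carrier := \<theta> ` H\<rparr>"
    by (rule is_isoI)
qed

lemma bij_betw_image_subgroups:
  assumes \<theta>: "\<theta> \<in> iso G G'" and G: "group G" "group G'"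
  shows "bij_betw ((`) \<theta>) {H. subgroup H G} {H. subgroup H G'}"
proof -
  have bij: "bij_betw \<theta> (carrier G) (carrier G')"
    using \<theta> by (simp add: iso_def)
  let ?\<eta> = "inv_into (carrier G) \<theta>"
  have \<eta>: "?\<eta> \<in> iso G' G"
    by (rule group.iso_set_sym[OF G(1) \<theta>])
  show ?thesis
  proof (rule bij_betw_byWitness[where f' = "(`) ?\<eta>"])
    show "\<forall>H\<in>{H. subgroup H G}. ?\<eta> ` \<theta> ` H = H"
      by (intro ballI inv_into_image_cancel bij_betw_imp_inj_on[OF bij]) (auto dest: subgroup.subset)
    show "\<forall>H\<in>{H. subgroup H G'}. \<theta> ` ?\<eta> ` H = H"
      by (intro ballI image_inv_into_cancel[OF bij_betw_imp_surj_on[OF bij]]) (auto dest: subgroup.subset)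
  qed (use iso_image_subgroup(1)[OF \<theta> G] iso_image_subgroup(1)[OF \<eta> G(2,1)] in auto)
qed

lemma lie_model_smult:
  assumes "lie_subset D N" "x \<in> N"
  shows "n \<odot>\<^bsub>lie_model id D\<^esub> x \<in> N"
  using add_subgroup_pair_vscale[of N "fst x" "snd x" n] assms
  by (cases x) (simp add: lie_subset_def)

lemma group_add_monoid_lie_model: "group (add_monoid (lie_model \<zeta> D))"
proof (rule groupI)
  fix x assume x: "x \<in> carrier (add_monoid (lie_model \<zeta> D))"
  then show "\<exists>y\<in>carrier (add_monoid (lie_model \<zeta> D)). y \<otimes>\<^bsub>add_monoid (lie_model \<zeta> D)\<^esub> x = \<one>\<^bsub>add_monoid (lie_model \<zeta> D)\<^esub>"
    by (intro bexI[of _ "- x"]) (auto simp: zero_prod_def)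
next
  show "\<one>\<^bsub>add_monoid (lie_model \<zeta> D)\<^esub> \<in> carrier (add_monoid (lie_model \<zeta> D))"
    by simp
qed (auto simp: add_ac zero_prod_def[symmetric])

lemma subgroup_add_monoid_lie_model:
  "subgroup N (add_monoid (lie_model id D)) \<longleftrightarrow> N \<subseteq> base D \<times> center D \<and> add_subgroup (N :: int vec_pair set)"
proof -
  have G: "group (add_monoid (lie_model id D :: (int, int vec_pair) module))"
    by (rule group_add_monoid_lie_model)
  have inv: "inv\<^bsub>add_monoid (lie_model id D)\<^esub> x = - x" if "x \<in> base D \<times> center D" for x :: "int vec_pair"
    by (rule group.inv_equality[OF G]) (use that in \<open>auto simp: zero_prod_def\<close>)
  show ?thesis
  proof
    assume N: "subgroup N (add_monoid (lie_model id D))"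
    have sub: "N \<subseteq> base D \<times> center D"
      using subgroup.subset[OF N] by simp
    moreover have "add_subgroup N"
      unfolding add_subgroup_def
    proof (intro conjI ballI)
      show "0 \<in> N"
        using subgroup.one_closed[OF N] by (simp add: zero_prod_def)
      fix x y assume xy: "x \<in> N" "y \<in> N"
      then have "- y \<in> N"
        using subgroup.m_inv_closed[OF N xy(2)] inv sub by auto
      then show "x - y \<in> N"
        using subgroup.m_closed[OF N xy(1), of "- y"] by simp
    qed
    ultimately show "N \<subseteq> base D \<times> center D \<and> add_subgroup N" ..
  next
    assume N: "N \<subseteq> base D \<times> center D \<and> add_subgroup N"
    show "subgroup N (add_monoid (lie_model id D))"
    proof (rule group.subgroupI[OF G])
      show "inv\<^bsub>add_monoid (lie_model id D)\<^esub> x \<in> N" if "x \<in> N" for x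
        using that N inv[of x] add_subgroup_closed(3)[of N x] by auto
    qed (use N add_subgroup_closed(1)[of N] add_subgroup_closed(4)[of N] in auto)
  qed
qed

text \<open>The correspondence between \<open>twisted_group D\<close> and \<open>lie_model id D\<close> is carried over by isomorphisms \<open>\<theta>\<close>
  and \<open>l\<close>. The twist \<open>D'\<close> depends on \<open>H\<close> but serves both \<open>H\<close> and its partner.\<close>
theorem subgroup_subalgebra_correspondence:
  fixes L :: "(int, 'a) module" and G :: "'g monoid"
  assumes nd: "nondegenerate D" and G: "group G" "G \<cong> (twisted_group D :: int vec_pair monoid)"
    and L: "lie_algebra \<Z> L" "lie_isomorphic \<Z> L (lie_model id D)"
  shows "\<exists>\<Phi>. bij_betw \<Phi> {H. subgroup H G} {M. lie_subalgebra M \<Z> L} \<and>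
    (\<forall>H. subgroup H G \<longrightarrow> card (a_rcosets\<^bsub>L\<^esub> (\<Phi> H)) = card (rcosets\<^bsub>G\<^esub> H) \<and>
      (card (rcosets\<^bsub>G\<^esub> H) > 0 \<longrightarrow> (\<exists>D'. nondegenerate D' \<and>
        G\<lparr>carrier := H\<rparr> \<cong> (twisted_group D' :: int vec_pair monoid) \<and>
        lie_isomorphic \<Z> (L\<lparr>carrier := \<Phi> H\<rparr>) (lie_model id D'))))"
proof -
  interpret L: lie_algebra \<Z> L by fact
  obtain \<theta> where \<theta>: "\<theta> \<in> iso G (twisted_group D :: int vec_pair monoid)"
    using G(2) by (auto simp: is_iso_def)
  obtain l where l: "l \<in> iso (add_monoid L) (add_monoid (lie_model id D))"
    "\<And>c x. x \<in> carrier L \<Longrightarrow> l (c \<odot>\<^bsub>L\<^esub> x) = c \<odot>\<^bsub>lie_model id D\<^esub> l x"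
    "\<And>x y. x \<in> carrier L \<Longrightarrow> y \<in> carrier L \<Longrightarrow> l (x \<otimes>\<^bsub>L\<^esub> y) = l x \<otimes>\<^bsub>lie_model id D\<^esub> l y"
    using L(2) unfolding lie_isomorphic_def by auto
  have l_bij: "bij_betw l (carrier L) (base D \<times> center D)"
    using l(1) by (simp add: iso_def)
  have l_add: "l (x \<oplus>\<^bsub>L\<^esub> y) = l x + l y" if "x \<in> carrier L" "y \<in> carrier L" for x y
    using l(1) that by (auto simp: iso_def hom_def)
  have GL: "group (add_monoid L)"
    by (rule L.add.is_group)
  have GM: "group (add_monoid (lie_model id D :: (int, int vec_pair) module))"
    by (rule group_add_monoid_lie_model)
  have l_inj: "x = y" if "l x = l y" "x \<in> carrier L" "y \<in> carrier L" for x y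
    using inj_onD[OF bij_betw_imp_inj_on[OF l_bij] that] .
  have subalgebra_iff: "lie_subalgebra M \<Z> L \<longleftrightarrow> lie_subset D (l ` M)" if M: "subgroup M (add_monoid L)" for M
  proof -
    have sub: "M \<subseteq> carrier L"
      using subgroup.subset[OF M] by simp
    have in_M: "x \<in> M \<longleftrightarrow> l x \<in> l ` M" if "x \<in> carrier L" for x
      using inj_on_image_mem_iff[OF bij_betw_imp_inj_on[OF l_bij] that sub] by simp
    have mult: "l (x \<otimes>\<^bsub>L\<^esub> y) = (0, bracket D (fst (l x)) (fst (l y)))" if "x \<in> M" "y \<in> M" for x y
      using that sub l(3)[of x y] by (cases "l x", cases "l y") auto
    have M': "l ` M \<subseteq> base D \<times> center D \<and> add_subgroup (l ` M)"
      by (rule iffD1[OF subgroup_add_monoid_lie_model iso_image_subgroup(1)[OF l(1) GL GM M]])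
    have mult_closed: "(\<forall>x\<in>M. \<forall>y\<in>M. x \<otimes>\<^bsub>L\<^esub> y \<in> M) \<longleftrightarrow>
        (\<forall>x\<in>l ` M. \<forall>y\<in>l ` M. (0, bracket D (fst x) (fst y)) \<in> l ` M)"
    proof -
      have "x \<otimes>\<^bsub>L\<^esub> y \<in> M \<longleftrightarrow> (0, bracket D (fst (l x)) (fst (l y))) \<in> l ` M" if "x \<in> M" "y \<in> M" for x y
        using in_M[of "x \<otimes>\<^bsub>L\<^esub> y"] mult[OF that] that sub L.bracket_closed by auto
      then show ?thesis
        by blast
    qed
    show ?thesis
    proof
      assume "lie_subalgebra M \<Z> L"
      then show "lie_subset D (l ` M)"
        unfolding lie_subalgebra_def lie_subset_def using M' mult_closed by blast
    next
      assume N: "lie_subset D (l ` M)"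
      have "submodule M \<Z> L"
      proof (intro submodule.intro M submodule_axioms.intro)
        fix c :: int and x assume "x \<in> M"
        then have "c \<odot>\<^bsub>lie_model id D\<^esub> l x \<in> l ` M" "x \<in> carrier L"
          using sub by (auto intro!: lie_model_smult[OF N])
        then show "c \<odot>\<^bsub>L\<^esub> x \<in> M"
          using in_M[of "c \<odot>\<^bsub>L\<^esub> x"] l(2) by auto
      qed
      then show "lie_subalgebra M \<Z> L"
        using N mult_closed unfolding lie_subalgebra_def lie_subset_def by blast
    qed
  qed
  have bij_l: "bij_betw ((`) l) {M. lie_subalgebra M \<Z> L} {N. lie_subset D N}"
  proof -
    have "bij_betw ((`) l) {M. subgroup M (add_monoid L)} {N. subgroup N (add_monoid (lie_model id D))}"
      by (rule bij_betw_image_subgroups[OF l(1) GL GM])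
    moreover have "{M. lie_subalgebra M \<Z> L} \<subseteq> {M. subgroup M (add_monoid L)}"
      by (auto simp: lie_subalgebra_def submodule_def)
    moreover have "(`) l ` {M. lie_subalgebra M \<Z> L} = {N. lie_subset D N}"
    proof
      show "(`) l ` {M. lie_subalgebra M \<Z> L} \<subseteq> {N. lie_subset D N}"
        using subalgebra_iff by (auto simp: lie_subalgebra_def submodule_def)
      show "{N. lie_subset D N} \<subseteq> (`) l ` {M. lie_subalgebra M \<Z> L}"
      proof
        fix N assume N: "N \<in> {N. lie_subset D N}"
        then have "N \<in> {N. subgroup N (add_monoid (lie_model id D))}"
          unfolding mem_Collect_eq subgroup_add_monoid_lie_model lie_subset_def by blast
        then have "N \<in> (`) l ` {M. subgroup M (add_monoid L)}"
          unfolding bij_betw_imp_surj_on[OF calculation(1)] .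
        then show "N \<in> (`) l ` {M. lie_subalgebra M \<Z> L}"
          using N subalgebra_iff by blast
      qed
    qed
    ultimately show ?thesis
      by (rule bij_betw_subset)
  qed
  have bij_H: "bij_betw (\<lambda>H. to_lie D (\<theta> ` H)) {H. subgroup H G} {N. lie_subset D N}"
    using bij_betw_trans[OF bij_betw_image_subgroups[OF \<theta> G(1) group_twisted_group] bij_betw_to_lie]
    by (simp add: comp_def)
  define \<Phi> where "\<Phi> H = inv_into {M. lie_subalgebra M \<Z> L} ((`) l) (to_lie D (\<theta> ` H))" for H
  have "bij_betw \<Phi> {H. subgroup H G} {M. lie_subalgebra M \<Z> L}"
    using bij_betw_trans[OF bij_H bij_betw_inv_into[OF bij_l]] unfolding \<Phi>_def[abs_def] comp_def .
  moreover have "card (a_rcosets\<^bsub>L\<^esub> (\<Phi> H)) = card (rcosets\<^bsub>G\<^esub> H) \<and>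
      (card (rcosets\<^bsub>G\<^esub> H) > 0 \<longrightarrow> (\<exists>D'. nondegenerate D' \<and>
        G\<lparr>carrier := H\<rparr> \<cong> (twisted_group D' :: int vec_pair monoid) \<and>
        lie_isomorphic \<Z> (L\<lparr>carrier := \<Phi> H\<rparr>) (lie_model id D')))" if H: "subgroup H G" for H
  proof -
    note H' = iso_image_subgroup[OF \<theta> G(1) group_twisted_group H]
    have \<Phi>: "lie_subalgebra (\<Phi> H) \<Z> L"
      using bij_betwE[OF calculation] H by blast
    have image: "l ` \<Phi> H = to_lie D (\<theta> ` H)"
      unfolding \<Phi>_def
      by (rule f_inv_into_f) (use bij_betw_imp_surj_on[OF bij_l] to_lie_base_fibre(1)[OF H'(1)] in blast)
    have sub: "subgroup (\<Phi> H) (add_monoid L)"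
      using \<Phi> by (simp add: lie_subalgebra_def submodule_def)
    have "card (a_rcosets\<^bsub>L\<^esub> (\<Phi> H)) = card (a_rcosets\<^bsub>lie_model id D\<^esub> (l ` \<Phi> H))"
      unfolding A_RCOSETS_def using iso_image_subgroup(2)[OF l(1) GL GM sub] by simp
    also have "\<dots> = card (rcosets\<^bsub>G\<^esub> H)"
      unfolding image index_to_lie[OF H'(1)] by (rule H'(2))
    finally have index: "card (a_rcosets\<^bsub>L\<^esub> (\<Phi> H)) = card (rcosets\<^bsub>G\<^esub> H)" .
    have "\<exists>D'. nondegenerate D' \<and> G\<lparr>carrier := H\<rparr> \<cong> (twisted_group D' :: int vec_pair monoid) \<and>
        lie_isomorphic \<Z> (L\<lparr>carrier := \<Phi> H\<rparr>) (lie_model id D')" if fin: "card (rcosets\<^bsub>G\<^esub> H) > 0"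
    proof -
      obtain D' \<phi> where D': "nondegenerate D'" "lie_coordinates D (to_lie D (\<theta> ` H)) D' \<phi>"
        "(twisted_group D)\<lparr>carrier := \<theta> ` H\<rparr> \<cong> (twisted_group D' :: int vec_pair monoid)"
        using common_twist[OF nd H'(1) straightens_straightening_subgroup[OF H'(1)]] fin H'(2)
        unfolding to_lie_def by auto
      have \<phi>: "bij_betw \<phi> (l ` \<Phi> H) (base D' \<times> center D')" "additive_on (l ` \<Phi> H) \<phi>"
        "\<And>x y. x \<in> l ` \<Phi> H \<Longrightarrow> y \<in> l ` \<Phi> H \<Longrightarrow>
          \<phi> (0, bracket D (fst x) (fst y)) = (0, bracket D' (fst (\<phi> x)) (fst (\<phi> y)))"
        using D'(2) unfolding lie_coordinates_def image by blast+
      have subset: "\<Phi> H \<subseteq> carrier L"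
        using subgroup.subset[OF sub] by simp
      let ?\<psi> = "\<lambda>x. \<phi> (l x)"
      have closed: "x \<oplus>\<^bsub>L\<^esub> y \<in> \<Phi> H" "c \<odot>\<^bsub>L\<^esub> x \<in> \<Phi> H" if "x \<in> \<Phi> H" "y \<in> \<Phi> H" for x y and c :: int
        using \<Phi> that subgroup.m_closed[OF sub] submodule.smult_closed[of "\<Phi> H" \<Z> L c x]
        by (auto simp: lie_subalgebra_def)
      have \<psi>_add: "?\<psi> (x \<oplus>\<^bsub>L\<^esub> y) = ?\<psi> x + ?\<psi> y" if "x \<in> \<Phi> H" "y \<in> \<Phi> H" for x y
      proof -
        have "l (x \<oplus>\<^bsub>L\<^esub> y) = l x + l y"
          by (rule l_add) (use that subset in auto)
        then show ?thesis
          using \<phi>(2) that by (simp add: additive_on_def)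
      qed
      have smult: "?\<psi> (c \<odot>\<^bsub>L\<^esub> x) = (vscale c (fst (?\<psi> x)), vscale c (snd (?\<psi> x)))" if x: "x \<in> \<Phi> H" for c :: int and x
      proof -
        have N: "add_subgroup (l ` \<Phi> H)"
          using to_lie_base_fibre(1)[OF H'(1)] unfolding image lie_subset_def by blast
        have "l (c \<odot>\<^bsub>L\<^esub> x) = (vscale c (fst (l x)), vscale c (snd (l x)))"
          using l(2)[of x c] x subset by (cases "l x") auto
        then show ?thesis
          using additive_on_pair_vscale[OF \<phi>(2) N, of "fst (l x)" "snd (l x)" c] x by simp
      qed
      have "lie_isomorphic \<Z> (L\<lparr>carrier := \<Phi> H\<rparr>) (lie_model id D')"
        unfolding lie_isomorphic_iff
      proof (intro exI[of _ ?\<psi>] conjI ballI)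
        have "bij_betw l (\<Phi> H) (l ` \<Phi> H)"
          by (rule bij_betw_subset[OF l_bij subset refl])
        from bij_betw_trans[OF this \<phi>(1)]
        show "bij_betw ?\<psi> (carrier (L\<lparr>carrier := \<Phi> H\<rparr>)) (carrier (lie_model id D'))"
          by (simp add: comp_def)
        fix x assume "x \<in> carrier (L\<lparr>carrier := \<Phi> H\<rparr>)"
        then have x: "x \<in> \<Phi> H"
          by simp
        {
          fix y assume "y \<in> carrier (L\<lparr>carrier := \<Phi> H\<rparr>)"
          then have y: "y \<in> \<Phi> H"
            by simp
          show "?\<psi> (x \<oplus>\<^bsub>L\<lparr>carrier := \<Phi> H\<rparr>\<^esub> y) = ?\<psi> x \<oplus>\<^bsub>lie_model id D'\<^esub> ?\<psi> y"
            using \<psi>_add[OF x y] by simp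
          have "l (x \<otimes>\<^bsub>L\<^esub> y) = (0, bracket D (fst (l x)) (fst (l y)))"
            using l(3)[of x y] x y subset by (cases "l x", cases "l y") auto
          then show "?\<psi> (x \<otimes>\<^bsub>L\<lparr>carrier := \<Phi> H\<rparr>\<^esub> y) = ?\<psi> x \<otimes>\<^bsub>lie_model id D'\<^esub> ?\<psi> y"
            using \<phi>(3)[of "l x" "l y"] x y by (cases "?\<psi> x", cases "?\<psi> y") simp
        }
        fix c :: int
        show "?\<psi> (c \<odot>\<^bsub>L\<lparr>carrier := \<Phi> H\<rparr>\<^esub> x) = c \<odot>\<^bsub>lie_model id D'\<^esub> ?\<psi> x"
          using smult[OF x, of c] by (cases "?\<psi> x") simp
      qed
      moreover have "G\<lparr>carrier := H\<rparr> \<cong> (twisted_group D' :: int vec_pair monoid)"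
        by (rule iso_trans[OF H'(3) D'(3)])
      ultimately show ?thesis
        using D'(1) by blast
    qed
    with index show ?thesis
      by blast
  qed
  ultimately show ?thesis
    by blast
qed

section \<open>Congruence subgroups\<close>

lemma twisted_group_base_pow:
  "(a, 0) [^]\<^bsub>twisted_group D\<^esub> n
    = (vscale (of_nat n) a, vscale (of_nat (n choose 2)) (cocycle D a a))" for n :: nat
proof (induction n)
  case (Suc n)
  have "(a, 0) [^]\<^bsub>twisted_group D\<^esub> Suc n
      = (vscale (of_nat n) a + a, vscale (of_nat (n choose 2)) (cocycle D a a) + vscale (of_nat n) (cocycle D a a))"
    by (simp only: nat_pow_Suc Suc.IH twisted_group_simps add_0_right cocycle_scale_left)
  also have "vscale (of_nat n) a + a = vscale (of_nat (Suc n)) a"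
    by (simp add: fun_eq_iff algebra_simps)
  also have "vscale (of_nat (n choose 2)) (cocycle D a a) + vscale (of_nat n) (cocycle D a a)
      = vscale (of_nat (Suc n choose 2)) (cocycle D a a)"
    by (simp add: fun_eq_iff algebra_simps numeral_2_eq_2)
  finally show ?case .
qed (simp add: fun_eq_iff numeral_2_eq_2)

lemma twisted_group_center_pow:
  "(0, z) [^]\<^bsub>twisted_group D\<^esub> n = (0, vscale (of_nat n) z)" for n :: nat
proof (induction n)
  case (Suc n)
  have "(0, z) [^]\<^bsub>twisted_group D\<^esub> Suc n = (0, vscale (of_nat n) z + z)"
    by (simp only: nat_pow_Suc Suc.IH twisted_group_simps add_0_right cocycle_zero)
  also have "vscale (of_nat n) z + z = vscale (of_nat (Suc n)) z"
    by (simp add: fun_eq_iff algebra_simps)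
  finally show ?case .
qed (simp add: fun_eq_iff)

text \<open>With \<open>k\<close> the order of \<open>Q\<close>, powers with exponent \<open>k\<close> are in the kernel. The power of \<open>(a, 0)\<close> with exponent
  \<open>2 * k\<close> is \<open>2 * k\<close> times \<open>a\<close> up to the central term \<open>k * (2 * k - 1)\<close> times \<open>cocycle D a a\<close>, which is
  divisible by \<open>k\<close> and is cancelled by a power of a central element. The exponent \<open>k\<close> itself would not do,
  since \<open>k choose 2\<close> need not be divisible by \<open>k\<close>. So the kernel of every abstract
  homomorphism contains an explicit congruence class, also over the profinite integers.\<close>
lemma multiples_in_kernel:
  fixes a z :: "nat \<Rightarrow> 'r::comm_ring_1"
  assumes \<psi>: "\<psi> \<in> hom (twisted_group D) Q" and Q: "group Q"
    and az: "a \<in> base D" "z \<in> center D"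
  shows "\<psi> (vscale (of_nat (2 * order Q)) a, vscale (of_nat (2 * order Q)) z) = \<one>\<^bsub>Q\<^esub>"
proof -
  let ?G = "twisted_group D :: 'r vec_pair monoid"
  define k where "k = order Q"
  have G: "group ?G"
    by (rule group_twisted_group)
  have pow: "\<psi> (x [^]\<^bsub>?G\<^esub> k) = \<one>\<^bsub>Q\<^esub>" if "x \<in> carrier ?G" for x
  proof -
    have "\<psi> (x [^]\<^bsub>?G\<^esub> k) = \<psi> x [^]\<^bsub>Q\<^esub> k"
      by (rule hom_nat_pow[OF \<psi> that G Q])
    also have "\<dots> = \<one>\<^bsub>Q\<^esub>"
      unfolding k_def by (rule group.pow_order_eq_1[OF Q hom_in_carrier[OF \<psi> that]])
    finally show ?thesis .
  qed
  define m where "m = 2 * k - 1"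
  \<comment> \<open>In the natural numbers \<open>m\<close> is also correct for \<open>k = 0\<close>, where both sides are 0.\<close>
  have choose: "(2 * k) choose 2 = k * m"
    by (simp add: choose_two m_def)
  define \<beta> where "\<beta> = cocycle D a a"
  have \<beta>: "\<beta> \<in> center D"
    by (simp add: \<beta>_def)
  have pow_2k: "\<psi> (vscale (of_nat (2 * k)) a, vscale (of_nat (k * m)) \<beta>) = \<one>\<^bsub>Q\<^esub>"
  proof -
    have "\<psi> (((a, 0) [^]\<^bsub>?G\<^esub> (2::nat)) [^]\<^bsub>?G\<^esub> k) = \<one>\<^bsub>Q\<^esub>"
      using az by (intro pow) (simp add: twisted_group_base_pow)
    moreover have "((a, 0) [^]\<^bsub>?G\<^esub> (2::nat)) [^]\<^bsub>?G\<^esub> k = (a, 0) [^]\<^bsub>?G\<^esub> (2 * k)"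
      using az by (intro monoid.nat_pow_pow group.is_monoid[OF G]) simp
    ultimately show ?thesis
      unfolding twisted_group_base_pow choose \<beta>_def by (simp only:)
  qed
  define v where "v = vscale (of_nat 2) z - vscale (of_nat m) \<beta>"
  have v: "v \<in> center D"
    using az \<beta> by (simp add: v_def)
  have pow_v: "\<psi> (0, vscale (of_nat k) v) = \<one>\<^bsub>Q\<^esub>"
    using pow[of "(0, v)"] v unfolding twisted_group_center_pow by simp
  have split: "(vscale (of_nat (2 * k)) a, vscale (of_nat (2 * k)) z)
      = (vscale (of_nat (2 * k)) a, vscale (of_nat (k * m)) \<beta>) \<otimes>\<^bsub>?G\<^esub> (0, vscale (of_nat k) v)"
    by (simp add: v_def fun_eq_iff algebra_simps)
  have "\<psi> (vscale (of_nat (2 * k)) a, vscale (of_nat (2 * k)) z)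
      = \<psi> (vscale (of_nat (2 * k)) a, vscale (of_nat (k * m)) \<beta>) \<otimes>\<^bsub>Q\<^esub> \<psi> (0, vscale (of_nat k) v)"
    unfolding split using az \<beta> v by (intro hom_mult[OF \<psi>]) simp_all
  also have "\<dots> = \<one>\<^bsub>Q\<^esub>"
    unfolding pow_2k pow_v by (rule monoid.l_one[OF group.is_monoid[OF Q] monoid.one_closed[OF group.is_monoid[OF Q]]])
  finally show ?thesis
    unfolding k_def .
qed

text \<open>Representatives of the classes modulo \<open>n\<close>; the multiplication of the twisted group is compatible with
  them because it is given by integral polynomials.\<close>
definition reduce :: "nat \<Rightarrow> int vec_pair \<Rightarrow> int vec_pair"
  where "reduce n p = ((\<lambda>i. fst p i mod int n), (\<lambda>i. snd p i mod int n))"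

definition residues :: "nat \<Rightarrow> zhat vec_pair \<Rightarrow> int vec_pair"
  where "residues n t = ((\<lambda>i. residue (fst t i) n), (\<lambda>i. residue (snd t i) n))"

lemma residue_sum: "n > 0 \<Longrightarrow> residue (sum f I) n = (\<Sum>i\<in>I. residue (f i) n) mod int n"
  by (induction I rule: infinite_finite_induct) (simp_all add: residue_add mod_simps)

lemma cocycle_mod:
  "cocycle D (\<lambda>i. x i mod int n) (\<lambda>i. y i mod int n) k mod int n = cocycle D x y k mod int n"
proof -
  have "(\<Sum>i<d. \<Sum>j<d. f i j * (x i mod int n) * (y j mod int n)) mod int n
      = (\<Sum>i<d. \<Sum>j<d. f i j * x i * y j) mod int n" for d and f :: "nat \<Rightarrow> nat \<Rightarrow> int"
  proof -
    have summand: "(f i j * (x i mod int n) * (y j mod int n)) mod int n = (f i j * x i * y j) mod int n" for i j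
      by (intro mod_mult_cong) simp_all
    have inner: "(\<Sum>j<d. f i j * (x i mod int n) * (y j mod int n)) mod int n = (\<Sum>j<d. f i j * x i * y j) mod int n" for i
      by (subst (1 2) mod_sum_eq[symmetric]) (simp only: summand)
    show ?thesis
      by (subst (1 2) mod_sum_eq[symmetric]) (simp only: inner)
  qed
  then show ?thesis
    by (simp add: cocycle_def)
qed

lemma residue_cocycle:
  assumes "n > 0"
  shows "residue (cocycle D a b k) n = cocycle D (\<lambda>i. residue (a i) n) (\<lambda>i. residue (b i) n) k mod int n"
proof -
  have "residue (\<Sum>i<d. \<Sum>j<d. of_int (f i j) * a i * b j) n
      = (\<Sum>i<d. \<Sum>j<d. f i j * residue (a i) n * residue (b j) n) mod int n"
    for d and f :: "nat \<Rightarrow> nat \<Rightarrow> int"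
  proof -
    have "residue (of_int (f i j) * a i * b j) n = (f i j * residue (a i) n * residue (b j) n) mod int n" for i j
      using assms by (simp add: residue_mult residue_of_int mod_simps)
    then show ?thesis
      using assms by (simp only: residue_sum mod_sum_eq)
  qed
  then show ?thesis
    by (simp add: cocycle_def)
qed

lemma reduce_mult:
  "reduce n (p \<otimes>\<^bsub>twisted_group D\<^esub> q) = reduce n (reduce n p \<otimes>\<^bsub>twisted_group D\<^esub> reduce n q)"
proof -
  obtain a z b w where pq: "p = (a, z)" "q = (b, w)"
    by (cases p, cases q)
  have "(z k + w k + cocycle D a b k) mod int n
      = (z k mod int n + w k mod int n + cocycle D (\<lambda>i. a i mod int n) (\<lambda>i. b i mod int n) k) mod int n" for k
    by (intro mod_add_cong) (simp_all add: cocycle_mod)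
  moreover have "(a k + b k) mod int n = (a k mod int n + b k mod int n) mod int n" for k
    by (simp add: mod_simps)
  ultimately show ?thesis
    by (simp add: pq reduce_def)
qed

lemma residues_mult:
  assumes "n > 0"
  shows "residues n (t \<otimes>\<^bsub>twisted_group D\<^esub> u) = reduce n (residues n t \<otimes>\<^bsub>twisted_group D\<^esub> residues n u)"
proof -
  obtain a z b w where tu: "t = (a, z)" "u = (b, w)"
    by (cases t, cases u)
  show ?thesis
    using assms by (simp add: tu reduce_def residues_def residue_add residue_cocycle mod_simps)
qed

lemma reduce_residues: "n > 0 \<Longrightarrow> m dvd n \<Longrightarrow> reduce m (residues n t) = residues m t"
  by (simp add: reduce_def residues_def residue_mod_dvd)

lemma reduce_reduce: "m dvd n \<Longrightarrow> reduce m (reduce n p) = reduce m p"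
  by (simp add: reduce_def mod_mod_cancel)

lemma residues_carrier: "t \<in> carrier (twisted_group D) \<Longrightarrow> residues n t \<in> carrier (twisted_group D)"
  by (auto simp: residues_def vecs_def)

lemma residues_eqI:
  assumes "\<And>n. n > 0 \<Longrightarrow> residues n t = residues n u"
  shows "t = u"
proof (rule prod_eqI)
  show "fst t = fst u"
    using assms by (intro ext zhat_eqI) (simp add: residues_def fun_eq_iff)
  show "snd t = snd u"
    using assms by (intro ext zhat_eqI) (simp add: residues_def fun_eq_iff)
qed

lemma exists_residues:
  fixes x :: "nat \<Rightarrow> int vec_pair"
  assumes x: "\<And>n. n > 0 \<Longrightarrow> x n \<in> carrier (twisted_group D)"
    and compat: "\<And>m n. 0 < n \<Longrightarrow> m dvd n \<Longrightarrow> reduce m (x n) = reduce m (x m)"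
  shows "\<exists>t\<in>carrier (twisted_group D). \<forall>n>0. residues n t = reduce n (x n)"
proof -
  define t where "t = ((\<lambda>i. zhat_of (\<lambda>n. fst (x n) i)), (\<lambda>i. zhat_of (\<lambda>n. snd (x n) i)))"
  have fst: "residue (zhat_of (\<lambda>n. fst (x n) i)) n = fst (x n) i mod int n" if "n > 0" for n i
    by (rule residue_zhat_of[OF _ that]) (use compat in \<open>simp add: reduce_def fun_eq_iff\<close>)
  have snd: "residue (zhat_of (\<lambda>n. snd (x n) i)) n = snd (x n) i mod int n" if "n > 0" for n i
    by (rule residue_zhat_of[OF _ that]) (use compat in \<open>simp add: reduce_def fun_eq_iff\<close>)
  have res: "residues n t = reduce n (x n)" if "n > 0" for n
    using that by (simp add: residues_def t_def reduce_def fst snd)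
  have "fst t \<in> base D"
  proof (rule vecsI)
    fix i assume i: "base_rank D \<le> i"
    show "fst t i = 0"
    proof (rule zhat_eqI)
      fix n :: nat assume n: "n > 0"
      have "fst (x n) i = 0"
        using x[OF n] i by (auto simp: vecs_def)
      then show "residue (fst t i) n = residue 0 n"
        by (simp add: t_def fst[OF n])
    qed
  qed
  moreover have "snd t \<in> center D"
  proof (rule vecsI)
    fix i assume i: "center_rank D \<le> i"
    show "snd t i = 0"
    proof (rule zhat_eqI)
      fix n :: nat assume n: "n > 0"
      have "snd (x n) i = 0"
        using x[OF n] i by (auto simp: vecs_def)
      then show "residue (snd t i) n = residue 0 n"
        by (simp add: t_def snd[OF n])
    qed
  qed
  ultimately have "t \<in> carrier (twisted_group D)"
    by (simp add: mem_Times_iff)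
  with res show ?thesis
    by blast
qed

text \<open>This brings two elements of a congruence class into the form required by \<open>multiples_in_kernel\<close>: the
  quotient has both components divisible by \<open>n\<close>.\<close>
lemma residues_eq_imp_differ_by_multiple:
  assumes n: "n > 0" and t: "t \<in> carrier (twisted_group D)" and u: "u \<in> carrier (twisted_group D)"
    and eq: "residues n t = residues n u"
  shows "\<exists>a\<in>base D. \<exists>z\<in>center D. t = u \<otimes>\<^bsub>twisted_group D\<^esub> (vscale (of_nat n) a, vscale (of_nat n) z)"
proof -
  interpret group "twisted_group D :: zhat vec_pair monoid"
    by (rule group_twisted_group)
  define y where "y = inv\<^bsub>twisted_group D\<^esub> u \<otimes>\<^bsub>twisted_group D\<^esub> t"
  have y: "y \<in> carrier (twisted_group D)" "t = u \<otimes>\<^bsub>twisted_group D\<^esub> y"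
    unfolding y_def using t u by (simp_all only: m_closed inv_closed m_assoc[symmetric] r_inv l_one)
  have "residues n y = residues n (inv\<^bsub>twisted_group D\<^esub> u \<otimes>\<^bsub>twisted_group D\<^esub> u)"
    unfolding y_def residues_mult[OF n] eq ..
  also have "\<dots> = residues n \<one>\<^bsub>twisted_group D\<^esub>"
    using u by (simp only: l_inv)
  finally have zero: "residue (fst y i) n = 0" "residue (snd y i) n = 0" for i
    by (simp_all add: residues_def fun_eq_iff)
  have multiple: "\<exists>a\<in>vecs d. v = vscale (of_nat n) a"
    if v: "v \<in> vecs d" "\<And>i. residue (v i) n = 0" for v :: "nat \<Rightarrow> zhat" and d
  proof -
    obtain a where a: "\<And>i. v i = of_nat n * a i"
      using residue_eq_0_imp_multiple[OF n v(2)] by metis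
    define a' where "a' = (\<lambda>i. if i < d then a i else 0)"
    have "v = vscale (of_nat n) a'"
      using v(1) by (intro ext) (auto simp: a'_def vecs_def a[symmetric])
    moreover have "a' \<in> vecs d"
      by (simp add: a'_def vecs_def)
    ultimately show ?thesis
      by blast
  qed
  have "fst y \<in> base D" "snd y \<in> center D"
    using y(1) by (simp_all add: mem_Times_iff)
  then obtain a z where az: "a \<in> base D" "fst y = vscale (of_nat n) a"
      "z \<in> center D" "snd y = vscale (of_nat n) z"
    using multiple zero by metis
  have "y = (vscale (of_nat n) a, vscale (of_nat n) z)"
    by (rule prod_eqI) (simp_all only: az fst_conv snd_conv)
  with az y(2) show ?thesis
    by blast
qed

lemma finite_reduced: "n > 0 \<Longrightarrow> finite (reduce n ` carrier (twisted_group D))"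
proof -
  assume n: "n > 0"
  have fin: "finite {x. \<forall>i. (i \<in> {..<d} \<longrightarrow> x i \<in> {0..<int n}) \<and> (i \<notin> {..<d} \<longrightarrow> x i = 0)}" for d :: nat
    by (rule finite_set_of_finite_funs) auto
  have "reduce n ` carrier (twisted_group D)
      \<subseteq> {x. \<forall>i. (i \<in> {..<base_rank D} \<longrightarrow> x i \<in> {0..<int n}) \<and> (i \<notin> {..<base_rank D} \<longrightarrow> x i = 0)} \<times>
        {x. \<forall>i. (i \<in> {..<center_rank D} \<longrightarrow> x i \<in> {0..<int n}) \<and> (i \<notin> {..<center_rank D} \<longrightarrow> x i = 0)}"
    using n by (auto simp: reduce_def vecs_def)
  then show ?thesis
    by (rule finite_subset) (intro finite_cartesian_product fin)
qed

text \<open>A group with chosen coordinates \<open>\<theta>\<close> in a twisted group over the integers; \<open>\<eta>\<close> below is the inverse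
  of \<open>\<theta>\<close>.\<close>
locale twisted_model = group G for G :: "('g, 'm) monoid_scheme" (structure) +
  fixes D :: twist and \<theta> :: "'g \<Rightarrow> int vec_pair"
  assumes \<theta>: "\<theta> \<in> iso G (twisted_group D)"
begin

definition congruence :: "nat \<Rightarrow> 'g set"
  where "congruence n = {g \<in> carrier G. reduce n (\<theta> g) = (0, 0)}"

lemma \<theta>_bij: "bij_betw \<theta> (carrier G) (carrier (twisted_group D))"
  using \<theta> by (simp add: iso_def)

lemma \<theta>_hom: "x \<in> carrier G \<Longrightarrow> y \<in> carrier G \<Longrightarrow> \<theta> (x \<otimes> y) = \<theta> x \<otimes>\<^bsub>twisted_group D\<^esub> \<theta> y"
  using \<theta> by (simp add: iso_def hom_def)

lemma \<theta>_one: "\<theta> \<one> = (0, 0)"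
proof -
  have "\<theta> \<one> = \<one>\<^bsub>twisted_group D\<^esub>"
    by (rule hom_one[OF _ is_group group_twisted_group]) (use \<theta> in \<open>simp add: iso_def\<close>)
  then show ?thesis
    by simp
qed

definition \<eta> :: "int vec_pair \<Rightarrow> 'g"
  where "\<eta> = inv_into (carrier G) \<theta>"

lemma \<eta>: "p \<in> carrier (twisted_group D) \<Longrightarrow> \<eta> p \<in> carrier G"
  "p \<in> carrier (twisted_group D) \<Longrightarrow> \<theta> (\<eta> p) = p"
  using \<theta>_bij unfolding \<eta>_def bij_betw_def by (metis inv_into_into, metis f_inv_into_f)

lemma \<eta>_iso: "\<eta> \<in> iso (twisted_group D) G"
  unfolding \<eta>_def by (rule iso_set_sym[OF \<theta>])

lemma reduce_\<theta>_cong: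
  assumes "x \<in> carrier G" "x' \<in> carrier G" "y \<in> carrier G" "y' \<in> carrier G"
    and "reduce n (\<theta> x) = reduce n (\<theta> x')" "reduce n (\<theta> y) = reduce n (\<theta> y')"
  shows "reduce n (\<theta> (x \<otimes> y)) = reduce n (\<theta> (x' \<otimes> y'))"
  unfolding \<theta>_hom[OF assms(1,3)] \<theta>_hom[OF assms(2,4)]
  by (subst (1 2) reduce_mult) (simp only: assms(5,6))

lemma reduce_zero: "reduce n (0, 0) = (0, 0)"
  by (simp add: reduce_def zero_fun_def)

lemma congruence_iff: "g \<in> congruence n \<longleftrightarrow> g \<in> carrier G \<and> reduce n (\<theta> g) = reduce n (\<theta> \<one>)"
  by (simp add: congruence_def \<theta>_one reduce_zero)

lemma congruence_subgroup: "subgroup (congruence n) G"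
proof (rule subgroupI)
  show "congruence n \<noteq> {}"
    using congruence_iff one_closed by blast
  show "congruence n \<subseteq> carrier G"
    by (auto simp: congruence_def)
  fix a assume a: "a \<in> congruence n"
  then have ac: "a \<in> carrier G" "reduce n (\<theta> a) = reduce n (\<theta> \<one>)"
    by (simp_all add: congruence_iff)
  have "reduce n (\<theta> (inv a \<otimes> \<one>)) = reduce n (\<theta> (inv a \<otimes> a))"
    by (rule reduce_\<theta>_cong) (use ac in simp_all)
  then show "inv a \<in> congruence n"
    using ac by (simp add: congruence_iff)
  fix b assume "b \<in> congruence n"
  then have bc: "b \<in> carrier G" "reduce n (\<theta> b) = reduce n (\<theta> \<one>)"
    by (simp_all add: congruence_iff)
  have "reduce n (\<theta> (a \<otimes> b)) = reduce n (\<theta> (\<one> \<otimes> \<one>))"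
    by (rule reduce_\<theta>_cong) (use ac bc in simp_all)
  then show "a \<otimes> b \<in> congruence n"
    using ac bc by (simp add: congruence_iff)
qed

lemma congruence_normal: "congruence n \<lhd> G"
proof (rule normal_invI[OF congruence_subgroup])
  fix x h assume x: "x \<in> carrier G" and h: "h \<in> congruence n"
  then have h: "h \<in> carrier G" "reduce n (\<theta> h) = reduce n (\<theta> \<one>)"
    by (simp_all add: congruence_iff)
  have "reduce n (\<theta> (x \<otimes> h)) = reduce n (\<theta> (x \<otimes> \<one>))"
    by (rule reduce_\<theta>_cong) (use x h in simp_all)
  then have "reduce n (\<theta> (x \<otimes> h \<otimes> inv x)) = reduce n (\<theta> (x \<otimes> \<one> \<otimes> inv x))"
    by (intro reduce_\<theta>_cong) (use x h in simp_all)
  then show "x \<otimes> h \<otimes> inv x \<in> congruence n"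
    using x h by (simp add: congruence_iff)
qed

lemma in_congruence_coset_iff:
  assumes "g \<in> carrier G" "h \<in> carrier G"
  shows "h \<in> congruence n #> g \<longleftrightarrow> reduce n (\<theta> h) = reduce n (\<theta> g)"
proof
  assume "h \<in> congruence n #> g"
  then obtain k where k: "k \<in> congruence n" "h = k \<otimes> g"
    by (auto simp: r_coset_def)
  have "reduce n (\<theta> (k \<otimes> g)) = reduce n (\<theta> (\<one> \<otimes> g))"
    by (rule reduce_\<theta>_cong) (use k assms in \<open>simp_all add: congruence_iff\<close>)
  then show "reduce n (\<theta> h) = reduce n (\<theta> g)"
    using assms by (simp add: k)
next
  assume eq: "reduce n (\<theta> h) = reduce n (\<theta> g)"
  have "reduce n (\<theta> (h \<otimes> inv g)) = reduce n (\<theta> (g \<otimes> inv g))"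
    by (rule reduce_\<theta>_cong) (use eq assms in simp_all)
  then have "h \<otimes> inv g \<in> congruence n"
    using assms by (simp add: congruence_iff)
  moreover have "h = h \<otimes> inv g \<otimes> g"
    using assms by (simp add: m_assoc)
  ultimately show "h \<in> congruence n #> g"
    unfolding r_coset_def by blast
qed

lemma congruence_finite_index:
  assumes "n > 0"
  shows "congruence n \<in> finite_index_normals G"
proof -
  define \<rho> where "\<rho> C = reduce n (\<theta> (SOME g. g \<in> C))" for C
  have some: "(SOME h. h \<in> congruence n #> g) \<in> congruence n #> g" if "g \<in> carrier G" for g
    by (rule someI[of _ g]) (use that in \<open>simp add: in_congruence_coset_iff\<close>)
  have sub: "congruence n #> g \<subseteq> carrier G" if "g \<in> carrier G" for g
    by (rule r_coset_subset_G[OF subgroup.subset[OF congruence_subgroup] that])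
  have \<rho>: "\<rho> (congruence n #> g) = reduce n (\<theta> g)" if "g \<in> carrier G" for g
    using in_congruence_coset_iff[OF that] some[OF that] sub[OF that] by (auto simp: \<rho>_def)
  have "\<rho> ` (rcosets (congruence n)) \<subseteq> reduce n ` carrier (twisted_group D)"
  proof
    fix v assume "v \<in> \<rho> ` (rcosets (congruence n))"
    then obtain g where g: "g \<in> carrier G" "v = \<rho> (congruence n #> g)"
      unfolding RCOSETS_def by blast
    have "\<theta> g \<in> carrier (twisted_group D)"
      using bij_betwE[OF \<theta>_bij] g(1) by blast
    then show "v \<in> reduce n ` carrier (twisted_group D)"
      unfolding g(2) \<rho>[OF g(1)] by (rule imageI)
  qed
  moreover have "inj_on \<rho> (rcosets (congruence n))"
  proof (rule inj_onI)
    fix C C' assume C: "C \<in> rcosets (congruence n)" "C' \<in> rcosets (congruence n)" "\<rho> C = \<rho> C'"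
    obtain g g' where g: "g \<in> carrier G" "C = congruence n #> g" "g' \<in> carrier G" "C' = congruence n #> g'"
      using C(1,2) by (auto simp: RCOSETS_def)
    have "g \<in> congruence n #> g'"
      using C(3) g \<rho> by (simp add: in_congruence_coset_iff)
    from repr_independence[OF this g(3) congruence_subgroup] show "C = C'"
      by (simp only: g)
  qed
  ultimately have "finite (rcosets (congruence n))"
    using finite_reduced[OF assms] by (meson inj_on_finite)
  then show ?thesis
    by (simp add: finite_index_normals_def congruence_normal)
qed

text \<open>The quotient by \<open>N\<close> has a finite order \<open>k\<close>, so \<open>multiples_in_kernel\<close> applies to the projection and puts
  the congruence subgroup modulo \<open>2 * k\<close> into \<open>N\<close>.\<close>
lemma congruence_cofinal:
  assumes "N \<in> finite_index_normals G"
  shows "\<exists>n>0. congruence n \<subseteq> N"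
proof -
  interpret N: normal N G
    using assms by (simp add: finite_index_normals_def)
  define k where "k = order (G Mod N)"
  have "finite (rcosets N)"
    using assms by (simp add: finite_index_normals_def)
  moreover have "rcosets N \<noteq> {}"
    by (auto simp: RCOSETS_def)
  ultimately have "k > 0"
    by (simp add: k_def order_def FactGroup_def card_gt_0_iff)
  have hom: "(\<lambda>p. N #> \<eta> p) \<in> hom (twisted_group D) (G Mod N)"
  proof -
    have \<eta>_hom: "\<eta> \<in> hom (twisted_group D) G"
      using \<eta>_iso by (simp add: iso_def)
    show ?thesis
      by (rule homI)
        (simp_all only: hom_mult[OF \<eta>_hom] hom_mult[OF N.r_coset_hom_Mod] hom_in_carrier[OF \<eta>_hom]
          hom_in_carrier[OF N.r_coset_hom_Mod])
  qed
  have "congruence (2 * k) \<subseteq> N"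
  proof
    fix g assume g: "g \<in> congruence (2 * k)"
    then have gc: "g \<in> carrier G"
      by (simp add: congruence_def)
    obtain a z where az: "\<theta> g = (a, z)"
      by (cases "\<theta> g")
    have mem: "a \<in> base D" "z \<in> center D"
      using bij_betwE[OF \<theta>_bij] gc az by force+
    have "a i mod int (2 * k) = 0" "z i mod int (2 * k) = 0" for i
      using g az by (simp_all add: congruence_def reduce_def fun_eq_iff)
    then have div: "vscale (of_nat (2 * k)) (\<lambda>i. a i div int (2 * k)) = a"
      "vscale (of_nat (2 * k)) (\<lambda>i. z i div int (2 * k)) = z"
      by (intro ext; simp add: mod_eq_0_iff_dvd)+
    have "N #> \<eta> (vscale (of_nat (2 * k)) (\<lambda>i. a i div int (2 * k)), vscale (of_nat (2 * k)) (\<lambda>i. z i div int (2 * k))) = \<one>\<^bsub>G Mod N\<^esub>"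
      unfolding k_def
      by (rule multiples_in_kernel[OF hom N.factorgroup_is_group]) (use mem in \<open>simp_all add: vecs_def\<close>)
    then have "N #> \<eta> (\<theta> g) = N"
      unfolding div az by simp
    moreover have "\<eta> (\<theta> g) = g"
      unfolding \<eta>_def by (rule inv_into_f_f[OF bij_betw_imp_inj_on[OF \<theta>_bij] gc])
    ultimately show "g \<in> N"
      using rcos_self[OF gc N.subgroup_axioms] by simp
  qed
  with \<open>k > 0\<close> show ?thesis
    by (intro exI[of _ "2 * k"]) simp
qed

definition level :: "'g set \<Rightarrow> nat"
  where "level N = (SOME n. n > 0 \<and> congruence n \<subseteq> N)"

lemma level: "N \<in> finite_index_normals G \<Longrightarrow> level N > 0"
  "N \<in> finite_index_normals G \<Longrightarrow> congruence (level N) \<subseteq> N"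
  using someI_ex[OF congruence_cofinal[unfolded Bex_def]] unfolding level_def by blast+

text \<open>An element of the twisted group over the profinite integers is approximated modulo \<open>level N\<close> by an
  integral one, whose coset modulo \<open>N\<close> is the coordinate at \<open>N\<close>; any other modulus with congruence
  subgroup in \<open>N\<close> gives the same coset.\<close>
definition to_completion :: "zhat vec_pair \<Rightarrow> 'g set \<Rightarrow> 'g set"
  where "to_completion t = (\<lambda>N\<in>finite_index_normals G. N #> \<eta> (residues (level N) t))"

lemma \<eta>_residues_coset:
  assumes N: "subgroup N G" "congruence n \<subseteq> N"
    and p: "p \<in> carrier (twisted_group D)" "q \<in> carrier (twisted_group D)" "reduce n p = reduce n q"
  shows "N #> \<eta> p = N #> \<eta> q"
proof -
  have "\<eta> p \<in> congruence n #> \<eta> q"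
    using p by (simp only: in_congruence_coset_iff \<eta>)
  then have "\<eta> p \<in> N #> \<eta> q"
    using N(2) unfolding r_coset_def by blast
  then show ?thesis
    using repr_independence[OF _ \<eta>(1)[OF p(2)] N(1)] by simp
qed

lemma to_completion_eq:
  assumes N: "N \<in> finite_index_normals G" and n: "n > 0" "congruence n \<subseteq> N"
    and t: "t \<in> carrier (twisted_group D)"
  shows "to_completion t N = N #> \<eta> (residues n t)"
proof -
  have sub: "subgroup N G"
    using N by (simp add: finite_index_normals_def normal_imp_subgroup)
  let ?m = "level N"
  note m = level[OF N]
  have "N #> \<eta> (residues ?m t) = N #> \<eta> (residues (?m * n) t)"
    by (rule \<eta>_residues_coset[OF sub m(2)])
      (use residues_carrier[OF t] m n in \<open>simp_all only: reduce_residues dvd_triv_left nat_0_less_mult_iff dvd_refl\<close>)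
  also have "\<dots> = N #> \<eta> (residues n t)"
    by (rule \<eta>_residues_coset[OF sub n(2)])
      (use residues_carrier[OF t] m n in \<open>simp_all only: reduce_residues dvd_triv_right nat_0_less_mult_iff dvd_refl\<close>)
  finally show ?thesis
    using N by (simp add: to_completion_def)
qed

end

section \<open>Profinite completions\<close>

lemma profinite_completion_simps:
  "f \<in> carrier (profinite_completion G) \<longleftrightarrow>
    f \<in> (\<Pi>\<^sub>E N \<in> finite_index_normals G. carrier (G Mod N)) \<and>
    (\<forall>N \<in> finite_index_normals G. \<forall>M \<in> finite_index_normals G. N \<subseteq> M \<longrightarrow> f N \<subseteq> f M)"
  "f \<otimes>\<^bsub>profinite_completion G\<^esub> g = (\<lambda>N\<in>finite_index_normals G. f N \<otimes>\<^bsub>G Mod N\<^esub> g N)"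
  "\<one>\<^bsub>profinite_completion G\<^esub> = (\<lambda>N\<in>finite_index_normals G. N)"
  by (simp_all add: profinite_completion_def)

lemma profinite_coordinate_carrier:
  "f \<in> carrier (profinite_completion G) \<Longrightarrow> N \<in> finite_index_normals G \<Longrightarrow> f N \<in> carrier (G Mod N)"
  unfolding profinite_completion_simps by blast

lemma profinite_coordinate_mono:
  "f \<in> carrier (profinite_completion G) \<Longrightarrow> N \<in> finite_index_normals G \<Longrightarrow>
    M \<in> finite_index_normals G \<Longrightarrow> N \<subseteq> M \<Longrightarrow> f N \<subseteq> f M"
  unfolding profinite_completion_simps by blast

context twisted_model
begin

lemma finite_index_normal: "N \<in> finite_index_normals G \<Longrightarrow> N \<lhd> G"
  by (simp add: finite_index_normals_def)

lemma finite_index_subgroup: "N \<in> finite_index_normals G \<Longrightarrow> subgroup N G"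
  by (simp add: finite_index_normals_def normal_imp_subgroup)

lemma \<eta>_residues: "t \<in> carrier (twisted_group D) \<Longrightarrow> \<eta> (residues n t) \<in> carrier G"
  by (rule \<eta>(1)[OF residues_carrier])

lemma to_completion_carrier:
  assumes t: "t \<in> carrier (twisted_group D)"
  shows "to_completion t \<in> carrier (profinite_completion G)"
  unfolding profinite_completion_simps
proof (intro conjI ballI impI)
  show "to_completion t \<in> (\<Pi>\<^sub>E N\<in>finite_index_normals G. carrier (G Mod N))"
    unfolding to_completion_def
    by (rule restrict_PiE_iff[THEN iffD2]) (use \<eta>_residues[OF t] in \<open>simp add: carrier_FactGroup\<close>)
  fix N M assume NM: "N \<in> finite_index_normals G" "M \<in> finite_index_normals G" "N \<subseteq> M"
  have "congruence (level N) \<subseteq> M"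
    using level(2)[OF NM(1)] NM(3) by blast
  then have "to_completion t M = M #> \<eta> (residues (level N) t)"
    by (rule to_completion_eq[OF NM(2) level(1)[OF NM(1)] _ t])
  moreover have "to_completion t N = N #> \<eta> (residues (level N) t)"
    using NM(1) by (simp add: to_completion_def)
  ultimately show "to_completion t N \<subseteq> to_completion t M"
    using NM(3) by (auto simp: r_coset_def)
qed

lemma to_completion_hom: "to_completion \<in> hom (twisted_group D) (profinite_completion G)"
proof (rule homI)
  fix t u :: "zhat vec_pair"
  assume tu: "t \<in> carrier (twisted_group D)" "u \<in> carrier (twisted_group D)"
  interpret T: group "twisted_group D :: zhat vec_pair monoid"
    by (rule group_twisted_group)
  interpret T': group "twisted_group D :: int vec_pair monoid"
    by (rule group_twisted_group)
  have tu': "t \<otimes>\<^bsub>twisted_group D\<^esub> u \<in> carrier (twisted_group D)"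
    using tu by (rule T.m_closed)
  have \<eta>_hom: "\<eta> \<in> hom (twisted_group D) G"
    using \<eta>_iso by (simp add: iso_def)
  have "to_completion (t \<otimes>\<^bsub>twisted_group D\<^esub> u) N = to_completion t N <#> to_completion u N"
    if N: "N \<in> finite_index_normals G" for N
  proof -
    let ?n = "level N"
    interpret N: normal N G
      by (rule finite_index_normal[OF N])
    have "N #> \<eta> (residues ?n (t \<otimes>\<^bsub>twisted_group D\<^esub> u))
        = N #> \<eta> (residues ?n t \<otimes>\<^bsub>twisted_group D\<^esub> residues ?n u)"
    proof (rule \<eta>_residues_coset[OF N.subgroup_axioms level(2)[OF N] residues_carrier[OF tu'] T'.m_closed])
      show "reduce ?n (residues ?n (t \<otimes>\<^bsub>twisted_group D\<^esub> u))
          = reduce ?n (residues ?n t \<otimes>\<^bsub>twisted_group D\<^esub> residues ?n u)"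
        unfolding residues_mult[OF level(1)[OF N]] by (rule reduce_reduce) simp
    qed (use tu residues_carrier in blast)+
    also have "\<dots> = N #> (\<eta> (residues ?n t) \<otimes> \<eta> (residues ?n u))"
      using tu residues_carrier by (simp only: hom_mult[OF \<eta>_hom])
    also have "\<dots> = (N #> \<eta> (residues ?n t)) <#> (N #> \<eta> (residues ?n u))"
      using tu \<eta>_residues by (intro N.rcos_sum[symmetric])
    finally show ?thesis
      using N by (simp add: to_completion_def)
  qed
  then show "to_completion (t \<otimes>\<^bsub>twisted_group D\<^esub> u)
      = to_completion t \<otimes>\<^bsub>profinite_completion G\<^esub> to_completion u"
    unfolding profinite_completion_simps by (auto simp: to_completion_def fun_eq_iff)
qed (rule to_completion_carrier)

lemma to_completion_congruence:
  assumes "n > 0" "t \<in> carrier (twisted_group D)"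
  shows "to_completion t (congruence n) = congruence n #> \<eta> (residues n t)"
  by (rule to_completion_eq[OF congruence_finite_index[OF assms(1)] assms(1) subset_refl assms(2)])

lemma to_completion_congruence_eq_iff:
  assumes "n > 0" "t \<in> carrier (twisted_group D)" "u \<in> carrier (twisted_group D)"
  shows "to_completion t (congruence n) = to_completion u (congruence n) \<longleftrightarrow> residues n t = residues n u"
proof
  assume "to_completion t (congruence n) = to_completion u (congruence n)"
  then have "congruence n #> \<eta> (residues n t) = congruence n #> \<eta> (residues n u)"
    by (simp only: to_completion_congruence[OF assms(1)] assms(2,3))
  moreover have "\<eta> (residues n t) \<in> congruence n #> \<eta> (residues n t)"
    by (rule rcos_self[OF \<eta>_residues[OF assms(2)] congruence_subgroup])
  ultimately have "\<eta> (residues n t) \<in> congruence n #> \<eta> (residues n u)"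
    by simp
  then have "reduce n (\<theta> (\<eta> (residues n t))) = reduce n (\<theta> (\<eta> (residues n u)))"
    using \<eta>_residues assms by (simp only: in_congruence_coset_iff)
  then show "residues n t = residues n u"
    using residues_carrier assms by (simp only: \<eta>(2) reduce_residues dvd_refl)
qed (use assms in \<open>simp only: to_completion_congruence\<close>)

text \<open>A point of the completion is determined by its coordinates at the congruence subgroups, since these are
  cofinal, and these coordinates are a compatible system of residues.\<close>
lemma to_completion_surj:
  assumes f: "f \<in> carrier (profinite_completion G)"
  shows "\<exists>t\<in>carrier (twisted_group D). f = to_completion t"
proof -
  note FI = congruence_finite_index
  have ex: "\<exists>g. g \<in> carrier G \<and> f (congruence n) = congruence n #> g" if n: "n > 0" for n
    using profinite_coordinate_carrier[OF f FI[OF n]] by (auto simp: carrier_FactGroup)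
  define g where "g n = (SOME g. g \<in> carrier G \<and> f (congruence n) = congruence n #> g)" for n
  have g: "g n \<in> carrier G" "f (congruence n) = congruence n #> g n" if "n > 0" for n
    using someI_ex[OF ex[OF that]] unfolding g_def by blast+
  have \<theta>_carrier: "\<theta> x \<in> carrier (twisted_group D)" if "x \<in> carrier G" for x
    using bij_betwE[OF \<theta>_bij] that by blast
  have "\<exists>t\<in>carrier (twisted_group D). \<forall>n>0. residues n t = reduce n (\<theta> (g n))"
  proof (rule exists_residues)
    show "\<theta> (g n) \<in> carrier (twisted_group D)" if "n > 0" for n
      by (rule \<theta>_carrier[OF g(1)[OF that]])
    fix m n :: nat assume n: "0 < n" and mn: "m dvd n"
    have m: "m > 0"
      using n mn by (rule dvd_pos_nat)
    have "congruence n \<subseteq> congruence m"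
    proof
      fix x assume "x \<in> congruence n"
      then have "x \<in> carrier G" "reduce m (reduce n (\<theta> x)) = reduce m (0, 0)"
        by (simp_all add: congruence_def)
      then show "x \<in> congruence m"
        by (simp only: congruence_def reduce_reduce[OF mn] reduce_zero mem_Collect_eq simp_thms)
    qed
    then have "f (congruence n) \<subseteq> f (congruence m)"
      by (rule profinite_coordinate_mono[OF f FI[OF n] FI[OF m]])
    moreover have "g n \<in> f (congruence n)"
      unfolding g(2)[OF n] by (rule rcos_self[OF g(1)[OF n] congruence_subgroup])
    ultimately have "g n \<in> congruence m #> g m"
      using g(2)[OF m] by blast
    then show "reduce m (\<theta> (g n)) = reduce m (\<theta> (g m))"
      using g(1)[OF n] g(1)[OF m] by (simp only: in_congruence_coset_iff)
  qed
  then obtain t where t: "t \<in> carrier (twisted_group D)" "\<And>n. n > 0 \<Longrightarrow> residues n t = reduce n (\<theta> (g n))"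
    by blast
  have "f N = to_completion t N" if N: "N \<in> finite_index_normals G" for N
  proof -
    let ?n = "level N"
    note n = level[OF N]
    have "\<theta> (\<eta> (residues ?n t)) = reduce ?n (\<theta> (g ?n))"
      by (rule trans[OF \<eta>(2)[OF residues_carrier[OF t(1)]] t(2)[OF n(1)]])
    then have "reduce ?n (\<theta> (\<eta> (residues ?n t))) = reduce ?n (reduce ?n (\<theta> (g ?n)))"
      by (rule arg_cong)
    also have "\<dots> = reduce ?n (\<theta> (g ?n))"
      by (rule reduce_reduce) simp
    finally have "\<eta> (residues ?n t) \<in> f (congruence ?n)"
      unfolding g(2)[OF n(1)] using \<eta>_residues[OF t(1)] g(1)[OF n(1)] by (simp only: in_congruence_coset_iff)
    then have mem: "\<eta> (residues ?n t) \<in> f N"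
      using profinite_coordinate_mono[OF f FI[OF n(1)] N n(2)] by blast
    obtain x where x: "x \<in> carrier G" "f N = N #> x"
      using profinite_coordinate_carrier[OF f N] unfolding carrier_FactGroup by blast
    have "f N = N #> \<eta> (residues ?n t)"
      unfolding x(2) by (rule repr_independence[OF mem[unfolded x(2)] x(1) finite_index_subgroup[OF N]])
    then show ?thesis
      using N by (simp add: to_completion_def)
  qed
  moreover have "f \<in> extensional (finite_index_normals G)"
    using f unfolding profinite_completion_simps by (simp add: PiE_def)
  ultimately have "f = to_completion t"
    by (intro extensionalityI[of _ "finite_index_normals G"]) (simp_all add: to_completion_def)
  with t(1) show ?thesis
    by blast
qed

theorem to_completion_iso: "to_completion \<in> iso (twisted_group D) (profinite_completion G)"
  unfolding iso_def
proof (intro CollectI conjI to_completion_hom)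
  show "bij_betw to_completion (carrier (twisted_group D)) (carrier (profinite_completion G))"
    unfolding bij_betw_def
  proof
    show "inj_on to_completion (carrier (twisted_group D))"
    proof (rule inj_onI)
      fix t u :: "zhat vec_pair"
  assume tu: "t \<in> carrier (twisted_group D)" "u \<in> carrier (twisted_group D)"
        "to_completion t = to_completion u"
      show "t = u"
      proof (rule residues_eqI)
        fix n :: nat assume "n > 0"
        then show "residues n t = residues n u"
          using to_completion_congruence_eq_iff[OF _ tu(1,2)] tu(3) by simp
      qed
    qed
    show "to_completion ` carrier (twisted_group D) = carrier (profinite_completion G)"
      using to_completion_carrier to_completion_surj by (intro equalityI subsetI) blast+
  qed
qed

lemma to_completion_one: "to_completion (0, 0) = \<one>\<^bsub>profinite_completion G\<^esub>"
proof -
  have "residues n (0, 0) = (0, 0)" for n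
    by (simp add: residues_def zero_fun_def)
  moreover have "\<eta> (0, 0) = \<one>"
    using inv_into_f_f[OF bij_betw_imp_inj_on[OF \<theta>_bij] one_closed] by (simp add: \<eta>_def \<theta>_one)
  ultimately have "N #> \<eta> (residues (level N) (0, 0)) = N" if "N \<in> finite_index_normals G" for N
    using subgroup.subset[OF finite_index_subgroup[OF that]] by (simp add: coset_mult_one)
  then show ?thesis
    unfolding profinite_completion_simps to_completion_def by (intro restrict_ext)
qed

lemma group_profinite_completion: "group (profinite_completion G)"
proof -
  have "group (profinite_completion G \<lparr>one := to_completion \<one>\<^bsub>twisted_group D\<^esub>\<rparr>)"
    by (rule group.iso_imp_img_group[OF group_twisted_group to_completion_iso])
  then show ?thesis
    by (simp add: to_completion_one)
qed

lemma topspace_profinite: "topspace (profinite_topology G) = carrier (profinite_completion G)"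
proof -
  have "carrier (profinite_completion G) \<subseteq> (\<Pi>\<^sub>E N\<in>finite_index_normals G. carrier (G Mod N))"
    by (rule subsetI) (simp only: profinite_completion_simps(1))
  then show ?thesis
    unfolding profinite_topology_def by (simp add: topspace_product_topology Int_absorb1)
qed

lemma openin_coordinate:
  assumes N: "N \<in> finite_index_normals G" and f0: "f0 \<in> carrier (profinite_completion G)"
  shows "openin (profinite_topology G) {f \<in> carrier (profinite_completion G). f N = f0 N}"
proof -
  have "continuous_map (profinite_topology G) (discrete_topology (carrier (G Mod N))) (\<lambda>f. f N)"
    unfolding profinite_topology_def
    by (rule continuous_map_from_subtopology[OF continuous_map_product_projection[OF N]])
  from openin_continuous_map_preimage[OF this, of "{f0 N}"]
  show ?thesis
    using profinite_coordinate_carrier[OF f0 N] by (simp add: topspace_profinite)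
qed

text \<open>The coordinate of \<open>\<phi> f\<close> at \<open>N\<close> is a homomorphism to a finite group of some order \<open>k\<close>. Two points with the same
  coordinate at the congruence subgroup modulo \<open>2 * k\<close> differ by a vector divisible by \<open>2 * k\<close>, which the
  homomorphism kills. So each coordinate of \<open>\<phi>\<close> is locally constant.\<close>
lemma hom_continuous:
  assumes H: "group H" and \<phi>: "\<phi> \<in> hom (profinite_completion G) (profinite_completion H)"
  shows "continuous_map (profinite_topology G) (profinite_topology H) \<phi>"
proof -
  have coordinate: "continuous_map (profinite_topology G) (discrete_topology (carrier (H Mod N))) (\<lambda>f. \<phi> f N)"
    if N: "N \<in> finite_index_normals H" for N
    unfolding continuous_map_def
  proof (intro conjI allI impI)
    show "(\<lambda>f. \<phi> f N) \<in> topspace (profinite_topology G) \<rightarrow> topspace (discrete_topology (carrier (H Mod N)))"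
      using profinite_coordinate_carrier[OF hom_in_carrier[OF \<phi>] N] by (simp add: topspace_profinite)
    fix U
    interpret N: normal N H
      using N by (simp add: finite_index_normals_def)
    define k where "k = order (H Mod N)"
    have "finite (rcosets\<^bsub>H\<^esub> N)"
      using N by (simp add: finite_index_normals_def)
    moreover have "rcosets\<^bsub>H\<^esub> N \<noteq> {}"
      using subgroup.subgroup_in_rcosets[OF N.subgroup_axioms H] by blast
    ultimately have k: "2 * k > 0"
      by (simp add: k_def order_def FactGroup_def card_gt_0_iff)
    have \<psi>: "(\<lambda>t. \<phi> (to_completion t) N) \<in> hom (twisted_group D) (H Mod N)"
    proof (rule homI)
      fix t u :: "zhat vec_pair"
  assume tu: "t \<in> carrier (twisted_group D)" "u \<in> carrier (twisted_group D)"
      then show "\<phi> (to_completion t) N \<in> carrier (H Mod N)"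
        using profinite_coordinate_carrier[OF hom_in_carrier[OF \<phi>] N] to_completion_carrier by blast
      have "\<phi> (to_completion (t \<otimes>\<^bsub>twisted_group D\<^esub> u))
          = \<phi> (to_completion t) \<otimes>\<^bsub>profinite_completion H\<^esub> \<phi> (to_completion u)"
        using tu to_completion_carrier by (simp only: hom_mult[OF to_completion_hom] hom_mult[OF \<phi>])
      then show "\<phi> (to_completion (t \<otimes>\<^bsub>twisted_group D\<^esub> u)) N
          = \<phi> (to_completion t) N \<otimes>\<^bsub>H Mod N\<^esub> \<phi> (to_completion u) N"
        using N by (simp add: profinite_completion_simps)
    qed
    have const: "\<phi> f N = \<phi> f0 N"
      if f: "f \<in> carrier (profinite_completion G)" "f0 \<in> carrier (profinite_completion G)"
        and eq: "f (congruence (2 * k)) = f0 (congruence (2 * k))" for f f0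
    proof -
      obtain t where t: "t \<in> carrier (twisted_group D)" "f = to_completion t"
        using to_completion_surj[OF f(1)] by blast
      obtain u where u: "u \<in> carrier (twisted_group D)" "f0 = to_completion u"
        using to_completion_surj[OF f(2)] by blast
      have "residues (2 * k) t = residues (2 * k) u"
        using eq to_completion_congruence_eq_iff[OF k t(1) u(1)] t(2) u(2) by simp
      then obtain a z where az: "a \<in> base D" "z \<in> center D"
        "t = u \<otimes>\<^bsub>twisted_group D\<^esub> (vscale (of_nat (2 * k)) a, vscale (of_nat (2 * k)) z)"
        using residues_eq_imp_differ_by_multiple[OF k t(1) u(1)] by blast
      have "\<phi> (to_completion t) N = \<phi> (to_completion u) N \<otimes>\<^bsub>H Mod N\<^esub>
          \<phi> (to_completion (vscale (of_nat (2 * k)) a, vscale (of_nat (2 * k)) z)) N"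
        unfolding az(3) by (rule hom_mult[OF \<psi> u(1)]) (use az in simp)
      also have "\<phi> (to_completion (vscale (of_nat (2 * k)) a, vscale (of_nat (2 * k)) z)) N = \<one>\<^bsub>H Mod N\<^esub>"
        unfolding k_def by (rule multiples_in_kernel[OF \<psi> N.factorgroup_is_group az(1,2)])
      also have "\<phi> (to_completion u) N \<otimes>\<^bsub>H Mod N\<^esub> \<one>\<^bsub>H Mod N\<^esub> = \<phi> (to_completion u) N"
        by (rule monoid.r_one[OF group.is_monoid[OF N.factorgroup_is_group] hom_in_carrier[OF \<psi> u(1)]])
      finally show ?thesis
        by (simp only: t(2) u(2))
    qed
    show "openin (profinite_topology G) {f \<in> topspace (profinite_topology G). \<phi> f N \<in> U}"
    proof (subst openin_subopen, intro ballI)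
      fix f0 assume "f0 \<in> {f \<in> topspace (profinite_topology G). \<phi> f N \<in> U}"
      then have f0: "f0 \<in> carrier (profinite_completion G)" "\<phi> f0 N \<in> U"
        by (simp_all add: topspace_profinite)
      let ?T = "{f \<in> carrier (profinite_completion G). f (congruence (2 * k)) = f0 (congruence (2 * k))}"
      have "openin (profinite_topology G) ?T"
        by (rule openin_coordinate[OF congruence_finite_index[OF k] f0(1)])
      moreover have "f0 \<in> ?T"
        using f0 by simp
      moreover have "?T \<subseteq> {f \<in> topspace (profinite_topology G). \<phi> f N \<in> U}"
      proof
        fix f assume "f \<in> ?T"
        then have "f \<in> carrier (profinite_completion G)" "\<phi> f N = \<phi> f0 N"
          using const[of f f0] f0(1) by simp_all
        then show "f \<in> {f \<in> topspace (profinite_topology G). \<phi> f N \<in> U}"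
          using f0(2) by (simp add: topspace_profinite)
      qed
      ultimately show "\<exists>T. openin (profinite_topology G) T \<and> f0 \<in> T \<and>
          T \<subseteq> {f \<in> topspace (profinite_topology G). \<phi> f N \<in> U}"
        by blast
    qed
  qed
  have mem: "\<phi> f \<in> carrier (profinite_completion H)" if "f \<in> topspace (profinite_topology G)" for f
    using hom_in_carrier[OF \<phi>] that by (simp add: topspace_profinite)
  show ?thesis
    unfolding profinite_topology_def[of H] continuous_map_in_subtopology continuous_map_componentwise
  proof (intro conjI ballI coordinate)
    have "\<phi> f \<in> extensional (finite_index_normals H)" if "f \<in> topspace (profinite_topology G)" for f
      using mem[OF that] unfolding profinite_completion_simps by (simp add: PiE_def)
    then show "\<phi> ` topspace (profinite_topology G) \<subseteq> extensional (finite_index_normals H)"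
      by blast
    show "\<phi> \<in> topspace (profinite_topology G) \<rightarrow> carrier (profinite_completion H)"
      using mem by blast
  qed
qed

end

theorem isomorphic_profinite_completions_iff:
  fixes G :: "'g monoid" and H :: "'h monoid"
  assumes G: "group G" "G \<cong> (twisted_group D :: int vec_pair monoid)"
    and H: "group H" "H \<cong> (twisted_group D' :: int vec_pair monoid)"
  shows "isomorphic_profinite_completions G H \<longleftrightarrow>
    (twisted_group D :: zhat vec_pair monoid) \<cong> (twisted_group D' :: zhat vec_pair monoid)"
proof -
  obtain \<theta> where "\<theta> \<in> iso G (twisted_group D :: int vec_pair monoid)"
    using G(2) by (auto simp: is_iso_def)
  then interpret G: twisted_model G D \<theta>
    by (intro twisted_model.intro G(1) twisted_model_axioms.intro)
  obtain \<theta>' where "\<theta>' \<in> iso H (twisted_group D' :: int vec_pair monoid)"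
    using H(2) by (auto simp: is_iso_def)
  then interpret H: twisted_model H D' \<theta>'
    by (intro twisted_model.intro H(1) twisted_model_axioms.intro)
  have G_iso: "(twisted_group D :: zhat vec_pair monoid) \<cong> profinite_completion G"
    by (rule is_isoI[OF G.to_completion_iso])
  have H_iso: "(twisted_group D' :: zhat vec_pair monoid) \<cong> profinite_completion H"
    by (rule is_isoI[OF H.to_completion_iso])
  note G_iso' = group.iso_sym[OF group_twisted_group G_iso]
  note H_iso' = group.iso_sym[OF group_twisted_group H_iso]
  show ?thesis
  proof
    assume "isomorphic_profinite_completions G H"
    then have "profinite_completion G \<cong> profinite_completion H"
      unfolding isomorphic_profinite_completions_def by (blast intro: is_isoI)
    then show "(twisted_group D :: zhat vec_pair monoid) \<cong> (twisted_group D' :: zhat vec_pair monoid)"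
      by (rule iso_trans[OF iso_trans[OF G_iso] H_iso'])
  next
    assume "(twisted_group D :: zhat vec_pair monoid) \<cong> (twisted_group D' :: zhat vec_pair monoid)"
    then have "profinite_completion G \<cong> profinite_completion H"
      by (rule iso_trans[OF iso_trans[OF G_iso'] H_iso])
    then obtain \<phi> where \<phi>: "\<phi> \<in> iso (profinite_completion G) (profinite_completion H)"
      by (auto simp: is_iso_def)
    define \<phi>' where "\<phi>' = inv_into (carrier (profinite_completion G)) \<phi>"
    have \<phi>': "\<phi>' \<in> iso (profinite_completion H) (profinite_completion G)"
      unfolding \<phi>'_def by (rule group.iso_set_sym[OF G.group_profinite_completion \<phi>])
    have bij: "bij_betw \<phi> (carrier (profinite_completion G)) (carrier (profinite_completion H))"
      using \<phi> by (simp add: iso_def)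
    have "homeomorphic_maps (profinite_topology G) (profinite_topology H) \<phi> \<phi>'"
      unfolding homeomorphic_maps_def G.topspace_profinite H.topspace_profinite
    proof (intro conjI ballI)
      show "continuous_map (profinite_topology G) (profinite_topology H) \<phi>"
        using \<phi> by (intro G.hom_continuous[OF H(1)]) (simp add: iso_def)
      show "continuous_map (profinite_topology H) (profinite_topology G) \<phi>'"
        using \<phi>' by (intro H.hom_continuous[OF G(1)]) (simp add: iso_def)
      show "\<phi>' (\<phi> x) = x" if "x \<in> carrier (profinite_completion G)" for x
        unfolding \<phi>'_def by (rule inv_into_f_f[OF bij_betw_imp_inj_on[OF bij] that])
      show "\<phi> (\<phi>' y) = y" if "y \<in> carrier (profinite_completion H)" for y
        unfolding \<phi>'_def by (rule f_inv_into_f[of _ \<phi>]) (use that bij in \<open>simp add: bij_betw_def\<close>)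
    qed
    then show "isomorphic_profinite_completions G H"
      unfolding isomorphic_profinite_completions_def using \<phi> homeomorphic_maps_imp_map by blast
  qed
qed

section \<open>Extension of scalars to the profinite integers\<close>

lemma mem_ZMod_iff: "x \<in> ZMod m r \<longleftrightarrow> x mod m = r mod m"
proof
  assume "x \<in> ZMod m r"
  then obtain y where "x = y * m + r"
    using rcos_zfact by blast
  then show "x mod m = r mod m"
    by simp
next
  interpret ideal "Idl\<^bsub>\<Z>\<^esub> {m}" \<Z>
    by (rule int.genideal_ideal) simp
  assume "x mod m = r mod m"
  then have "ZMod m x = ZMod m r"
    by (rule zmod_imp_ZMod)
  moreover have "x \<in> ZMod m x"
    unfolding ZMod_def by (rule a_rcos_self) simp
  ultimately show "x \<in> ZMod m r"
    by simp
qed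

lemma carrier_ZFact: "carrier (ZFact m) = range (ZMod m)"
  by (auto simp: ZFact_def FactRing_def A_RCOSETS_def' ZMod_def)

lemma ZMod_add: "ZMod m x \<oplus>\<^bsub>ZFact m\<^esub> ZMod m y = ZMod m (x + y)"
  and ZMod_mult: "ZMod m x \<otimes>\<^bsub>ZFact m\<^esub> ZMod m y = ZMod m (x * y)"
proof -
  interpret ideal "Idl\<^bsub>\<Z>\<^esub> {m}" \<Z>
    by (rule int.genideal_ideal) simp
  show "ZMod m x \<oplus>\<^bsub>ZFact m\<^esub> ZMod m y = ZMod m (x + y)"
    using a_rcos_sum[of x y] by (simp add: ZMod_def ZFact_def FactRing_def)
  show "ZMod m x \<otimes>\<^bsub>ZFact m\<^esub> ZMod m y = ZMod m (x * y)"
    using rcoset_mult_add[of x y] by (simp add: ZMod_def ZFact_def FactRing_def)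
qed

definition profinite_of_zhat :: "zhat \<Rightarrow> nat \<Rightarrow> int set"
  where "profinite_of_zhat x = (\<lambda>n\<in>{0<..}. ZMod (int n) (residue x n))"

lemma bij_profinite_of_zhat: "bij_betw profinite_of_zhat UNIV (carrier profinite_int)"
  unfolding bij_betw_def
proof
  show "inj profinite_of_zhat"
  proof (rule injI)
    fix x y assume eq: "profinite_of_zhat x = profinite_of_zhat y"
    show "x = y"
    proof (rule zhat_eqI)
      fix n :: nat assume "n > 0"
      then have "ZMod (int n) (residue x n) = ZMod (int n) (residue y n)"
        using fun_cong[OF eq, of n] by (simp add: profinite_of_zhat_def)
      then show "residue x n = residue y n"
        using ZMod_imp_zmod[of "int n" "residue x n" "residue y n"] by simp
    qed
  qed
  show "range profinite_of_zhat = carrier profinite_int"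
  proof (intro equalityI subsetI)
    fix f assume "f \<in> range profinite_of_zhat"
    then obtain x where f: "f = profinite_of_zhat x"
      by blast
    have "f n \<subseteq> f m" if mn: "m > 0" "n > 0" "m dvd n" for m n
    proof
      fix y assume "y \<in> f n"
      then have "y mod int n = residue x n"
        using mn by (simp add: f profinite_of_zhat_def mem_ZMod_iff)
      then have "y mod int m = residue x n mod int m"
        using mn(3) by (metis mod_mod_cancel of_nat_dvd_iff)
      then show "y \<in> f m"
        using mn by (simp add: f profinite_of_zhat_def mem_ZMod_iff residue_mod_dvd)
    qed
    then show "f \<in> carrier profinite_int"
      by (auto simp: profinite_int_def f profinite_of_zhat_def carrier_ZFact)
  next
    fix f assume "f \<in> carrier profinite_int"
    then have f: "f \<in> (\<Pi>\<^sub>E n\<in>{0<..}. carrier (ZFact (int n)))"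
      and mono: "\<And>m n. m > 0 \<Longrightarrow> n > 0 \<Longrightarrow> m dvd n \<Longrightarrow> f n \<subseteq> f m"
      by (simp_all add: profinite_int_def)
    have "\<exists>r. f n = ZMod (int n) r" if "n > 0" for n
      using PiE_mem[OF f, of n] that by (auto simp: carrier_ZFact)
    then obtain r where r: "\<And>n. n > 0 \<Longrightarrow> f n = ZMod (int n) (r n)"
      by metis
    have "r n mod int m = r m mod int m" if n: "0 < n" "m dvd n" for m n
    proof -
      have m: "m > 0"
        using n by (rule dvd_pos_nat)
      have "r n \<in> f n"
        using n by (simp add: r mem_ZMod_iff)
      then have "r n \<in> f m"
        using mono[OF m n] by blast
      then show ?thesis
        using m by (simp add: r mem_ZMod_iff)
    qed
    then have res: "residue (zhat_of r) n = r n mod int n" if "n > 0" for n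
      using that by (rule residue_zhat_of)
    have "f n = profinite_of_zhat (zhat_of r) n" if "n > 0" for n
      unfolding r[OF that] using that by (simp add: profinite_of_zhat_def res ZMod_mod[symmetric])
    moreover have "f \<in> extensional {0<..}" "profinite_of_zhat (zhat_of r) \<in> extensional {0<..}"
      using f by (simp_all add: PiE_def profinite_of_zhat_def)
    ultimately have "f = profinite_of_zhat (zhat_of r)"
      by (intro extensionalityI) auto
    then show "f \<in> range profinite_of_zhat"
      by blast
  qed
qed

lemma profinite_of_zhat_add:
  "profinite_of_zhat x \<oplus>\<^bsub>profinite_int\<^esub> profinite_of_zhat y = profinite_of_zhat (x + y)"
proof -
  have "ZMod (int n) (residue x n + residue y n) = ZMod (int n) (residue (x + y) n)" if "n > 0" for n
    using that by (intro zmod_imp_ZMod) (simp add: residue_add)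
  then show ?thesis
    by (auto simp: profinite_int_def profinite_of_zhat_def ZMod_add fun_eq_iff)
qed

lemma profinite_of_zhat_mult:
  "profinite_of_zhat x \<otimes>\<^bsub>profinite_int\<^esub> profinite_of_zhat y = profinite_of_zhat (x * y)"
proof -
  have "ZMod (int n) (residue x n * residue y n) = ZMod (int n) (residue (x * y) n)" if "n > 0" for n
    using that by (intro zmod_imp_ZMod) (simp add: residue_mult)
  then show ?thesis
    by (auto simp: profinite_int_def profinite_of_zhat_def ZMod_mult fun_eq_iff)
qed

definition zhat_of_profinite :: "(nat \<Rightarrow> int set) \<Rightarrow> zhat"
  where "zhat_of_profinite = inv_into UNIV profinite_of_zhat"

lemma zhat_of_profinite_inverse [simp]: "zhat_of_profinite (profinite_of_zhat x) = x"
  unfolding zhat_of_profinite_def using bij_profinite_of_zhat by (simp add: bij_betw_def)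

lemma profinite_of_zhat_inverse: "a \<in> carrier profinite_int \<Longrightarrow> profinite_of_zhat (zhat_of_profinite a) = a"
  unfolding zhat_of_profinite_def using bij_profinite_of_zhat by (simp add: bij_betw_def f_inv_into_f)

lemma profinite_of_zhat_carrier [simp]: "profinite_of_zhat x \<in> carrier profinite_int"
  using bij_betwE[OF bij_profinite_of_zhat] by blast

lemma profinite_int_closed:
  assumes "a \<in> carrier profinite_int" "b \<in> carrier profinite_int"
  shows "a \<oplus>\<^bsub>profinite_int\<^esub> b \<in> carrier profinite_int" "a \<otimes>\<^bsub>profinite_int\<^esub> b \<in> carrier profinite_int"
    "zhat_of_profinite (a \<oplus>\<^bsub>profinite_int\<^esub> b) = zhat_of_profinite a + zhat_of_profinite b"
    "zhat_of_profinite (a \<otimes>\<^bsub>profinite_int\<^esub> b) = zhat_of_profinite a * zhat_of_profinite b"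
  using profinite_of_zhat_add[of "zhat_of_profinite a" "zhat_of_profinite b"]
    profinite_of_zhat_mult[of "zhat_of_profinite a" "zhat_of_profinite b"]
  by (simp_all add: profinite_of_zhat_inverse assms)

definition pair_scale :: "'r::times \<Rightarrow> 'r vec_pair \<Rightarrow> 'r vec_pair"
  where "pair_scale s p = (vscale s (fst p), vscale s (snd p))"

definition of_int_pair :: "int vec_pair \<Rightarrow> 'r::comm_ring_1 vec_pair"
  where "of_int_pair p = ((\<lambda>i. of_int (fst p i)), (\<lambda>i. of_int (snd p i)))"

lemma pair_scale_add: "pair_scale s (p + q) = pair_scale s p + pair_scale s q"
  and pair_scale_add_left: "pair_scale (s + t) p = pair_scale s p + pair_scale t p"
  for s :: "'r::comm_ring_1"
  by (simp_all add: pair_scale_def prod_eq_iff fun_eq_iff algebra_simps)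

lemma of_int_pair_add: "of_int_pair (p + q) = of_int_pair p + of_int_pair q"
  by (simp add: of_int_pair_def prod_eq_iff fun_eq_iff)

lemma of_int_pair_mem: "p \<in> base D \<times> center D \<Longrightarrow> of_int_pair p \<in> base D \<times> center D"
  by (cases p) (simp add: of_int_pair_def vecs_def)

lemma pair_scale_mem: "p \<in> base D \<times> center D \<Longrightarrow> pair_scale s p \<in> base D \<times> center D"
  for s :: "'r::comm_ring_1"
  by (cases p) (simp add: pair_scale_def)

lemma bracket_of_int:
  "bracket D (\<lambda>i. of_int (x i)) (\<lambda>i. of_int (y i)) = (\<lambda>k. of_int (bracket D x y k))"
  by (intro ext) (simp add: bracket_def cocycle_def)

lemma bracket_scale: "bracket D (vscale s x) (vscale t y) = vscale (s * t) (bracket D x y)"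
  by (intro ext) (simp add: bracket_def cocycle_scale_left cocycle_scale_right algebra_simps)

text \<open>A Lie ring with coordinates \<open>l\<close> in the model of a twist. Evaluation \<open>\<tau>\<close> sends a formal sum of pairs \<open>(x, a)\<close>
  to the sum of \<open>a\<close> times the coordinate vectors of \<open>x\<close>; the aim is that its kernel is the subgroup \<open>T\<close>
  generated by the biadditivity relations, so that it identifies the tensor product with the model over
  the profinite integers.\<close>
locale lie_coordinate_map =
  fixes M :: "(int, 'a, 'n) module_scheme" and D :: twist and l :: "'a \<Rightarrow> int vec_pair"
  assumes l_bij: "bij_betw l (carrier M) (base D \<times> center D)"
    and closed: "\<And>x y. x \<in> carrier M \<Longrightarrow> y \<in> carrier M \<Longrightarrow> x \<oplus>\<^bsub>M\<^esub> y \<in> carrier M"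
      "\<And>x y. x \<in> carrier M \<Longrightarrow> y \<in> carrier M \<Longrightarrow> x \<otimes>\<^bsub>M\<^esub> y \<in> carrier M"
    and l_add: "\<And>x y. x \<in> carrier M \<Longrightarrow> y \<in> carrier M \<Longrightarrow> l (x \<oplus>\<^bsub>M\<^esub> y) = l x + l y"
    and l_bracket: "\<And>x y. x \<in> carrier M \<Longrightarrow> y \<in> carrier M \<Longrightarrow>
      l (x \<otimes>\<^bsub>M\<^esub> y) = (0, bracket D (fst (l x)) (fst (l y)))"
begin

abbreviation S :: "(nat \<Rightarrow> int set) ring" where "S \<equiv> profinite_int"
abbreviation \<zeta> :: "(nat \<Rightarrow> int set) \<Rightarrow> zhat" where "\<zeta> \<equiv> zhat_of_profinite"

definition F :: "('a \<times> (nat \<Rightarrow> int set) \<Rightarrow>\<^sub>0 int) monoid"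
  where "F = free_Abelian_group (carrier M \<times> carrier S)"

definition T :: "('a \<times> (nat \<Rightarrow> int set) \<Rightarrow>\<^sub>0 int) set"
  where "T = generate F (tensor_relations M S)"

definition \<tau>0 :: "'a \<times> (nat \<Rightarrow> int set) \<Rightarrow> zhat vec_pair"
  where "\<tau>0 p = pair_scale (\<zeta> (snd p)) (of_int_pair (l (fst p)))"

definition \<tau> :: "('a \<times> (nat \<Rightarrow> int set) \<Rightarrow>\<^sub>0 int) \<Rightarrow> zhat vec_pair"
  where "\<tau> = (SOME h. h \<in> hom F (add_monoid (lie_model \<zeta> D)) \<and>
    (\<forall>x\<in>carrier M \<times> carrier S. h (frag_of x) = \<tau>0 x))"

lemma l_mem: "x \<in> carrier M \<Longrightarrow> l x \<in> base D \<times> center D"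
  using bij_betwE[OF l_bij] by blast

lemma \<tau>0_mem: "p \<in> carrier M \<times> carrier S \<Longrightarrow> \<tau>0 p \<in> base D \<times> center D"
  unfolding \<tau>0_def using l_mem by (intro pair_scale_mem of_int_pair_mem) auto

lemma \<tau>_spec: "\<tau> \<in> hom F (add_monoid (lie_model \<zeta> D))"
  "\<And>p. p \<in> carrier M \<times> carrier S \<Longrightarrow> \<tau> (frag_of p) = \<tau>0 p"
proof -
  have "comm_group (add_monoid (lie_model \<zeta> D))"
    by (rule group.group_comm_groupI[OF group_add_monoid_lie_model]) (simp add: add.commute)
  moreover have "\<tau>0 ` (carrier M \<times> carrier S) \<subseteq> carrier (add_monoid (lie_model \<zeta> D))"
    by (intro image_subsetI) (use \<tau>0_mem in simp)
  ultimately obtain h where "h \<in> hom F (add_monoid (lie_model \<zeta> D))"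
    "\<And>x. x \<in> carrier M \<times> carrier S \<Longrightarrow> h (frag_of x) = \<tau>0 x"
    unfolding F_def using comm_group.free_Abelian_group_universal by blast
  then have "\<exists>h. h \<in> hom F (add_monoid (lie_model \<zeta> D)) \<and> (\<forall>x\<in>carrier M \<times> carrier S. h (frag_of x) = \<tau>0 x)"
    by blast
  then have "\<tau> \<in> hom F (add_monoid (lie_model \<zeta> D)) \<and> (\<forall>x\<in>carrier M \<times> carrier S. \<tau> (frag_of x) = \<tau>0 x)"
    unfolding \<tau>_def by (rule someI_ex)
  then show "\<tau> \<in> hom F (add_monoid (lie_model \<zeta> D))"
    "\<And>p. p \<in> carrier M \<times> carrier S \<Longrightarrow> \<tau> (frag_of p) = \<tau>0 p"
    by blast+
qed

lemma F_group: "group F"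
  by (simp add: F_def)

lemma F_simps: "u \<otimes>\<^bsub>F\<^esub> v = u + v" "\<one>\<^bsub>F\<^esub> = 0"
  by (simp_all add: F_def)

lemma carrier_F: "u \<in> carrier F \<longleftrightarrow> Poly_Mapping.keys u \<subseteq> carrier M \<times> carrier S"
  by (simp add: F_def)

lemma F_add_subgroup: "add_subgroup (carrier F)"
proof -
  have "u - v \<in> carrier F" if "u \<in> carrier F" "v \<in> carrier F" for u v
    using that keys_diff[of u v] unfolding carrier_F by blast
  then show ?thesis
    by (simp add: add_subgroup_def carrier_F)
qed

lemma frag_of_F: "x \<in> carrier M \<Longrightarrow> a \<in> carrier S \<Longrightarrow> frag_of (x, a) \<in> carrier F"
  by (simp add: carrier_F)

lemma \<tau>_mem: "u \<in> carrier F \<Longrightarrow> \<tau> u \<in> base D \<times> center D"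
  using hom_in_carrier[OF \<tau>_spec(1)] by simp

lemma \<tau>_additive: "additive_on (carrier F) \<tau>"
  using \<tau>_spec(1) by (simp add: additive_on_def hom_def F_simps)

lemmas \<tau>_simps = additive_on_simps[OF \<tau>_additive F_add_subgroup]

lemma subgroup_F_iff: "subgroup K F \<longleftrightarrow> K \<subseteq> carrier F \<and> add_subgroup K"
proof -
  have inv: "inv\<^bsub>F\<^esub> u = - u" if "u \<in> carrier F" for u
    using that by (simp add: F_def)
  show ?thesis
  proof
    assume K: "subgroup K F"
    have sub: "K \<subseteq> carrier F"
      by (rule subgroup.subset[OF K])
    have "u - v \<in> K" if "u \<in> K" "v \<in> K" for u v
      using subgroup.m_closed[OF K that(1) subgroup.m_inv_closed[OF K that(2)]] inv[of v] that sub
      by (auto simp: F_simps)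
    then show "K \<subseteq> carrier F \<and> add_subgroup K"
      using sub subgroup.one_closed[OF K] by (simp add: add_subgroup_def F_simps)
  next
    assume K: "K \<subseteq> carrier F \<and> add_subgroup K"
    show "subgroup K F"
    proof (rule group.subgroupI[OF F_group])
      show "K \<noteq> {}"
        using K add_subgroup_closed(1) by blast
      show "inv\<^bsub>F\<^esub> u \<in> K" if "u \<in> K" for u
        using K that inv[of u] add_subgroup_closed(3)[of K u] by auto
      show "u \<otimes>\<^bsub>F\<^esub> v \<in> K" if "u \<in> K" "v \<in> K" for u v
        using K that add_subgroup_closed(4)[of K u v] by (simp add: F_simps)
    qed (use K in blast)
  qed
qed

lemma S_closed: "a \<in> carrier S \<Longrightarrow> b \<in> carrier S \<Longrightarrow> a \<oplus>\<^bsub>S\<^esub> b \<in> carrier S"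
  by (rule profinite_int_closed(1))

lemma relations_F: "tensor_relations M S \<subseteq> carrier F"
proof
  fix u assume "u \<in> tensor_relations M S"
  then show "u \<in> carrier F"
    unfolding tensor_relations_def
    by (auto intro!: add_subgroup_closed(2)[OF F_add_subgroup] frag_of_F closed S_closed)
qed

lemma T_subgroup: "subgroup T F"
  unfolding T_def by (rule group.generate_is_subgroup[OF F_group relations_F])

lemma T_add: "add_subgroup T" "T \<subseteq> carrier F"
  using T_subgroup by (simp_all add: subgroup_F_iff)

lemma T_relations:
  "x \<in> carrier M \<Longrightarrow> y \<in> carrier M \<Longrightarrow> a \<in> carrier S \<Longrightarrow>
    frag_of (x \<oplus>\<^bsub>M\<^esub> y, a) - frag_of (x, a) - frag_of (y, a) \<in> T"
  "x \<in> carrier M \<Longrightarrow> a \<in> carrier S \<Longrightarrow> b \<in> carrier S \<Longrightarrow>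
    frag_of (x, a \<oplus>\<^bsub>S\<^esub> b) - frag_of (x, a) - frag_of (x, b) \<in> T"
proof -
  have incl: "u \<in> T" if "u \<in> tensor_relations M S" for u
    unfolding T_def using that by (rule generate.incl)
  show "frag_of (x \<oplus>\<^bsub>M\<^esub> y, a) - frag_of (x, a) - frag_of (y, a) \<in> T"
    if "x \<in> carrier M" "y \<in> carrier M" "a \<in> carrier S"
    using that by (intro incl) (auto simp: tensor_relations_def)
  show "frag_of (x, a \<oplus>\<^bsub>S\<^esub> b) - frag_of (x, a) - frag_of (x, b) \<in> T"
    if "x \<in> carrier M" "a \<in> carrier S" "b \<in> carrier S"
    using that by (intro incl) (auto simp: tensor_relations_def)
qed

lemma \<tau>_frag: "x \<in> carrier M \<Longrightarrow> a \<in> carrier S \<Longrightarrow> \<tau> (frag_of (x, a)) = pair_scale (\<zeta> a) (of_int_pair (l x))"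
  by (simp add: \<tau>_spec(2) \<tau>0_def)

lemma T_kernel: "u \<in> T \<Longrightarrow> \<tau> u = 0"
proof -
  have "add_subgroup {u \<in> carrier F. \<tau> u = 0}"
    using add_subgroup_closed[OF F_add_subgroup] \<tau>_simps unfolding add_subgroup_def by auto
  then have "subgroup {u \<in> carrier F. \<tau> u = 0} F"
    by (simp add: subgroup_F_iff)
  moreover have "tensor_relations M S \<subseteq> {u \<in> carrier F. \<tau> u = 0}"
  proof
    fix u assume u: "u \<in> tensor_relations M S"
    have "\<tau> (frag_of (x \<oplus>\<^bsub>M\<^esub> y, a) - frag_of (x, a) - frag_of (y, a)) = 0"
      if "x \<in> carrier M" "y \<in> carrier M" "a \<in> carrier S" for x y a
      using that by (simp add: \<tau>_simps add_subgroup_closed[OF F_add_subgroup] frag_of_F closed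
          \<tau>_frag l_add of_int_pair_add pair_scale_add)
    moreover have "\<tau> (frag_of (x, a \<oplus>\<^bsub>S\<^esub> b) - frag_of (x, a) - frag_of (x, b)) = 0"
      if "x \<in> carrier M" "a \<in> carrier S" "b \<in> carrier S" for x a b
      using that by (simp add: \<tau>_simps add_subgroup_closed[OF F_add_subgroup] frag_of_F S_closed
          \<tau>_frag profinite_int_closed(3) pair_scale_add_left)
    ultimately have "\<tau> u = 0"
      using u unfolding tensor_relations_def by auto
    then show "u \<in> {u \<in> carrier F. \<tau> u = 0}"
      using u relations_F by blast
  qed
  ultimately have "T \<subseteq> {u \<in> carrier F. \<tau> u = 0}"
    unfolding T_def by (intro group.generate_subgroup_incl[OF F_group])
  then show "u \<in> T \<Longrightarrow> \<tau> u = 0"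
    by blast
qed

definition basis_elem :: "int vec_pair \<Rightarrow> 'a"
  where "basis_elem = inv_into (carrier M) l"

lemma basis_elem: "p \<in> base D \<times> center D \<Longrightarrow> basis_elem p \<in> carrier M"
  "p \<in> base D \<times> center D \<Longrightarrow> l (basis_elem p) = p"
  using l_bij unfolding basis_elem_def bij_betw_def by (metis inv_into_into, metis f_inv_into_f)

lemma basis_elem_l: "x \<in> carrier M \<Longrightarrow> basis_elem (l x) = x"
  unfolding basis_elem_def by (rule inv_into_f_f[OF bij_betw_imp_inj_on[OF l_bij]])

text \<open>A section of \<open>\<tau>\<close> that expands a vector in the basis of unit vectors.\<close>
definition \<kappa> :: "zhat vec_pair \<Rightarrow> 'a \<times> (nat \<Rightarrow> int set) \<Rightarrow>\<^sub>0 int"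
  where "\<kappa> p =
    (\<Sum>i<base_rank D. frag_of (basis_elem (unit_vec i, 0), profinite_of_zhat (fst p i))) +
    (\<Sum>k<center_rank D. frag_of (basis_elem (0, unit_vec k), profinite_of_zhat (snd p k)))"

lemma \<kappa>_terms: "i < base_rank D \<Longrightarrow> basis_elem (unit_vec i, 0) \<in> carrier M"
  "k < center_rank D \<Longrightarrow> basis_elem (0, unit_vec k) \<in> carrier M"
  by (rule basis_elem(1); simp)+

lemma \<kappa>_F: "\<kappa> p \<in> carrier F"
  unfolding \<kappa>_def
  by (intro add_subgroup_closed(4)[OF F_add_subgroup] add_subgroup_sum[OF F_add_subgroup] frag_of_F \<kappa>_terms)
    simp_all

lemma \<tau>_sum: "(\<And>i. i < n \<Longrightarrow> f i \<in> carrier F) \<Longrightarrow> \<tau> (\<Sum>i<n. f i) = (\<Sum>i<n. \<tau> (f i))" for n :: nat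
proof (induction n)
  case 0
  show ?case
    unfolding lessThan_0 sum.empty by (rule \<tau>_simps(1))
next
  case (Suc n)
  have "(\<Sum>i<n. f i) \<in> carrier F"
    by (rule add_subgroup_sum[OF F_add_subgroup]) (use Suc.prems in simp)
  then show ?case
    unfolding sum.lessThan_Suc using Suc by (simp only: \<tau>_simps(4) lessI less_SucI)
qed

lemma \<tau>_\<kappa>: 
  assumes p: "p \<in> base D \<times> center D"
  shows "\<tau> (\<kappa> p) = p"
proof -
  have base: "\<tau> (\<Sum>i<base_rank D. frag_of (basis_elem (unit_vec i, 0), profinite_of_zhat (fst p i)))
      = (\<Sum>i<base_rank D. pair_scale (fst p i) (of_int_pair (unit_vec i, 0)))"
    by (subst \<tau>_sum) (simp_all add: frag_of_F \<kappa>_terms \<tau>_frag basis_elem(2))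
  have center: "\<tau> (\<Sum>k<center_rank D. frag_of (basis_elem (0, unit_vec k), profinite_of_zhat (snd p k)))
      = (\<Sum>k<center_rank D. pair_scale (snd p k) (of_int_pair (0, unit_vec k)))"
    by (subst \<tau>_sum) (simp_all add: frag_of_F \<kappa>_terms \<tau>_frag basis_elem(2))
  have unit: "of_int_pair (unit_vec i, 0) = (unit_vec i, 0 :: nat \<Rightarrow> zhat)"
    "of_int_pair (0, unit_vec i) = (0 :: nat \<Rightarrow> zhat, unit_vec i)" for i
    by (simp_all add: of_int_pair_def unit_vec_def fun_eq_iff)
  have zero: "vscale s 0 = (0 :: nat \<Rightarrow> zhat)" for s
    by (simp add: fun_eq_iff)
  have "\<tau> (\<kappa> p) = (\<Sum>i<base_rank D. pair_scale (fst p i) (of_int_pair (unit_vec i, 0)))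
      + (\<Sum>k<center_rank D. pair_scale (snd p k) (of_int_pair (0, unit_vec k)))"
    unfolding \<kappa>_def base[symmetric] center[symmetric]
    by (rule \<tau>_simps(4))
      (auto intro!: add_subgroup_sum[OF F_add_subgroup] frag_of_F \<kappa>_terms)
  also have "\<dots> = (fst p, 0) + (0, snd p)"
    unfolding unit pair_scale_def fst_conv snd_conv zero sum_prod sum.neutral_const
    using p by (simp only: unit_vec_expansion mem_Times_iff)
  also have "\<dots> = p"
    by simp
  finally show ?thesis .
qed

end

context lie_coordinate_map
begin

lemma T_zero_scalar:
  assumes "x \<in> carrier M"
  shows "frag_of (x, profinite_of_zhat 0) \<in> T"
proof -
  let ?o = "profinite_of_zhat 0"
  have "frag_of (x, ?o \<oplus>\<^bsub>S\<^esub> ?o) - frag_of (x, ?o) - frag_of (x, ?o) \<in> T"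
    by (rule T_relations(2)) (use assms in simp_all)
  then have "- frag_of (x, ?o) \<in> T"
    by (simp add: profinite_of_zhat_add)
  from add_subgroup_closed(3)[OF T_add(1) this] show ?thesis
    by simp
qed

lemma \<kappa>_add: "\<kappa> (p + q) - \<kappa> p - \<kappa> q \<in> T"
proof -
  have rel: "frag_of (x, profinite_of_zhat (s + t)) - frag_of (x, profinite_of_zhat s)
      - frag_of (x, profinite_of_zhat t) \<in> T" if "x \<in> carrier M" for x s t
    using T_relations(2)[OF that, of "profinite_of_zhat s" "profinite_of_zhat t"]
    by (simp add: profinite_of_zhat_add)
  have "\<kappa> (p + q) - \<kappa> p - \<kappa> q =
      (\<Sum>i<base_rank D. frag_of (basis_elem (unit_vec i, 0), profinite_of_zhat (fst p i + fst q i))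
        - frag_of (basis_elem (unit_vec i, 0), profinite_of_zhat (fst p i))
        - frag_of (basis_elem (unit_vec i, 0), profinite_of_zhat (fst q i))) +
      (\<Sum>k<center_rank D. frag_of (basis_elem (0, unit_vec k), profinite_of_zhat (snd p k + snd q k))
        - frag_of (basis_elem (0, unit_vec k), profinite_of_zhat (snd p k))
        - frag_of (basis_elem (0, unit_vec k), profinite_of_zhat (snd q k)))"
    by (simp add: \<kappa>_def sum_subtractf)
  also have "\<dots> \<in> T"
    by (intro add_subgroup_closed(4)[OF T_add(1)] add_subgroup_sum[OF T_add(1)] rel \<kappa>_terms) simp_all
  finally show ?thesis .
qed

lemma \<kappa>_zero: "\<kappa> 0 \<in> T"
  using add_subgroup_closed(3)[OF T_add(1) \<kappa>_add[of 0 0]] by simp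

lemma sum_minus_term_in_T:
  fixes d :: nat
  assumes "i < d" "\<And>j. j < d \<Longrightarrow> j \<noteq> i \<Longrightarrow> f j \<in> T"
  shows "(\<Sum>j<d. f j) - f i \<in> T"
proof -
  have "(\<Sum>j<d. f j) - f i = (\<Sum>j\<in>{..<d} - {i}. f j)"
    using assms(1) by (simp add: sum.remove[of "{..<d}" i])
  also have "\<dots> \<in> T"
    by (rule add_subgroup_sum[OF T_add(1)]) (use assms(2) in auto)
  finally show ?thesis .
qed

text \<open>For fixed \<open>a\<close>, the coordinate vectors \<open>p\<close> for which the pair of the corresponding element with \<open>a\<close> equals its
  expansion modulo \<open>T\<close> form a subgroup \<open>R\<close>. It contains the unit vectors, whose expansions have only one
  term with a nonzero scalar, and hence everything.\<close>
lemma frag_of_eq_\<kappa>: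
  assumes x: "x \<in> carrier M" and a: "a \<in> carrier S"
  shows "frag_of (x, a) - \<kappa> (\<tau>0 (x, a)) \<in> T"
proof -
  let ?B = "base D \<times> center D :: int vec_pair set"
  note T = add_subgroup_closed[OF T_add(1)]
  define img where "img p = pair_scale (\<zeta> a) (of_int_pair p)" for p
  define R where "R = {p \<in> ?B. frag_of (basis_elem p, a) - \<kappa> (img p) \<in> T}"
  have B_diff: "p - q \<in> ?B" if "p \<in> ?B" "q \<in> ?B" for p q
    using that by (cases p, cases q) simp
  have img_add: "img (p + q) = img p + img q" for p q
    by (simp add: img_def of_int_pair_add pair_scale_add)
  have elem_add: "basis_elem (p + q) = basis_elem p \<oplus>\<^bsub>M\<^esub> basis_elem q" if "p \<in> ?B" "q \<in> ?B" for p q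
    using basis_elem_l[OF closed(1)[OF basis_elem(1)[OF that(1)] basis_elem(1)[OF that(2)]]]
    by (simp only: l_add basis_elem that)
  have rel: "frag_of (basis_elem (p + q), a) - frag_of (basis_elem p, a) - frag_of (basis_elem q, a) \<in> T"
    if "p \<in> ?B" "q \<in> ?B" for p q
    unfolding elem_add[OF that] by (rule T_relations(1)) (use basis_elem(1) that a in blast)+
  have zero_B: "0 \<in> ?B"
    by (simp add: zero_prod_def)
  have R: "add_subgroup R"
    unfolding add_subgroup_def
  proof (intro conjI ballI)
    have "- frag_of (basis_elem 0, a) \<in> T"
      using rel[OF zero_B zero_B] by simp
    then have "frag_of (basis_elem 0, a) \<in> T"
      using T(3) by fastforce
    moreover have "img 0 = 0"
      using img_add[of 0 0] by simp
    ultimately show "0 \<in> R"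
      using \<kappa>_zero zero_B T(2) by (simp add: R_def)
    fix p q assume "p \<in> R" "q \<in> R"
    then have pq: "p \<in> ?B" "q \<in> ?B" "frag_of (basis_elem p, a) - \<kappa> (img p) \<in> T"
      "frag_of (basis_elem q, a) - \<kappa> (img q) \<in> T"
      by (simp_all add: R_def)
    define r where "r = p - q"
    have r: "r \<in> ?B" "p = r + q"
      using B_diff[OF pq(1,2)] by (simp_all add: r_def)
    have "frag_of (basis_elem r, a) - \<kappa> (img r) =
        (frag_of (basis_elem p, a) - \<kappa> (img p)) - (frag_of (basis_elem q, a) - \<kappa> (img q))
        - (frag_of (basis_elem p, a) - frag_of (basis_elem r, a) - frag_of (basis_elem q, a))
        + (\<kappa> (img p) - \<kappa> (img r) - \<kappa> (img q))"
      by simp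
    also have "\<dots> \<in> T"
      by (rule T(4)[OF T(2)[OF T(2)[OF pq(3,4)] rel[OF r(1) pq(2), folded r(2)]]
            \<kappa>_add[of "img r" "img q", folded img_add r(2)]])
    finally show "p - q \<in> R"
      using r(1) by (simp add: R_def r_def)
  qed
  have unit_base: "(unit_vec i, 0) \<in> R" if i: "i < base_rank D" for i
  proof -
    let ?f = "\<lambda>j. frag_of (basis_elem (unit_vec j, 0), profinite_of_zhat (fst (img (unit_vec i, 0)) j))"
    let ?g = "\<lambda>k. frag_of (basis_elem (0, unit_vec k), profinite_of_zhat (snd (img (unit_vec i, 0)) k))"
    have coords: "fst (img (unit_vec i, 0)) j = (if j = i then \<zeta> a else 0)" "snd (img (unit_vec i, 0)) k = 0" for j k
      by (simp_all add: img_def pair_scale_def of_int_pair_def unit_vec_def)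
    have "(\<Sum>j<base_rank D. ?f j) - ?f i \<in> T"
      by (rule sum_minus_term_in_T[OF i]) (simp add: coords T_zero_scalar \<kappa>_terms)
    moreover have "(\<Sum>k<center_rank D. ?g k) \<in> T"
      by (rule add_subgroup_sum[OF T_add(1)]) (simp add: coords T_zero_scalar \<kappa>_terms)
    ultimately have "- (((\<Sum>j<base_rank D. ?f j) - ?f i) + (\<Sum>k<center_rank D. ?g k)) \<in> T"
      by (intro T(3,4))
    moreover have fi: "?f i = frag_of (basis_elem (unit_vec i, 0), a)"
      by (simp add: coords profinite_of_zhat_inverse a)
    have "frag_of (basis_elem (unit_vec i, 0), a) - \<kappa> (img (unit_vec i, 0))
        = - (((\<Sum>j<base_rank D. ?f j) - ?f i) + (\<Sum>k<center_rank D. ?g k))"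
      unfolding \<kappa>_def fi by simp
    ultimately have "frag_of (basis_elem (unit_vec i, 0), a) - \<kappa> (img (unit_vec i, 0)) \<in> T"
      by (simp only:)
    with i show ?thesis
      by (simp add: R_def)
  qed
  have unit_center: "(0, unit_vec i) \<in> R" if i: "i < center_rank D" for i
  proof -
    let ?f = "\<lambda>j. frag_of (basis_elem (unit_vec j, 0), profinite_of_zhat (fst (img (0, unit_vec i)) j))"
    let ?g = "\<lambda>k. frag_of (basis_elem (0, unit_vec k), profinite_of_zhat (snd (img (0, unit_vec i)) k))"
    have coords: "snd (img (0, unit_vec i)) j = (if j = i then \<zeta> a else 0)" "fst (img (0, unit_vec i)) k = 0" for j k
      by (simp_all add: img_def pair_scale_def of_int_pair_def unit_vec_def)
    have "(\<Sum>k<center_rank D. ?g k) - ?g i \<in> T"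
      by (rule sum_minus_term_in_T[OF i]) (simp add: coords T_zero_scalar \<kappa>_terms)
    moreover have "(\<Sum>j<base_rank D. ?f j) \<in> T"
      by (rule add_subgroup_sum[OF T_add(1)]) (simp add: coords T_zero_scalar \<kappa>_terms)
    ultimately have "- ((\<Sum>j<base_rank D. ?f j) + ((\<Sum>k<center_rank D. ?g k) - ?g i)) \<in> T"
      by (intro T(3,4))
    moreover have gi: "?g i = frag_of (basis_elem (0, unit_vec i), a)"
      by (simp add: coords profinite_of_zhat_inverse a)
    have "frag_of (basis_elem (0, unit_vec i), a) - \<kappa> (img (0, unit_vec i))
        = - ((\<Sum>j<base_rank D. ?f j) + ((\<Sum>k<center_rank D. ?g k) - ?g i))"
      unfolding \<kappa>_def gi by simp
    ultimately have "frag_of (basis_elem (0, unit_vec i), a) - \<kappa> (img (0, unit_vec i)) \<in> T"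
      by (simp only:)
    with i show ?thesis
      by (simp add: R_def)
  qed
  have full: "(v, w) \<in> R" if v: "v \<in> base D" and w: "w \<in> center D" for v w
  proof -
    have "add_subgroup {v. (v, 0) \<in> R}" "add_subgroup {w. (0, w) \<in> R}"
      using add_subgroup_closed(1)[OF R] add_subgroup_closed(2)[OF R]
      by (auto simp: add_subgroup_def zero_prod_def dest: add_subgroup_closed(2)[OF R])
    then have "(\<Sum>i<base_rank D. vscale (v i) (unit_vec i)) \<in> {v. (v, 0) \<in> R}"
      "(\<Sum>i<center_rank D. vscale (w i) (unit_vec i)) \<in> {w. (0, w) \<in> R}"
      using unit_base unit_center by (intro add_subgroup_sum add_subgroup_vscale; simp)+
    then have "(v, 0) \<in> R" "(0, w) \<in> R"
      unfolding unit_vec_expansion[OF v] unit_vec_expansion[OF w] by simp_all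
    from add_subgroup_closed(4)[OF R this] show ?thesis
      by simp
  qed
  have "l x \<in> R"
    using full l_mem[OF x] by (cases "l x") simp
  then show ?thesis
    by (simp add: R_def img_def \<tau>0_def basis_elem_l[OF x])
qed

text \<open>Every formal sum equals, modulo the relations, the expansion of its value. Therefore a sum with value 0
  is a consequence of the relations.\<close>
lemma eq_\<kappa>_\<tau>: "u \<in> carrier F \<Longrightarrow> u - \<kappa> (\<tau> u) \<in> T"
  unfolding carrier_F
proof (induction u rule: free_Abelian_group_induct[consumes 1])
  case 1
  show ?case
    using add_subgroup_closed(3)[OF T_add(1) \<kappa>_zero] \<tau>_simps(1) by simp
next
  case (2 u v)
  then have F: "u \<in> carrier F" "v \<in> carrier F"
    by (simp_all add: carrier_F)
  have "(u - v) - \<kappa> (\<tau> u - \<tau> v) = (u - \<kappa> (\<tau> u)) - (v - \<kappa> (\<tau> v))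
      + (\<kappa> ((\<tau> u - \<tau> v) + \<tau> v) - \<kappa> (\<tau> u - \<tau> v) - \<kappa> (\<tau> v))"
    by simp
  also have "\<dots> \<in> T"
    by (intro add_subgroup_closed(4)[OF T_add(1)] add_subgroup_closed(2)[OF T_add(1) 2(3,4)] \<kappa>_add)
  finally show ?case
    by (simp only: \<tau>_simps(3)[OF F])
next
  case (3 p)
  then show ?case
    using frag_of_eq_\<kappa>[of "fst p" "snd p"] by (simp add: \<tau>_spec(2) mem_Times_iff)
qed

lemma T_eq_kernel: "u \<in> T \<longleftrightarrow> u \<in> carrier F \<and> \<tau> u = 0"
proof
  assume "u \<in> carrier F \<and> \<tau> u = 0"
  then have "(u - \<kappa> 0) + \<kappa> 0 \<in> T"
    using eq_\<kappa>_\<tau>[of u] \<kappa>_zero by (intro add_subgroup_closed(4)[OF T_add(1)]) simp_all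
  then show "u \<in> T"
    by simp
qed (use T_kernel T_add(2) in blast)

text \<open>The coset of \<open>T\<close> in which \<open>\<tau>\<close> takes the value \<open>p\<close>: the element of the tensor product with coordinate
  vector \<open>p\<close>.\<close>
definition fib :: "zhat vec_pair \<Rightarrow> ('a \<times> (nat \<Rightarrow> int set) \<Rightarrow>\<^sub>0 int) set"
  where "fib p = {v \<in> carrier F. \<tau> v = p}"

lemma coset_eq_fib: "u \<in> carrier F \<Longrightarrow> T #>\<^bsub>F\<^esub> u = fib (\<tau> u)"
proof -
  assume u: "u \<in> carrier F"
  show "T #>\<^bsub>F\<^esub> u = fib (\<tau> u)"
  proof (intro equalityI subsetI)
    fix v assume "v \<in> T #>\<^bsub>F\<^esub> u"
    then obtain t where t: "t \<in> T" "v = t + u"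
      by (auto simp: r_coset_def F_simps)
    then have "t \<in> carrier F" "\<tau> t = 0"
      by (simp_all add: T_eq_kernel)
    then show "v \<in> fib (\<tau> u)"
      using u add_subgroup_closed(4)[OF F_add_subgroup] by (simp add: fib_def t(2) \<tau>_simps)
  next
    fix v assume "v \<in> fib (\<tau> u)"
    then have v: "v \<in> carrier F" "\<tau> v = \<tau> u"
      by (simp_all add: fib_def)
    then have "v - u \<in> T"
      using u add_subgroup_closed(2)[OF F_add_subgroup] by (simp add: T_eq_kernel \<tau>_simps)
    then show "v \<in> T #>\<^bsub>F\<^esub> u"
      unfolding r_coset_def F_simps by (auto intro!: bexI[of _ "v - u"])
  qed
qed

abbreviation tensor :: "(nat \<Rightarrow> int set, ('a \<times> (nat \<Rightarrow> int set) \<Rightarrow>\<^sub>0 int) set) module"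
  where "tensor \<equiv> lie_tensor M S"

abbreviation lie_bilinear
  where "lie_bilinear u v \<equiv>
    frag_extend (\<lambda>(x, a). frag_extend (\<lambda>(y, b). frag_of (x \<otimes>\<^bsub>M\<^esub> y, a \<otimes>\<^bsub>S\<^esub> b)) v) u"

abbreviation scalar_map
  where "scalar_map c u \<equiv> frag_extend (\<lambda>(x, a). frag_of (x, c \<otimes>\<^bsub>S\<^esub> a)) u"

lemma tensor_simps:
  "carrier tensor = carrier (F Mod T)"
  "U \<otimes>\<^bsub>tensor\<^esub> V = (\<Union>u\<in>U. \<Union>v\<in>V. T #>\<^bsub>F\<^esub> lie_bilinear u v)"
  "U \<oplus>\<^bsub>tensor\<^esub> V = U \<otimes>\<^bsub>F Mod T\<^esub> V"
  "c \<odot>\<^bsub>tensor\<^esub> U = (\<Union>u\<in>U. T #>\<^bsub>F\<^esub> scalar_map c u)"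
  by (simp_all add: lie_tensor_def Let_def F_def[symmetric] T_def[symmetric])

lemma carrier_tensor: "carrier tensor = fib ` (base D \<times> center D)"
proof -
  have "carrier tensor = (\<lambda>u. fib (\<tau> u)) ` carrier F"
    unfolding tensor_simps carrier_FactGroup by (intro image_cong refl coset_eq_fib)
  also have "\<dots> = fib ` (base D \<times> center D)"
  proof (intro equalityI subsetI)
    show "U \<in> fib ` (base D \<times> center D)" if "U \<in> (\<lambda>u. fib (\<tau> u)) ` carrier F" for U
      using that \<tau>_mem by blast
    fix U assume "U \<in> fib ` (base D \<times> center D)"
    then obtain p where p: "p \<in> base D \<times> center D" "U = fib p"
      by blast
    have "U = fib (\<tau> (\<kappa> p))"
      by (simp only: p(2) \<tau>_\<kappa>[OF p(1)])
    then show "U \<in> (\<lambda>u. fib (\<tau> u)) ` carrier F"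
      using \<kappa>_F by blast
  qed
  finally show ?thesis .
qed

lemma fib_nonempty: "p \<in> base D \<times> center D \<Longrightarrow> \<kappa> p \<in> fib p"
  by (simp only: fib_def mem_Collect_eq \<kappa>_F \<tau>_\<kappa> simp_thms)

lemma fib_add:
  assumes "p \<in> base D \<times> center D" "q \<in> base D \<times> center D"
  shows "fib p \<oplus>\<^bsub>tensor\<^esub> fib q = fib (p + q)"
proof -
  have "comm_group F"
    unfolding F_def by (rule abelian_free_Abelian_group)
  then interpret T: normal T F
    using T_subgroup by (simp add: comm_group.normal_iff_subgroup)
  have "fib p = T #>\<^bsub>F\<^esub> \<kappa> p" "fib q = T #>\<^bsub>F\<^esub> \<kappa> q"
    using coset_eq_fib[OF \<kappa>_F] \<tau>_\<kappa> assms by simp_all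
  then have "fib p \<oplus>\<^bsub>tensor\<^esub> fib q = T #>\<^bsub>F\<^esub> (\<kappa> p + \<kappa> q)"
    using T.rcos_sum[OF \<kappa>_F \<kappa>_F] by (simp add: tensor_simps F_simps)
  also have "\<dots> = fib (\<tau> (\<kappa> p + \<kappa> q))"
    by (rule coset_eq_fib[OF add_subgroup_closed(4)[OF F_add_subgroup \<kappa>_F \<kappa>_F]])
  also have "\<tau> (\<kappa> p + \<kappa> q) = p + q"
    using assms by (simp only: \<tau>_simps(4)[OF \<kappa>_F \<kappa>_F] \<tau>_\<kappa>)
  finally show ?thesis .
qed

lemma scalar_map:
  assumes c: "c \<in> carrier S" and u: "u \<in> carrier F"
  shows "scalar_map c u \<in> carrier F \<and> \<tau> (scalar_map c u) = pair_scale (\<zeta> c) (\<tau> u)"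
  using u unfolding carrier_F[of u]
proof (induction u rule: free_Abelian_group_induct[consumes 1])
  case 1
  show ?case
    using add_subgroup_closed(1)[OF F_add_subgroup] \<tau>_simps(1)
    by (simp add: pair_scale_def zero_prod_def vscale_def zero_fun_def)
next
  case (2 u v)
  then have F: "u \<in> carrier F" "v \<in> carrier F"
    by (simp_all add: carrier_F)
  have "pair_scale (\<zeta> c) (\<tau> u) - pair_scale (\<zeta> c) (\<tau> v) = pair_scale (\<zeta> c) (\<tau> u - \<tau> v)"
    by (simp add: pair_scale_def prod_eq_iff fun_eq_iff algebra_simps)
  then show ?case
    using 2 F add_subgroup_closed(2)[OF F_add_subgroup] by (simp only: frag_extend_diff \<tau>_simps simp_thms)
next
  case (3 p)
  obtain x a where p: "p = (x, a)" "x \<in> carrier M" "a \<in> carrier S"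
    using 3 by (cases p) auto
  have "pair_scale (s * t) r = pair_scale s (pair_scale t r)" for s t :: zhat and r
    by (simp add: pair_scale_def fun_eq_iff mult.assoc)
  then show ?case
    using c p profinite_int_closed[OF c p(3)] by (simp add: frag_of_F \<tau>_frag)
qed

lemma lie_bilinear:
  assumes u: "u \<in> carrier F" and v: "v \<in> carrier F"
  shows "lie_bilinear u v \<in> carrier F \<and> \<tau> (lie_bilinear u v) = (0, bracket D (fst (\<tau> u)) (fst (\<tau> v)))"
  using u unfolding carrier_F[of u]
proof (induction u rule: free_Abelian_group_induct[consumes 1])
  case 1
  show ?case
    unfolding frag_extend_0 \<tau>_simps(1) fst_zero bracket_zero
    using add_subgroup_closed(1)[OF F_add_subgroup] by (simp only: zero_prod_def simp_thms)
next
  case (2 u u')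
  then have F: "u \<in> carrier F" "u' \<in> carrier F"
    by (simp_all add: carrier_F)
  have "bracket D (fst (\<tau> u - \<tau> u')) w = bracket D (fst (\<tau> u)) w - bracket D (fst (\<tau> u')) w" for w
    using bracket_add_left[of D "fst (\<tau> u - \<tau> u')" "fst (\<tau> u')" w] by simp
  then show ?case
    using 2 F add_subgroup_closed(2)[OF F_add_subgroup]
    by (simp only: frag_extend_diff \<tau>_simps simp_thms diff_Pair diff_zero)
next
  case (3 p)
  obtain x a where p: "p = (x, a)" "x \<in> carrier M" "a \<in> carrier S"
    using 3 by (cases p) auto
  let ?B = "\<lambda>v. frag_extend (\<lambda>(y, b). frag_of (x \<otimes>\<^bsub>M\<^esub> y, a \<otimes>\<^bsub>S\<^esub> b)) v"
  have "?B v \<in> carrier F \<and> \<tau> (?B v) = (0, bracket D (fst (\<tau> (frag_of (x, a)))) (fst (\<tau> v)))"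
    using v unfolding carrier_F[of v]
  proof (induction v rule: free_Abelian_group_induct[consumes 1])
    case 1
    show ?case
      unfolding frag_extend_0 \<tau>_simps(1) fst_zero bracket_zero
      using add_subgroup_closed(1)[OF F_add_subgroup] by (simp only: zero_prod_def simp_thms)
  next
    case (2 v v')
    then have F: "v \<in> carrier F" "v' \<in> carrier F"
      by (simp_all add: carrier_F)
    have "bracket D w (fst (\<tau> v - \<tau> v')) = bracket D w (fst (\<tau> v)) - bracket D w (fst (\<tau> v'))" for w
      using bracket_add_right[of D w "fst (\<tau> v - \<tau> v')" "fst (\<tau> v')"] by simp
    then show ?case
      using 2 F add_subgroup_closed(2)[OF F_add_subgroup]
      by (simp only: frag_extend_diff \<tau>_simps simp_thms diff_Pair diff_zero)
  next
    case (3 q)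
    obtain y b where q: "q = (y, b)" "y \<in> carrier M" "b \<in> carrier S"
      using 3 by (cases q) auto
    have xy: "x \<otimes>\<^bsub>M\<^esub> y \<in> carrier M" and ab: "a \<otimes>\<^bsub>S\<^esub> b \<in> carrier S"
      "\<zeta> (a \<otimes>\<^bsub>S\<^esub> b) = \<zeta> a * \<zeta> b"
      using closed(2)[OF p(2) q(2)] profinite_int_closed[OF p(3) q(3)] by simp_all
    have "\<tau> (frag_of (x \<otimes>\<^bsub>M\<^esub> y, a \<otimes>\<^bsub>S\<^esub> b))
        = pair_scale (\<zeta> a * \<zeta> b) (of_int_pair (0, bracket D (fst (l x)) (fst (l y))))"
      by (simp only: \<tau>_frag[OF xy ab(1)] ab(2) l_bracket[OF p(2) q(2)])
    also have "\<dots> = (0, vscale (\<zeta> a * \<zeta> b) (bracket D (\<lambda>i. of_int (fst (l x) i)) (\<lambda>i. of_int (fst (l y) i))))"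
      by (simp add: pair_scale_def of_int_pair_def bracket_of_int fun_eq_iff)
    also have "\<dots> = (0, bracket D (fst (\<tau> (frag_of (x, a)))) (fst (\<tau> (frag_of (y, b)))))"
      by (simp only: \<tau>_frag[OF p(2,3)] \<tau>_frag[OF q(2,3)] pair_scale_def of_int_pair_def fst_conv bracket_scale)
    finally show ?case
      by (simp only: q(1) frag_extend_of prod.case frag_of_F[OF xy ab(1)] simp_thms)
  qed
  then show ?case
    by (simp only: p(1) frag_extend_of prod.case)
qed

lemma fib_bracket:
  assumes "p \<in> base D \<times> center D" "q \<in> base D \<times> center D"
  shows "fib p \<otimes>\<^bsub>tensor\<^esub> fib q = fib (0, bracket D (fst p) (fst q))"
proof -
  have "T #>\<^bsub>F\<^esub> lie_bilinear u v = fib (0, bracket D (fst p) (fst q))" if "u \<in> fib p" "v \<in> fib q" for u v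
  proof -
    have uv: "u \<in> carrier F" "\<tau> u = p" "v \<in> carrier F" "\<tau> v = q"
      using that by (simp_all add: fib_def)
    show ?thesis
      using lie_bilinear[OF uv(1,3)] coset_eq_fib[of "lie_bilinear u v"] uv(2,4) by simp
  qed
  then have "fib p \<otimes>\<^bsub>tensor\<^esub> fib q = (\<Union>u\<in>fib p. \<Union>v\<in>fib q. fib (0, bracket D (fst p) (fst q)))"
    unfolding tensor_simps by (intro SUP_cong refl)
  also have "\<dots> = fib (0, bracket D (fst p) (fst q))"
    using fib_nonempty[OF assms(1)] fib_nonempty[OF assms(2)] by blast
  finally show ?thesis .
qed

lemma fib_smult:
  assumes "c \<in> carrier S" "p \<in> base D \<times> center D"
  shows "c \<odot>\<^bsub>tensor\<^esub> fib p = fib (pair_scale (\<zeta> c) p)"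
proof -
  have "T #>\<^bsub>F\<^esub> scalar_map c u = fib (pair_scale (\<zeta> c) p)" if "u \<in> fib p" for u
  proof -
    have u: "u \<in> carrier F" "\<tau> u = p"
      using that by (simp_all add: fib_def)
    show ?thesis
      using scalar_map[OF assms(1) u(1)] coset_eq_fib[of "scalar_map c u"] u(2) by simp
  qed
  then have "c \<odot>\<^bsub>tensor\<^esub> fib p = (\<Union>u\<in>fib p. fib (pair_scale (\<zeta> c) p))"
    unfolding tensor_simps by (intro SUP_cong refl)
  also have "\<dots> = fib (pair_scale (\<zeta> c) p)"
    using fib_nonempty[OF assms(2)] by blast
  finally show ?thesis .
qed

lemma lie_model_closed: "lie_closed R (lie_model \<xi> D)"
  unfolding lie_closed_def
proof (intro conjI ballI)
  fix x y assume xy: "x \<in> carrier (lie_model \<xi> D)" "y \<in> carrier (lie_model \<xi> D)"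
  show "x \<oplus>\<^bsub>lie_model \<xi> D\<^esub> y \<in> carrier (lie_model \<xi> D)"
    "x \<otimes>\<^bsub>lie_model \<xi> D\<^esub> y \<in> carrier (lie_model \<xi> D)"
    using xy by (simp_all add: lie_model_def mem_Times_iff case_prod_beta)
next
  fix c x assume "x \<in> carrier (lie_model \<xi> D)"
  then show "c \<odot>\<^bsub>lie_model \<xi> D\<^esub> x \<in> carrier (lie_model \<xi> D)"
    by (cases x) simp
qed

theorem model_isomorphic_tensor: "lie_isomorphic S (lie_model \<zeta> D) tensor"
  unfolding lie_isomorphic_iff
proof (intro exI[of _ fib] conjI ballI)
  show "bij_betw fib (carrier (lie_model \<zeta> D)) (carrier tensor)"
    unfolding bij_betw_def carrier_tensor lie_model_simps(1)
  proof (intro conjI refl inj_onI)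
    fix p q assume pq: "p \<in> base D \<times> center D" "q \<in> base D \<times> center D" "fib p = fib q"
    have "\<kappa> p \<in> fib q"
      using fib_nonempty[OF pq(1)] pq(3) by simp
    then have "\<tau> (\<kappa> p) = q"
      by (simp add: fib_def)
    then show "p = q"
      by (simp only: \<tau>_\<kappa>[OF pq(1)])
  qed
  fix p assume p: "p \<in> carrier (lie_model \<zeta> D)"
  show "fib (p \<oplus>\<^bsub>lie_model \<zeta> D\<^esub> q) = fib p \<oplus>\<^bsub>tensor\<^esub> fib q" if "q \<in> carrier (lie_model \<zeta> D)" for q
    using p that by (simp only: lie_model_simps fib_add)
  show "fib (p \<otimes>\<^bsub>lie_model \<zeta> D\<^esub> q) = fib p \<otimes>\<^bsub>tensor\<^esub> fib q" if "q \<in> carrier (lie_model \<zeta> D)" for q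
    using p that fib_bracket[of p q] by (cases p, cases q) simp
  show "fib (c \<odot>\<^bsub>lie_model \<zeta> D\<^esub> p) = c \<odot>\<^bsub>tensor\<^esub> fib p" if "c \<in> carrier S" for c
    using p fib_smult[OF that, of p] by (cases p) (simp add: pair_scale_def)
qed

lemma tensor_closed: "lie_closed S tensor"
  unfolding lie_closed_def carrier_tensor
proof (intro conjI ballI)
  fix U V assume "U \<in> fib ` (base D \<times> center D)" "V \<in> fib ` (base D \<times> center D)"
  then obtain p q where p: "p \<in> base D \<times> center D" "U = fib p" and q: "q \<in> base D \<times> center D" "V = fib q"
    by blast
  have mem: "p + q \<in> base D \<times> center D" "(0 :: nat \<Rightarrow> zhat, bracket D (fst p) (fst q)) \<in> base D \<times> center D"
    using p(1) q(1) by (simp_all add: mem_Times_iff)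
  show "U \<oplus>\<^bsub>tensor\<^esub> V \<in> fib ` (base D \<times> center D)"
    unfolding p(2) q(2) fib_add[OF p(1) q(1)] by (rule imageI[OF mem(1)])
  show "U \<otimes>\<^bsub>tensor\<^esub> V \<in> fib ` (base D \<times> center D)"
    unfolding p(2) q(2) fib_bracket[OF p(1) q(1)] by (rule imageI[OF mem(2)])
next
  fix c U assume c: "c \<in> carrier S" and "U \<in> fib ` (base D \<times> center D)"
  then obtain p where p: "p \<in> base D \<times> center D" "U = fib p"
    by blast
  show "c \<odot>\<^bsub>tensor\<^esub> U \<in> fib ` (base D \<times> center D)"
    unfolding p(2) fib_smult[OF c p(1)] using pair_scale_mem[OF p(1)] by (rule imageI)
qed

end

lemma lie_tensor_isomorphic_model:
  fixes M :: "(int, 'a, 'n) module_scheme"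
  assumes "lie_isomorphic \<Z> M (lie_model id D)" "lie_closed \<Z> M"
  shows "lie_isomorphic profinite_int (lie_tensor M profinite_int) (lie_model zhat_of_profinite D)"
    "lie_closed profinite_int (lie_tensor M profinite_int)"
proof -
  obtain l :: "'a \<Rightarrow> int vec_pair" where l: "bij_betw l (carrier M) (base D \<times> center D)"
    "\<forall>x\<in>carrier M. \<forall>y\<in>carrier M. l (x \<oplus>\<^bsub>M\<^esub> y) = l x + l y \<and>
      l (x \<otimes>\<^bsub>M\<^esub> y) = l x \<otimes>\<^bsub>lie_model id D\<^esub> l y"
    using assms(1) unfolding lie_isomorphic_iff lie_model_simps by blast
  interpret lie_coordinate_map M D l
  proof
    show "l (x \<otimes>\<^bsub>M\<^esub> y) = (0, bracket D (fst (l x)) (fst (l y)))" if "x \<in> carrier M" "y \<in> carrier M" for x y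
      using l(2) that by (cases "l x", cases "l y") simp
  qed (use l assms(2) in \<open>auto simp: lie_closed_def\<close>)
  show "lie_isomorphic profinite_int (lie_tensor M profinite_int) (lie_model zhat_of_profinite D)"
    by (rule lie_isomorphic_sym[OF model_isomorphic_tensor lie_model_closed])
  show "lie_closed profinite_int (lie_tensor M profinite_int)"
    by (rule tensor_closed)
qed

section \<open>Equality of the zeta functions\<close>

lemma card_eq_of_bij_betw:
  assumes "bij_betw \<Phi> A B" "A' \<subseteq> A" "B' \<subseteq> B" "\<And>x. x \<in> A \<Longrightarrow> x \<in> A' \<longleftrightarrow> \<Phi> x \<in> B'"
  shows "card A' = card B'"
proof -
  have "\<Phi> ` A' = B'"
  proof (intro equalityI subsetI)
    fix y assume y: "y \<in> B'"
    then have "y \<in> \<Phi> ` A"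
      using assms(1,3) by (auto simp: bij_betw_def)
    then show "y \<in> \<Phi> ` A'"
      using y assms(4) by blast
  qed (use assms(2,4) in blast)
  then have "bij_betw \<Phi> A' B'"
    by (rule bij_betw_subset[OF assms(1,2)])
  then show ?thesis
    by (rule bij_betw_same_card)
qed

lemma dirichlet_series_cong:
  "(\<And>n. n > 0 \<Longrightarrow> a n = b n) \<Longrightarrow> dirichlet_series a = dirichlet_series b"
  by (simp add: dirichlet_series_def fun_eq_iff)

theorem corollary7p6:
  fixes L :: "(int, 'a) module" and G :: "'g monoid"
  assumes "lie_algebra \<Z> L" and "lie_nilpotent_of_class 2 L" and "free_of_finite_rank L"
    and "group G" and "torsion_free_group G" and "finitely_generated_group G"
    and "group_nilpotent_of_class 2 G"
    and "lie_isomorphic \<Z> L (lie_of_group G)"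
  shows "group_zeta_iso G = lie_zeta_iso L \<and> group_zeta_pro_iso G = lie_zeta_pro_iso L \<and>
    (\<forall>n>0. card (iso_subgroups G n) = card (iso_subalgebras L n) \<and>
           card (pro_iso_subgroups G n) = card (pro_iso_subalgebras L n))"
proof -
  note lie_alg = assms(1)
  interpret L: lie_algebra \<Z> L by fact
  obtain D where D: "nondegenerate D" "G \<cong> (twisted_group D :: int vec_pair monoid)"
    "lie_isomorphic \<Z> L (lie_model id D)"
    using twist_of_group_and_lie_algebra[OF assms(1,3,4) _ assms(8)] assms(7)
    unfolding group_nilpotent_of_class_def by blast
  obtain \<Phi> where \<Phi>: "bij_betw \<Phi> {H. subgroup H G} {M. lie_subalgebra M \<Z> L}"
    and index: "\<And>H. subgroup H G \<Longrightarrow> card (a_rcosets\<^bsub>L\<^esub> (\<Phi> H)) = card (rcosets\<^bsub>G\<^esub> H)"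
    and twist: "\<And>H. subgroup H G \<Longrightarrow> card (rcosets\<^bsub>G\<^esub> H) > 0 \<Longrightarrow> \<exists>D'. nondegenerate D' \<and>
        G\<lparr>carrier := H\<rparr> \<cong> (twisted_group D' :: int vec_pair monoid) \<and>
        lie_isomorphic \<Z> (L\<lparr>carrier := \<Phi> H\<rparr>) (lie_model id D')"
    using subgroup_subalgebra_correspondence[OF D(1) assms(4) D(2) assms(1) D(3)] by blast
  have L_closed: "lie_closed \<Z> L"
    by (simp add: lie_closed_def L.bracket_closed)
  \<comment> \<open>The common twist of \<open>H\<close> and its partner reduces all four isomorphism conditions to the existence of
    a bracket isomorphism, over the integers in the first case and over the profinite integers in the
    second.\<close>
  have equivalences:
    "G\<lparr>carrier := H\<rparr> \<cong> G \<longleftrightarrow> lie_isomorphic \<Z> (L\<lparr>carrier := \<Phi> H\<rparr>) L"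
    "isomorphic_profinite_completions (G\<lparr>carrier := H\<rparr>) G \<longleftrightarrow>
      lie_isomorphic profinite_int (lie_tensor (L\<lparr>carrier := \<Phi> H\<rparr>) profinite_int)
        (lie_tensor L profinite_int)"
    if H: "subgroup H G" and fin: "card (rcosets\<^bsub>G\<^esub> H) > 0" for H
  proof -
    obtain D' where D': "nondegenerate D'" "G\<lparr>carrier := H\<rparr> \<cong> (twisted_group D' :: int vec_pair monoid)"
      "lie_isomorphic \<Z> (L\<lparr>carrier := \<Phi> H\<rparr>) (lie_model id D')"
      using twist[OF H fin] by blast
    have GH: "group (G\<lparr>carrier := H\<rparr>)"
      by (rule subgroup.subgroup_is_group[OF H assms(4)])
    have "lie_subalgebra (\<Phi> H) \<Z> L"
      using bij_betwE[OF \<Phi>] H by blast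
    then have "submodule (\<Phi> H) \<Z> L" "\<forall>x\<in>\<Phi> H. \<forall>y\<in>\<Phi> H. x \<otimes>\<^bsub>L\<^esub> y \<in> \<Phi> H"
      by (simp_all add: lie_subalgebra_def)
    then have M_closed: "lie_closed \<Z> (L\<lparr>carrier := \<Phi> H\<rparr>)"
      using L.submoduleE(5) submodule.smult_closed by (fastforce simp: lie_closed_def)
    have "G\<lparr>carrier := H\<rparr> \<cong> G \<longleftrightarrow>
        (twisted_group D' :: int vec_pair monoid) \<cong> (twisted_group D :: int vec_pair monoid)"
      using D(2) D'(2) iso_trans group.iso_sym[OF GH D'(2)] group.iso_sym[OF assms(4) D(2)] by metis
    also have "\<dots> \<longleftrightarrow> lie_isomorphic \<Z> (lie_model (id :: int \<Rightarrow> int) D') (lie_model id D)"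
      unfolding twisted_groups_isomorphic_iff[OF D'(1) D(1)] lie_models_isomorphic_iff[OF D'(1) D(1)] ..
    also have "\<dots> \<longleftrightarrow> lie_isomorphic \<Z> (L\<lparr>carrier := \<Phi> H\<rparr>) L"
      by (rule lie_isomorphic_cong[OF D'(3) D(3) M_closed L_closed, symmetric])
    finally show "G\<lparr>carrier := H\<rparr> \<cong> G \<longleftrightarrow> lie_isomorphic \<Z> (L\<lparr>carrier := \<Phi> H\<rparr>) L" .
    have "isomorphic_profinite_completions (G\<lparr>carrier := H\<rparr>) G \<longleftrightarrow>
        (twisted_group D' :: zhat vec_pair monoid) \<cong> (twisted_group D :: zhat vec_pair monoid)"
      by (rule isomorphic_profinite_completions_iff[OF GH D'(2) assms(4) D(2)])
    also have "\<dots> \<longleftrightarrow>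
        lie_isomorphic profinite_int (lie_model zhat_of_profinite D') (lie_model zhat_of_profinite D)"
      unfolding twisted_groups_isomorphic_iff[OF D'(1) D(1)] lie_models_isomorphic_iff[OF D'(1) D(1)] ..
    also have "\<dots> \<longleftrightarrow> lie_isomorphic profinite_int
        (lie_tensor (L\<lparr>carrier := \<Phi> H\<rparr>) profinite_int) (lie_tensor L profinite_int)"
      by (rule lie_isomorphic_cong[symmetric]; rule lie_tensor_isomorphic_model)
        (rule D'(3) D(3) M_closed L_closed)+
    finally show "isomorphic_profinite_completions (G\<lparr>carrier := H\<rparr>) G \<longleftrightarrow>
        lie_isomorphic profinite_int (lie_tensor (L\<lparr>carrier := \<Phi> H\<rparr>) profinite_int)
          (lie_tensor L profinite_int)" .
  qed
  \<comment> \<open>Subgroups of infinite index have index 0 here and are excluded by \<open>n > 0\<close>.\<close>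
  have iso: "card (iso_subgroups G n) = card (iso_subalgebras L n)" if "n > 0" for n
    unfolding iso_subgroups_def iso_subalgebras_def
    by (rule card_eq_of_bij_betw[OF \<Phi>])
      (use that index equivalences(1) bij_betwE[OF \<Phi>] in auto)
  have pro: "card (pro_iso_subgroups G n) = card (pro_iso_subalgebras L n)" if "n > 0" for n
    unfolding pro_iso_subgroups_def pro_iso_subalgebras_def
    by (rule card_eq_of_bij_betw[OF \<Phi>])
      (use that index equivalences(2) bij_betwE[OF \<Phi>] in auto)
  have "group_zeta_iso G = lie_zeta_iso L"
    unfolding group_zeta_iso_def lie_zeta_iso_def by (rule dirichlet_series_cong[OF iso])
  moreover have "group_zeta_pro_iso G = lie_zeta_pro_iso L"
    unfolding group_zeta_pro_iso_def lie_zeta_pro_iso_def by (rule dirichlet_series_cong[OF pro])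
  ultimately show ?thesis
    using iso pro by blast
qed

end
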